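(* Let $n\in\mathbf N$ and $A\in\mathbb G^\infty_{n\times n}$. The differential equation $$x'-A(t)x=0$$ has no solutions in the space $\mathcal R^{n\prime}$ other than the classical ones; i.e., every solution $x\in\mathcal R^{n\prime}$ is the regular distribution given by a locally absolutely continuous function $x:I\to\mathbf C^n$ satisfying $x'(t)=A(t)x(t)$ for almost every $t\in I$.
   Context: $I=(a,b)\subset\mathbf R$ is an open interval (e.g. $I=\mathbf R$), $\mathbf N_0=\mathbf N\cup\{0\}$; functions are identified when equal almost everywhere. $\mathbb G$ is the algebra of essentially bounded $g:I\to\mathbf C$ possessing both limits $g(t\pm)=\operatorname{ess\,lim}_{s\to t\pm}g(s)$ at every $t\in I$; $\sigma_t(g):=g(t+)-g(t-)$. $\mathbb G^\infty$ is the algebra of $g\in\mathbb G$ such that for every $k\in\mathbf N$ there is $g^{(k)}\in\mathbb G$ with $g^{(k)}(t\pm)=\operatorname{ess\,lim}_{s\to t\pm}\frac{g^{(k-1)}(s)-g^{(k-1)}(t\pm)}{s-t}$ for all $t\in I$ ($g^{(0)}=g$), with the norms $\|g\|_k=\max_{0\le i\le k}\|g^{(i)}\|_{L_\infty}$, $k\in\mathbf N_0$. $\mathcal R$ is the space of $\varphi\in\mathbb G^\infty$ with compact support in $I$, with the locally convex inductive limit topology of the countably normed spaces $\{\varphi\in\mathbb G^\infty:\varphi=0\text{ outside }J\}$ (norms $\|\cdot\|_k$), $J$ running over bounded subintervals with $\bar J\subset I$. $\mathcal R'$ is the space of continuous linear functionals $f:\mathcal R\to\mathbf C$, $\varphi\mapsto(f,\varphi)$,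 with the weak* topology. A locally summable function $f$ is identified with the (regular) distribution $(f,\varphi)=\int_I f\varphi\,dt$. For $g\in\mathbb G^\infty$, $f\in\mathcal R'$: $(gf,\varphi):=(f,g\varphi)$. Derivative: let $\mathbb C$ be the bounded continuous functions on $I$; $\mathbb F_k\subset\mathbb G^\infty$ is the set of $g$ with $g^{(i)}\in\mathbb C$ for all $i\ne k$ and $g^{(k)}$ piecewise continuous (locally finitely many discontinuities); $\mathbb F$ is the linear span of all $\mathbb F_k$, $k\in\mathbf N_0$; $\mathcal R_F=\mathcal R\cap\mathbb F$. $\Delta\subset\mathcal R'$ is the set of $g\in\mathcal R'$ for which there is $c:I\to\mathbf C$ with $(g,\varphi)=\sum_{t\in I}c(t)\sigma_t(\varphi)$ for all $\varphi\in\mathcal R_F$ (a finite sum). For $f\in\mathcal R'$ let $(\frac{df}{dt},\varphi):=-(f,\varphi')$; a derivative of $f$ is any element $f'$ of $D(f):=\frac{df}{dt}+\Delta$ (differentiation is multivalued). $\mathcal R^{n\prime}$ is the space of $\mathbf C^n$-valued distributions ($n$-tuples of elements of $\mathcal R'$, operations componentwise), and $\mathbb G^\infty_{n\times n}$ the $n\times n$ matrices with entries in $\mathbb G^\infty$. A solution of $x'-A(t)x=0$ is $x\in\mathcal R^{n\prime}$ having some derivative $x'\in D(x)$ (componentwise) with $(x',\varphi)=(Ax,\varphi)$ for all $\varphi\in\mathcal R$. *)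

theory Defs
  imports "HOL-Analysis.Analysis" "HOL-Probability.Essential_Supremum"
begin

text \<open>
  Throughout, \<open>I\<close> is an open interval of the real line and a function on \<open>I\<close> is represented by some
  \<open>g :: real \<Rightarrow> complex\<close>, whose values outside \<open>I\<close> and on null sets carry no information:
  functions are identified when they satisfy \<open>ae_eq I\<close>, and all notions below respect this.
\<close>

definition ae_eq :: "real set \<Rightarrow> (real \<Rightarrow> complex) \<Rightarrow> (real \<Rightarrow> complex) \<Rightarrow> bool" where
  "ae_eq I g h \<longleftrightarrow> (AE t in lebesgue_on I. g t = h t)"

subsection \<open>Regulated functions\<close>

text \<open>A property holds eventually for \<open>ess_right t\<close> iff, for some \<open>d > 0\<close>, it holds at almost every
  point of \<open>(t, t + d)\<close>; so convergence along this filter is the essential one-sided limit.\<close>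

definition ess_right :: "real \<Rightarrow> real filter" where
  "ess_right t = inf (at_right t) (ae_filter lebesgue)"

definition ess_left :: "real \<Rightarrow> real filter" where
  "ess_left t = inf (at_left t) (ae_filter lebesgue)"

definition rlim :: "(real \<Rightarrow> complex) \<Rightarrow> real \<Rightarrow> complex" where
  "rlim g t = Lim (ess_right t) g"

definition llim :: "(real \<Rightarrow> complex) \<Rightarrow> real \<Rightarrow> complex" where
  "llim g t = Lim (ess_left t) g"

definition jump :: "real \<Rightarrow> (real \<Rightarrow> complex) \<Rightarrow> complex" where
  "jump t g = rlim g t - llim g t"

definition GG :: "real set \<Rightarrow> (real \<Rightarrow> complex) set" where
  "GG I = {g. g \<in> borel_measurable (lebesgue_on I)
            \<and> (\<exists>B. AE t in lebesgue_on I. norm (g t) \<le> B)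
            \<and> (\<forall>t\<in>I. (\<exists>l. (g \<longlongrightarrow> l) (ess_right t)) \<and> (\<exists>l. (g \<longlongrightarrow> l) (ess_left t)))}"

definition G_deriv :: "real set \<Rightarrow> (real \<Rightarrow> complex) \<Rightarrow> (real \<Rightarrow> complex) \<Rightarrow> bool" where
  "G_deriv I g h \<longleftrightarrow> g \<in> GG I \<and> h \<in> GG I \<and>
     (\<forall>t\<in>I. ((\<lambda>s. (g s - rlim g t) / of_real (s - t)) \<longlongrightarrow> rlim h t) (ess_right t)
          \<and> ((\<lambda>s. (g s - llim g t) / of_real (s - t)) \<longlongrightarrow> llim h t) (ess_left t))"

definition G_infty :: "real set \<Rightarrow> (real \<Rightarrow> complex) set" where
  "G_infty I = {g \<in> GG I. \<exists>d :: nat \<Rightarrow> real \<Rightarrow> complex. d 0 = g \<and> (\<forall>k. G_deriv I (d k) (d (Suc k)))}"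

text \<open>A function in \<open>GG I\<close> is almost everywhere equal to its one-sided limits, so the derivative
  is unique up to \<open>ae_eq I\<close>; the choice below picks a representative.\<close>

definition gder :: "real set \<Rightarrow> (real \<Rightarrow> complex) \<Rightarrow> real \<Rightarrow> complex" where
  "gder I g = (SOME h. G_deriv I g h)"

definition gders :: "real set \<Rightarrow> nat \<Rightarrow> (real \<Rightarrow> complex) \<Rightarrow> real \<Rightarrow> complex" where
  "gders I k g = (gder I ^^ k) g"

definition Linf_norm :: "real set \<Rightarrow> (real \<Rightarrow> complex) \<Rightarrow> real" where
  "Linf_norm I g = real_of_ereal (esssup (lebesgue_on I) (\<lambda>t. ereal (norm (g t))))"

definition gnorm :: "real set \<Rightarrow> nat \<Rightarrow> (real \<Rightarrow> complex) \<Rightarrow> real" where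
  "gnorm I k g = Max ((\<lambda>i. Linf_norm I (gders I i g)) ` {0..k})"

subsection \<open>Test functions and their topology\<close>

definition RR :: "real set \<Rightarrow> (real \<Rightarrow> complex) set" where
  "RR I = {\<phi> \<in> G_infty I. \<exists>K. compact K \<and> K \<subseteq> I \<and> (AE t in lebesgue_on I. t \<notin> K \<longrightarrow> \<phi> t = 0)}"

definition RR_on :: "real set \<Rightarrow> real set \<Rightarrow> (real \<Rightarrow> complex) set" where
  "RR_on I J = {\<phi> \<in> G_infty I. AE t in lebesgue_on I. t \<notin> J \<longrightarrow> \<phi> t = 0}"

definition admissible_subinterval :: "real set \<Rightarrow> real set \<Rightarrow> bool" where
  "admissible_subinterval I J \<longleftrightarrow> is_interval J \<and> bounded J \<and> closure J \<subseteq> I"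

text \<open>The basic neighbourhoods of zero in the locally convex inductive limit are the absolutely
  convex sets that meet every step \<open>RR_on I J\<close> in a neighbourhood of zero of that step. The norms
  \<open>gnorm I k\<close> increase with \<open>k\<close>, so balls of single norms form a neighbourhood base in the steps.\<close>

definition RR_zero_nhd :: "real set \<Rightarrow> (real \<Rightarrow> complex) set \<Rightarrow> bool" where
  "RR_zero_nhd I U \<longleftrightarrow> U \<subseteq> RR I
     \<and> (\<forall>\<phi>\<in>U. \<forall>\<psi>\<in>U. \<forall>\<alpha> \<beta> :: complex. norm \<alpha> + norm \<beta> \<le> 1 \<longrightarrow> (\<lambda>t. \<alpha> * \<phi> t + \<beta> * \<psi> t) \<in> U)
     \<and> (\<forall>J. admissible_subinterval I J \<longrightarrow>
          (\<exists>k. \<exists>e>0. {\<phi> \<in> RR_on I J. gnorm I k \<phi> < e} \<subseteq> U))"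

definition RR_openin :: "real set \<Rightarrow> (real \<Rightarrow> complex) set \<Rightarrow> bool" where
  "RR_openin I W \<longleftrightarrow> W \<subseteq> RR I \<and>
     (\<forall>\<phi>\<in>W. \<exists>U. RR_zero_nhd I U \<and> (\<lambda>\<psi> t. \<phi> t + \<psi> t) ` U \<subseteq> W)"

definition RR_topology :: "real set \<Rightarrow> (real \<Rightarrow> complex) topology" where
  "RR_topology I = topology (RR_openin I)"

lemma gnorm_mono: "k \<le> l \<Longrightarrow> gnorm I k g \<le> gnorm I l g"
  unfolding gnorm_def by (rule Max_mono) auto

lemma RR_zero_nhd_Int:
  assumes "RR_zero_nhd I U" "RR_zero_nhd I V"
  shows "RR_zero_nhd I (U \<inter> V)"
proof -
  have "\<exists>k. \<exists>e>0. {\<phi> \<in> RR_on I J. gnorm I k \<phi> < e} \<subseteq> U \<inter> V"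
    if J: "admissible_subinterval I J" for J
  proof -
    obtain k e where 1: "e > 0" "{\<phi> \<in> RR_on I J. gnorm I k \<phi> < e} \<subseteq> U"
      using assms(1) J unfolding RR_zero_nhd_def by meson
    obtain l d where 2: "d > 0" "{\<phi> \<in> RR_on I J. gnorm I l \<phi> < d} \<subseteq> V"
      using assms(2) J unfolding RR_zero_nhd_def by meson
    have "\<phi> \<in> U \<inter> V" if \<phi>: "\<phi> \<in> RR_on I J" "gnorm I (max k l) \<phi> < min e d" for \<phi>
    proof -
      have "gnorm I k \<phi> < e" "gnorm I l \<phi> < d"
        using \<phi>(2) gnorm_mono[of k "max k l" I \<phi>] gnorm_mono[of l "max k l" I \<phi>] by auto
      with 1 2 \<phi>(1) show ?thesis by auto
    qed
    with 1(1) 2(1) show ?thesis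
      by (intro exI[of _ "max k l"] exI[of _ "min e d"]) auto
  qed
  with assms show ?thesis
    unfolding RR_zero_nhd_def by blast
qed

lemma istopology_RR_openin: "istopology (RR_openin I)"
  unfolding istopology_def
proof (intro conjI allI impI)
  fix S T assume S: "RR_openin I S" and T: "RR_openin I T"
  show "RR_openin I (S \<inter> T)"
    unfolding RR_openin_def
  proof (intro conjI ballI)
    show "S \<inter> T \<subseteq> RR I" using S unfolding RR_openin_def by blast
    fix \<phi> assume "\<phi> \<in> S \<inter> T"
    then obtain U V where "RR_zero_nhd I U" "(\<lambda>\<psi> t. \<phi> t + \<psi> t) ` U \<subseteq> S"
      and "RR_zero_nhd I V" "(\<lambda>\<psi> t. \<phi> t + \<psi> t) ` V \<subseteq> T"
      using S T unfolding RR_openin_def by blast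
    then show "\<exists>U. RR_zero_nhd I U \<and> (\<lambda>\<psi> t. \<phi> t + \<psi> t) ` U \<subseteq> S \<inter> T"
      by (intro exI[of _ "U \<inter> V"]) (auto intro: RR_zero_nhd_Int)
  qed
next
  fix \<K> assume K: "\<forall>K\<in>\<K>. RR_openin I K"
  show "RR_openin I (\<Union>\<K>)"
    unfolding RR_openin_def
  proof (intro conjI ballI)
    show "\<Union>\<K> \<subseteq> RR I" using K unfolding RR_openin_def by blast
    fix \<phi> assume "\<phi> \<in> \<Union>\<K>"
    then obtain S where "S \<in> \<K>" "\<phi> \<in> S" by blast
    then show "\<exists>U. RR_zero_nhd I U \<and> (\<lambda>\<psi> t. \<phi> t + \<psi> t) ` U \<subseteq> \<Union>\<K>"
      using K unfolding RR_openin_def by (meson Union_upper order_trans)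
  qed
qed

lemma openin_RR_topology: "openin (RR_topology I) = RR_openin I"
  by (simp add: RR_topology_def istopology_RR_openin)

subsection \<open>Distributions\<close>

type_synonym cdistr = "(real \<Rightarrow> complex) \<Rightarrow> complex"

text \<open>Only the values on \<open>RR I\<close> matter. The second clause says that the functional is defined
  on classes of almost everywhere equal test functions.\<close>

definition RR_dual :: "real set \<Rightarrow> cdistr set" where
  "RR_dual I = {f.
     (\<forall>\<phi>\<in>RR I. \<forall>\<psi>\<in>RR I. \<forall>\<alpha> \<beta>. f (\<lambda>t. \<alpha> * \<phi> t + \<beta> * \<psi> t) = \<alpha> * f \<phi> + \<beta> * f \<psi>)
   \<and> (\<forall>\<phi>\<in>RR I. \<forall>\<psi>\<in>RR I. ae_eq I \<phi> \<psi> \<longrightarrow> f \<phi> = f \<psi>)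
   \<and> continuous_map (RR_topology I) euclidean f}"

definition locally_summable :: "real set \<Rightarrow> (real \<Rightarrow> complex) \<Rightarrow> bool" where
  "locally_summable I u \<longleftrightarrow> (\<forall>K. compact K \<and> K \<subseteq> I \<longrightarrow> set_integrable lebesgue K u)"

definition is_regular_distr :: "real set \<Rightarrow> cdistr \<Rightarrow> (real \<Rightarrow> complex) \<Rightarrow> bool" where
  "is_regular_distr I f u \<longleftrightarrow> locally_summable I u \<and>
     (\<forall>\<phi>\<in>RR I. f \<phi> = (LINT t|lebesgue_on I. u t * \<phi> t))"

definition mult_distr :: "(real \<Rightarrow> complex) \<Rightarrow> cdistr \<Rightarrow> cdistr" where
  "mult_distr g f = (\<lambda>\<phi>. f (\<lambda>t. g t * \<phi> t))"

subsection \<open>Multivalued differentiation\<close>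

definition bdd_continuous :: "real set \<Rightarrow> (real \<Rightarrow> complex) set" where
  "bdd_continuous I = {g. \<exists>h. ae_eq I g h \<and> continuous_on I h \<and> bounded (h ` I)}"

definition piecewise_continuous :: "real set \<Rightarrow> (real \<Rightarrow> complex) set" where
  "piecewise_continuous I =
     {g. \<exists>h. ae_eq I g h \<and> (\<forall>K. compact K \<and> K \<subseteq> I \<longrightarrow> finite {t \<in> K. \<not> isCont h t})}"

definition FF_k :: "real set \<Rightarrow> nat \<Rightarrow> (real \<Rightarrow> complex) set" where
  "FF_k I k = {g \<in> G_infty I. (\<forall>i. i \<noteq> k \<longrightarrow> gders I i g \<in> bdd_continuous I)
                             \<and> gders I k g \<in> piecewise_continuous I}"

definition FF :: "real set \<Rightarrow> (real \<Rightarrow> complex) set" where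
  "FF I = {(\<lambda>t. \<Sum>g\<in>P. c g * g t) | P (c :: (real \<Rightarrow> complex) \<Rightarrow> complex).
             finite P \<and> P \<subseteq> (\<Union>k. FF_k I k)}"

definition RR_F :: "real set \<Rightarrow> (real \<Rightarrow> complex) set" where
  "RR_F I = RR I \<inter> FF I"

text \<open>Elements of \<open>RR_F I\<close> have finitely many nonzero jumps, so the sum is finite.\<close>

definition Delta :: "real set \<Rightarrow> cdistr set" where
  "Delta I = {g \<in> RR_dual I. \<exists>c :: real \<Rightarrow> complex. \<forall>\<phi>\<in>RR_F I.
                g \<phi> = (\<Sum>t | t \<in> I \<and> jump t \<phi> \<noteq> 0. c t * jump t \<phi>)}"

definition ddt :: "real set \<Rightarrow> cdistr \<Rightarrow> cdistr" where
  "ddt I f = (\<lambda>\<phi>. - f (gder I \<phi>))"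

definition DD :: "real set \<Rightarrow> cdistr \<Rightarrow> cdistr set" where
  "DD I f = {(\<lambda>\<phi>. ddt I f \<phi> + g \<phi>) | g. g \<in> Delta I}"

subsection \<open>The equation\<close>

definition mat_mult_distr :: "(real \<Rightarrow> complex^'n^'n) \<Rightarrow> cdistr^'n \<Rightarrow> cdistr^'n" where
  "mat_mult_distr A x = (\<chi> i. (\<lambda>\<phi>. \<Sum>j\<in>UNIV. mult_distr (\<lambda>t. A t $ i $ j) (x $ j) \<phi>))"

definition distr_solution :: "real set \<Rightarrow> (real \<Rightarrow> complex^'n^'n) \<Rightarrow> cdistr^'n \<Rightarrow> bool" where
  "distr_solution I A x \<longleftrightarrow> (\<forall>i. x $ i \<in> RR_dual I) \<and>
     (\<exists>x' :: cdistr^'n. (\<forall>i. x' $ i \<in> DD I (x $ i)) \<and>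
        (\<forall>\<phi>\<in>RR I. \<forall>i. (x' $ i) \<phi> = (mat_mult_distr A x $ i) \<phi>))"

definition abs_continuous_on_interval :: "real \<Rightarrow> real \<Rightarrow> (real \<Rightarrow> 'a::real_normed_vector) \<Rightarrow> bool" where
  "abs_continuous_on_interval c d u \<longleftrightarrow> (\<forall>e>0. \<exists>\<delta>>0. \<forall>P :: (real \<times> real) set.
     finite P \<and> (\<forall>(p, q)\<in>P. c \<le> p \<and> p \<le> q \<and> q \<le> d)
       \<and> disjoint_family_on (\<lambda>(p, q). {p<..<q}) P \<and> (\<Sum>(p, q)\<in>P. q - p) < \<delta>
     \<longrightarrow> (\<Sum>(p, q)\<in>P. norm (u q - u p)) < e)"

definition locally_abs_continuous :: "real set \<Rightarrow> (real \<Rightarrow> 'a::real_normed_vector) \<Rightarrow> bool" where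
  "locally_abs_continuous I u \<longleftrightarrow> (\<forall>c d. {c..d} \<subseteq> I \<longrightarrow> abs_continuous_on_interval c d u)"

definition classical_solution :: "real set \<Rightarrow> (real \<Rightarrow> complex^'n^'n) \<Rightarrow> (real \<Rightarrow> complex^'n) \<Rightarrow> bool" where
  "classical_solution I A u \<longleftrightarrow> locally_abs_continuous I u \<and>
     (AE t in lebesgue_on I. (u has_vector_derivative (A t *v u t)) (at t))"

end

theory Submission
  imports Defs
begin

text \<open>
  Write the equation as \<open>- x i (\<phi>') + g i \<phi> = (\<Sum>j. x j (a i j * \<phi>))\<close> with \<open>g i\<close> in \<open>Delta\<close> given by jump
  weights \<open>c i\<close>, and put \<open>u i = - c i\<close>. Every \<open>\<psi> \<in> G_infty\<close> is, on a segment, a limit of piecewise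
  polynomials together with all derivatives up to the order of \<open>g i\<close>, and a polynomial cut to a segment
  lies in \<open>RR_F\<close>; so \<open>g i\<close> is known on all primitives cut to \<open>[s, T)\<close>. Inserting such a primitive \<open>V \<psi>\<close>
  gives \<open>x i \<psi> = u i T * \<integral>\<psi> - (\<Sum>j. x j (a i j * V \<psi>))\<close>. Since \<open>V\<close> gains a derivative, this identity
  lowers the order of \<open>x\<close> on the segment step by step to zero, and then shows that \<open>x i\<close> and
  \<open>\<psi> \<mapsto> \<integral>(u i * \<psi>)\<close> differ on \<open>[p, q)\<close> by \<open>O((q - p)\<^sup>2)\<close>, hence coincide. Finally the indicator of
  \<open>[p, q)\<close> as test function yields \<open>u i q - u i p = \<integral>(\<Sum>j. a i j * u j)\<close> over \<open>[p, q)\<close>.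
\<close>

section \<open>One-sided essential limits\<close>

text \<open>A functional in \<open>Delta\<close> is prescribed on \<open>RR_F\<close> only, while a
  test function may jump at infinitely many points; hence the detour through approximation, paid for
  by the finite order of \<open>g i\<close> on a segment. That cut polynomials lie in
  \<open>RR_F\<close> is itself not immediate: they have to be combined from functions in which a
  single derivative is discontinuous and every derivative is bounded on all of \<open>I\<close>, so
  on an infinite interval truncated powers are ruled out. Logistic functions supply bounded
  substitutes, and their smooth parts cancel in the difference of the steps at the two endpoints. A
  primitive that starts at 0 and is cut at \<open>T\<close> jumps only at \<open>T\<close>, by minus
  its integral; this is the origin of the sign in \<open>u i = - c i\<close>. Order zero alone would
  still allow point masses such as a one-sided value at a point. They are excluded by applying the
  identity on a fixed segment to functions supported in a small part \<open>[p, q)\<close>: the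
  primitive is then of size \<open>q - p\<close>, which makes the later error quadratic.\<close>

definition ess_side :: "bool \<Rightarrow> real \<Rightarrow> real filter" where
  "ess_side b t = (if b then ess_right t else ess_left t)"

definition slim :: "bool \<Rightarrow> (real \<Rightarrow> complex) \<Rightarrow> real \<Rightarrow> complex" where
  "slim b g t = Lim (ess_side b t) g"

text \<open>The Boolean is \<open>True\<close> for the right and \<open>False\<close> for the left
  throughout, so that each one-sided statement is proved once for both sides.\<close>

definition side :: "bool \<Rightarrow> real \<Rightarrow> real \<Rightarrow> real set" where
  "side b t d = (if b then {t<..<t+d} else {t-d<..<t})"

lemma slim_True: "slim True = rlim" and slim_False: "slim False = llim"
  by (auto simp: fun_eq_iff slim_def rlim_def llim_def ess_side_def)

text \<open>Unfolds the infimum of filters: the one-sided filter supplies the interval, the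
  almost-everywhere filter the null exceptional set. The auxiliary fact \<open>R\<close> is stated
  for an arbitrary neighbourhood base so as to serve both sides.\<close>

lemma eventually_ess_side:
  "eventually P (ess_side b t) \<longleftrightarrow> (\<exists>d>0. AE s in lebesgue. s \<in> side b t d \<longrightarrow> P s)"
proof -
  have R: "eventually P (inf F (ae_filter lebesgue)) \<longleftrightarrow> (\<exists>d>0. AE s in lebesgue. s \<in> N d \<longrightarrow> P s)"
    if F: "\<And>Q. eventually Q F \<longleftrightarrow> (\<exists>d>0. \<forall>s\<in>N d. Q s)" for F :: "real filter" and N :: "real \<Rightarrow> real set"
  proof
    assume "eventually P (inf F (ae_filter lebesgue))"
    then obtain Q R where Q: "eventually Q F" and R: "eventually R (ae_filter lebesgue)"
      and QR: "\<forall>s. Q s \<and> R s \<longrightarrow> P s" by (auto simp: eventually_inf)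
    obtain d where d: "d > 0" "\<forall>s\<in>N d. Q s" using Q F by blast
    have "AE s in lebesgue. s \<in> N d \<longrightarrow> P s" using R by eventually_elim (use QR d in auto)
    then show "\<exists>d>0. AE s in lebesgue. s \<in> N d \<longrightarrow> P s" using d by blast
  next
    assume "\<exists>d>0. AE s in lebesgue. s \<in> N d \<longrightarrow> P s"
    then obtain d where d: "d > 0" "AE s in lebesgue. s \<in> N d \<longrightarrow> P s" by blast
    have "eventually (\<lambda>s. s \<in> N d) F" using F d by blast
    then show "eventually P (inf F (ae_filter lebesgue))"
      unfolding eventually_inf using d(2) by blast
  qed
  have 1: "eventually Q (at_right t) \<longleftrightarrow> (\<exists>d>0. \<forall>s\<in>{t<..<t+d}. Q s)" for Q
    unfolding eventually_at_right_field
  proof (rule iffI; clarsimp)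
    fix c assume "c > t" "\<forall>y>t. y < c \<longrightarrow> Q y"
    then show "\<exists>d>0. \<forall>s\<in>{t<..<t+d}. Q s" by (intro exI[of _ "c-t"]) auto
  next
    fix d :: real assume "0 < d" "\<forall>s\<in>{t<..<t+d}. Q s"
    then show "\<exists>c>t. \<forall>y>t. y < c \<longrightarrow> Q y" by (intro exI[of _ "t+d"]) auto
  qed
  have 2: "eventually Q (at_left t) \<longleftrightarrow> (\<exists>d>0. \<forall>s\<in>{t-d<..<t}. Q s)" for Q
    unfolding eventually_at_left_field
  proof (rule iffI; clarsimp)
    fix c assume "c < t" "\<forall>y>c. y < t \<longrightarrow> Q y"
    then show "\<exists>d>0. \<forall>s\<in>{t-d<..<t}. Q s" by (intro exI[of _ "t-c"]) auto
  next
    fix d :: real assume "0 < d" "\<forall>s\<in>{t-d<..<t}. Q s"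
    then show "\<exists>c<t. \<forall>y>c. y < t \<longrightarrow> Q y" by (intro exI[of _ "t-d"]) auto
  qed
  show ?thesis
    using R[of "at_right t" "\<lambda>d. {t<..<t+d}"] R[of "at_left t" "\<lambda>d. {t-d<..<t}"] 1 2
    by (auto simp: ess_side_def ess_right_def ess_left_def side_def)
qed

lemma open_side [simp]: "open (side b t d)" by (simp add: side_def)

text \<open>An interval of positive length is not a null set. Uniqueness of essential limits rests
  on this.\<close>

lemma ess_side_not_bot [simp]: "ess_side b t \<noteq> bot"
proof
  assume "ess_side b t = bot"
  then have "eventually (\<lambda>_. False) (ess_side b t)" by simp
  then obtain d where d: "d > 0" "AE s in lebesgue. s \<notin> side b t d"
    by (auto simp: eventually_ess_side)
  then have "side b t d \<in> null_sets lebesgue"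
    by (subst AE_iff_null_sets) auto
  then have "emeasure lebesgue (side b t d) = 0" by auto
  with d show False by (cases b) (auto simp: side_def)
qed

lemma ess_side_eventually_at: "eventually P (at t) \<Longrightarrow> eventually P (ess_side b t)"
  by (cases b) (auto simp: ess_side_def ess_right_def ess_left_def eventually_at_split
      intro: filter_leD[OF inf_le1])

lemma ess_side_tendsto_at: "(f \<longlongrightarrow> l) (at t) \<Longrightarrow> (f \<longlongrightarrow> l) (ess_side b t)"
  by (auto simp: filterlim_iff intro: ess_side_eventually_at)

lemma slimI: "(g \<longlongrightarrow> l) (ess_side b t) \<Longrightarrow> slim b g t = l"
  unfolding slim_def by (rule tendsto_Lim) auto

lemma slim_cong_ev:
  assumes "eventually (\<lambda>s. g s = h s) (ess_side b t)"
  shows "slim b g t = slim b h t"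
proof -
  have "(g \<longlongrightarrow> l) (ess_side b t) \<longleftrightarrow> (h \<longlongrightarrow> l) (ess_side b t)" for l
    by (rule tendsto_cong[OF assms])
  then show ?thesis unfolding slim_def t2_space_class.Lim_def by simp
qed

lemma has_vector_derivative_complex_iff:
  "(f has_vector_derivative (D::complex)) (at t) \<longleftrightarrow> ((\<lambda>s. (f s - f t) / of_real (s - t)) \<longlongrightarrow> D) (at t)"
proof -
  have "eventually (\<lambda>s. norm (f s - f t - (s - t) *\<^sub>R D) / norm (s - t) = norm ((f s - f t) / of_real (s - t) - D)) (at t)"
  proof (rule eventually_at_filter[THEN iffD2], rule always_eventually, safe)
    fix s assume "s \<noteq> t"
    then have "(f s - f t) / of_real (s - t) - D = (f s - f t - (s - t) *\<^sub>R D) / of_real (s - t)"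
      by (simp add: field_simps scaleR_conv_of_real)
    then show "norm (f s - f t - (s - t) *\<^sub>R D) / norm (s - t) = norm ((f s - f t) / of_real (s - t) - D)"
      by (simp only: norm_divide norm_of_real real_norm_def)
  qed
  from tendsto_cong[OF this, of 0]
  show ?thesis unfolding has_vector_derivative_def has_derivative_iff_norm tendsto_norm_zero_iff
    by (simp only: bounded_linear_scaleR_left LIM_zero_iff simp_thms)
qed

section \<open>Regulated functions on an open interval\<close>

locale line_interval =
  fixes I :: "real set"
  assumes open_I: "open I" and interval_I: "is_interval I"
begin

lemma I_sets [simp, measurable]: "I \<in> sets lebesgue"
  using open_I by simp

lemma cIcc_I: "s \<in> I \<Longrightarrow> t \<in> I \<Longrightarrow> {s..t} \<subseteq> I"
  using interval_I unfolding is_interval_1 by (meson atLeastAtMost_iff subsetI)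

lemma AE_I: "(AE t in lebesgue_on I. P t) \<longleftrightarrow> (AE t in lebesgue. t \<in> I \<longrightarrow> P t)"
  by (rule AE_restrict_space_iff) simp

lemma side_subset_I: "t \<in> I \<Longrightarrow> \<exists>d>0. \<forall>d'\<le>d. side b t d' \<subseteq> I"
proof -
  assume "t \<in> I"
  then obtain d where "d > 0" "ball t d \<subseteq> I" using open_I open_contains_ball by blast
  then show ?thesis
    by (intro exI[of _ d]) (auto simp: side_def dist_real_def subset_iff split: if_splits)
qed

lemma eventually_in_I: "t \<in> I \<Longrightarrow> eventually (\<lambda>s. s \<in> I) (ess_side b t)"
  by (rule ess_side_eventually_at) (simp add: open_I eventually_at_in_open')

lemma ev_of_AE: "AE s in lebesgue_on I. P s \<Longrightarrow> t \<in> I \<Longrightarrow> eventually P (ess_side b t)"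
proof -
  assume A: "AE s in lebesgue_on I. P s" and t: "t \<in> I"
  obtain d where "d > 0" "side b t d \<subseteq> I" using side_subset_I[OF t] by blast
  with A show ?thesis unfolding eventually_ess_side AE_I
    by (intro exI[of _ d]) (auto elim!: eventually_mono)
qed

text \<open>By Lindelof countably many of the balls cover \<open>I\<close>, so the exceptional null
  sets add up to a null set. The centre of a ball belongs to neither side, but it is a single
  point.\<close>

lemma AE_local:
  assumes "\<And>t b. t \<in> I \<Longrightarrow> eventually P (ess_side b t)"
  shows "AE t in lebesgue_on I. P t"
proof -
  have "\<exists>d>0. AE s in lebesgue. s \<in> ball t d \<longrightarrow> P s" if tI: "t \<in> I" for t
  proof -
    obtain d1 where d1: "d1 > 0" "AE s in lebesgue. s \<in> side True t d1 \<longrightarrow> P s"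
      using assms[OF tI, of True] unfolding eventually_ess_side by auto
    obtain d2 where d2: "d2 > 0" "AE s in lebesgue. s \<in> side False t d2 \<longrightarrow> P s"
      using assms[OF tI, of False] unfolding eventually_ess_side by auto
    have "AE s in lebesgue. s \<noteq> t" using AE_not_in[of "{t}" lebesgue] by (auto elim: eventually_mono)
    with d1(2) d2(2) have "AE s in lebesgue. s \<in> ball t (min d1 d2) \<longrightarrow> P s"
      by eventually_elim (auto simp: side_def dist_real_def)
    with d1 d2 show ?thesis by (intro exI[of _ "min d1 d2"]) auto
  qed
  then obtain d where d: "\<And>t. t \<in> I \<Longrightarrow> d t > 0" "\<And>t. t \<in> I \<Longrightarrow> AE s in lebesgue. s \<in> ball t (d t) \<longrightarrow> P s"
    by metis
  obtain F' where F': "F' \<subseteq> (\<lambda>t. ball t (d t)) ` I" "countable F'" "\<Union>F' = \<Union>((\<lambda>t. ball t (d t)) ` I)"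
    by (rule Lindelof[of "(\<lambda>t. ball t (d t)) ` I"]) auto
  have "AE s in lebesgue. \<forall>B\<in>F'. s \<in> B \<longrightarrow> P s"
    using F'(1) d(2) by (subst AE_ball_countable[OF F'(2)]) blast
  then show ?thesis unfolding AE_I
  proof eventually_elim
    case (elim s)
    have "s \<in> \<Union>F'" if "s \<in> I" using that d(1) unfolding F'(3) by force
    with elim show ?case by blast
  qed
qed

lemma GG_tendsto: "g \<in> GG I \<Longrightarrow> t \<in> I \<Longrightarrow> (g \<longlongrightarrow> slim b g t) (ess_side b t)"
proof -
  assume "g \<in> GG I" "t \<in> I"
  then have "\<exists>l. (g \<longlongrightarrow> l) (ess_side b t)" by (auto simp: GG_def ess_side_def)
  then show ?thesis using slimI by blast
qed

lemma GG_I: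
  assumes "g \<in> borel_measurable (lebesgue_on I)" "AE t in lebesgue_on I. norm (g t) \<le> B"
    "\<And>t b. t \<in> I \<Longrightarrow> \<exists>l. (g \<longlongrightarrow> l) (ess_side b t)"
  shows "g \<in> GG I"
  using assms(1,2) assms(3)[of _ True] assms(3)[of _ False] by (auto simp: GG_def ess_side_def)

lemma GG_measurable: "g \<in> GG I \<Longrightarrow> g \<in> borel_measurable (lebesgue_on I)"
  by (simp add: GG_def)

lemma GG_bound: assumes "g \<in> GG I" obtains B where "B \<ge> 0" "AE t in lebesgue_on I. norm (g t) \<le> B"
proof -
  obtain B where "AE t in lebesgue_on I. norm (g t) \<le> B" using assms by (auto simp: GG_def)
  then have "AE t in lebesgue_on I. norm (g t) \<le> max 0 B" by eventually_elim auto
  then show ?thesis using that[of "max 0 B"] by simp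
qed

text \<open>Within \<open>e\<close> of a one-sided limit at \<open>t\<close> almost everywhere on
  one side of \<open>t\<close>, the function has its own one-sided limits at the points there within
  \<open>e\<close> of the same number. Hence function and limit differ by at most
  \<open>2 * e\<close> locally, \<open>AE_local\<close> makes this global, and \<open>e\<close> runs
  through a sequence.\<close>

lemma AE_slim:
  assumes g: "g \<in> GG I"
  shows "AE t in lebesgue_on I. g t = slim b g t"
proof -
  have "AE t in lebesgue_on I. norm (g t - slim b g t) \<le> 2 / real (Suc n)" for n
  proof (rule AE_local)
    fix t b' assume t: "t \<in> I"
    define e where "e = 1 / real (Suc n)"
    have e: "e > 0" "2 / real (Suc n) = 2 * e" by (auto simp: e_def)
    have "eventually (\<lambda>s. norm (g s - slim b' g t) < e \<and> s \<in> I) (ess_side b' t)"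
      using tendstoD[OF GG_tendsto[OF g t, of b'] e(1)] eventually_in_I[OF t]
      by eventually_elim (auto simp: dist_norm)
    then obtain d where d: "d > 0"
        "AE s in lebesgue. s \<in> side b' t d \<longrightarrow> norm (g s - slim b' g t) < e \<and> s \<in> I"
      unfolding eventually_ess_side by blast
    obtain d' where d': "d' > 0" "\<forall>d''\<le>d'. side b' t d'' \<subseteq> I" using side_subset_I[OF t] by blast
    define r where "r = min d d'"
    have r: "r > 0" "side b' t r \<subseteq> I" "side b' t r \<subseteq> side b' t d"
      using d d' by (auto simp: r_def side_def)
    have key: "norm (slim b g s - slim b' g t) \<le> e" if s: "s \<in> side b' t r" for s
    proof -
      have sI: "s \<in> I" using s r by auto
      have "eventually (\<lambda>x. x \<in> side b' t r) (ess_side b s)"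
        using s by (intro ess_side_eventually_at eventually_at_in_open') auto
      moreover have "eventually (\<lambda>x. x \<in> side b' t d \<longrightarrow> norm (g x - slim b' g t) < e \<and> x \<in> I) (ess_side b s)"
        unfolding eventually_ess_side by (rule exI[of _ 1]) (use d(2) in \<open>auto elim: eventually_mono\<close>)
      ultimately have "eventually (\<lambda>x. norm (g x - slim b' g t) \<le> e) (ess_side b s)"
        by eventually_elim (use r in auto)
      then show ?thesis
        by (rule tendsto_upperbound[OF tendsto_norm[OF tendsto_diff[OF GG_tendsto[OF g sI] tendsto_const]]]) simp
    qed
    have "AE s in lebesgue. s \<in> side b' t r \<longrightarrow> norm (g s - slim b g s) \<le> 2 / real (Suc n)"
      using d(2)
    proof eventually_elim
      case (elim s)
      show ?case
      proof
        assume s: "s \<in> side b' t r"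
        have "norm (g s - slim b g s) \<le> norm (g s - slim b' g t) + norm (slim b g s - slim b' g t)"
          using norm_triangle_ineq4[of "g s - slim b' g t" "slim b g s - slim b' g t"] by simp
        with key[OF s] elim s r show "norm (g s - slim b g s) \<le> 2 / real (Suc n)" unfolding e(2) by auto
      qed
    qed
    then show "\<forall>\<^sub>F s in ess_side b' t. norm (g s - slim b g s) \<le> 2 / real (Suc n)"
      unfolding eventually_ess_side using r by blast
  qed
  then have "AE t in lebesgue_on I. \<forall>n. norm (g t - slim b g t) \<le> 2 / real (Suc n)"
    by (simp add: AE_all_countable)
  then show ?thesis
  proof eventually_elim
    case (elim t)
    have "(\<lambda>n. 2 / real (Suc n)) \<longlonglongrightarrow> 0"
      by (rule LIMSEQ_Suc[OF lim_const_over_n])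
    then have "norm (g t - slim b g t) \<le> 0"
      by (rule LIMSEQ_le_const) (use elim in auto)
    then show ?case by simp
  qed
qed

lemma slim_ae_cong: "ae_eq I g h \<Longrightarrow> t \<in> I \<Longrightarrow> slim b g t = slim b h t"
  unfolding ae_eq_def by (rule slim_cong_ev, rule ev_of_AE)

lemma GG_ae_eqI:
  assumes "g \<in> GG I" "h \<in> GG I" "\<And>t. t \<in> I \<Longrightarrow> slim b g t = slim b h t"
  shows "ae_eq I g h"
proof -
  have "AE t in lebesgue_on I. t \<in> I" using AE_space[of "lebesgue_on I"] by (simp add: space_restrict_space)
  with AE_slim[OF assms(1), of b] AE_slim[OF assms(2), of b] show ?thesis
    unfolding ae_eq_def by eventually_elim (use assms(3) in auto)
qed

lemma ae_eq_refl: "ae_eq I g g" by (simp add: ae_eq_def)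
lemma ae_eq_sym: "ae_eq I g h \<Longrightarrow> ae_eq I h g" by (auto simp: ae_eq_def elim: eventually_mono)
section \<open>The derivative\<close>

lemma G_deriv_iff:
  "G_deriv I g h \<longleftrightarrow> g \<in> GG I \<and> h \<in> GG I \<and>
     (\<forall>t\<in>I. \<forall>b. ((\<lambda>s. (g s - slim b g t) / of_real (s - t)) \<longlongrightarrow> slim b h t) (ess_side b t))"
  unfolding G_deriv_def by (auto simp: all_bool_eq slim_True slim_False ess_side_def)

lemma G_deriv_tendsto:
  "G_deriv I g h \<Longrightarrow> t \<in> I \<Longrightarrow> ((\<lambda>s. (g s - slim b g t) / of_real (s - t)) \<longlongrightarrow> slim b h t) (ess_side b t)"
  by (simp add: G_deriv_iff)

lemma G_deriv_unique:
  assumes "G_deriv I g h" "G_deriv I g h'" shows "ae_eq I h h'"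
proof (rule GG_ae_eqI[of _ _ True])
  show "slim True h t = slim True h' t" if "t \<in> I" for t
    using G_deriv_tendsto[OF assms(1) that] G_deriv_tendsto[OF assms(2) that]
    by (rule tendsto_unique[rotated]) simp
qed (use assms in \<open>auto simp: G_deriv_iff\<close>)

lemma G_deriv_cong:
  assumes d: "G_deriv I g h" and "ae_eq I g g'" "g' \<in> GG I" "ae_eq I h h'" "h' \<in> GG I"
  shows "G_deriv I g' h'"
  unfolding G_deriv_iff
proof (intro conjI ballI allI)
  fix t b assume t: "t \<in> I"
  have 1: "slim b g' t = slim b g t" "slim b h' t = slim b h t"
    using assms t by (metis slim_ae_cong)+
  have "eventually (\<lambda>s. g s = g' s) (ess_side b t)" using assms(2) t unfolding ae_eq_def by (rule ev_of_AE)
  then have "\<forall>\<^sub>F s in ess_side b t. (g s - slim b g t) / of_real (s - t) = (g' s - slim b g t) / of_real (s - t)"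
    by eventually_elim auto
  from Lim_transform_eventually[OF G_deriv_tendsto[OF d t, of b] this]
  show "((\<lambda>s. (g' s - slim b g' t) / of_real (s - t)) \<longlongrightarrow> slim b h' t) (ess_side b t)"
    unfolding 1 .
qed (use assms in auto)

section \<open>Algebra operations on regulated functions and their derivatives\<close>

lemma GG_const: "(\<lambda>_. c) \<in> GG I"
  by (rule GG_I[of _ "norm c"]) (auto intro: tendsto_const)

lemma GG_lin: 
  assumes g: "g \<in> GG I" and h: "h \<in> GG I" shows "(\<lambda>t. \<alpha> * g t + \<beta> * h t) \<in> GG I"
proof -
  obtain B where B: "AE t in lebesgue_on I. norm (g t) \<le> B" using g by (rule GG_bound)
  obtain C where C: "AE t in lebesgue_on I. norm (h t) \<le> C" using h by (rule GG_bound)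
  show ?thesis
  proof (rule GG_I)
    show "(\<lambda>t. \<alpha> * g t + \<beta> * h t) \<in> borel_measurable (lebesgue_on I)"
      using GG_measurable[OF g] GG_measurable[OF h] by measurable
    show "AE t in lebesgue_on I. norm (\<alpha> * g t + \<beta> * h t) \<le> norm \<alpha> * B + norm \<beta> * C"
      using B C by eventually_elim
        (auto simp: norm_mult intro!: order_trans[OF norm_triangle_ineq] add_mono mult_left_mono)
    show "\<exists>l. ((\<lambda>t. \<alpha> * g t + \<beta> * h t) \<longlongrightarrow> l) (ess_side b t)" if "t \<in> I" for t b
      by (intro exI[of _ "\<alpha> * slim b g t + \<beta> * slim b h t"] tendsto_intros GG_tendsto g h that)
  qed
qed

lemma slim_lin:
  assumes "g \<in> GG I" "h \<in> GG I" "t \<in> I"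
  shows "slim b (\<lambda>t. \<alpha> * g t + \<beta> * h t) t = \<alpha> * slim b g t + \<beta> * slim b h t"
  by (intro slimI tendsto_intros GG_tendsto assms)

lemma GG_mult: 
  assumes g: "g \<in> GG I" and h: "h \<in> GG I" shows "(\<lambda>t. g t * h t) \<in> GG I"
proof -
  obtain B where B: "B \<ge> 0" "AE t in lebesgue_on I. norm (g t) \<le> B" using g by (rule GG_bound)
  obtain C where C: "C \<ge> 0" "AE t in lebesgue_on I. norm (h t) \<le> C" using h by (rule GG_bound)
  show ?thesis
  proof (rule GG_I)
    show "(\<lambda>t. g t * h t) \<in> borel_measurable (lebesgue_on I)"
      using GG_measurable[OF g] GG_measurable[OF h] by measurable
    show "AE t in lebesgue_on I. norm (g t * h t) \<le> B * C"
      using B(2) C(2) by eventually_elim (auto simp: norm_mult intro!: mult_mono B)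
    show "\<exists>l. ((\<lambda>t. g t * h t) \<longlongrightarrow> l) (ess_side b t)" if "t \<in> I" for t b
      by (intro exI[of _ "slim b g t * slim b h t"] tendsto_intros GG_tendsto g h that)
  qed
qed

lemma slim_mult:
  assumes "g \<in> GG I" "h \<in> GG I" "t \<in> I"
  shows "slim b (\<lambda>t. g t * h t) t = slim b g t * slim b h t"
  by (intro slimI tendsto_intros GG_tendsto assms)

lemma GG_sum:
  assumes "finite A" "\<And>i. i \<in> A \<Longrightarrow> g i \<in> GG I" shows "(\<lambda>t. \<Sum>i\<in>A. g i t) \<in> GG I"
  using assms
proof (induction A rule: finite_induct)
  case (insert x F)
  from GG_lin[of "g x" "\<lambda>t. \<Sum>i\<in>F. g i t" 1 1] insert show ?case by simp
qed (simp add: GG_const)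

lemma G_deriv_lin:
  assumes g: "G_deriv I g g'" and h: "G_deriv I h h'"
  shows "G_deriv I (\<lambda>t. \<alpha> * g t + \<beta> * h t) (\<lambda>t. \<alpha> * g' t + \<beta> * h' t)"
proof -
  have G: "g \<in> GG I" "g' \<in> GG I" "h \<in> GG I" "h' \<in> GG I" using g h by (auto simp: G_deriv_iff)
  have "((\<lambda>s. (\<alpha> * g s + \<beta> * h s - (\<alpha> * slim b g t + \<beta> * slim b h t)) / of_real (s - t)) \<longlongrightarrow>
          \<alpha> * slim b g' t + \<beta> * slim b h' t) (ess_side b t)" if "t \<in> I" for t b
  proof -
    have "((\<lambda>s. \<alpha> * ((g s - slim b g t) / of_real (s - t)) + \<beta> * ((h s - slim b h t) / of_real (s - t))) \<longlongrightarrow>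
          \<alpha> * slim b g' t + \<beta> * slim b h' t) (ess_side b t)"
      by (intro tendsto_intros G_deriv_tendsto[OF g that] G_deriv_tendsto[OF h that])
    then show ?thesis by (simp add: diff_divide_distrib add_divide_distrib algebra_simps)
  qed
  then show ?thesis using G by (simp add: G_deriv_iff GG_lin slim_lin)
qed

lemma G_deriv_mult:
  assumes g: "G_deriv I g g'" and h: "G_deriv I h h'"
  shows "G_deriv I (\<lambda>t. g t * h t) (\<lambda>t. g' t * h t + g t * h' t)"
proof -
  have G: "g \<in> GG I" "g' \<in> GG I" "h \<in> GG I" "h' \<in> GG I" using g h by (auto simp: G_deriv_iff)
  have G': "(\<lambda>t. g' t * h t + g t * h' t) \<in> GG I"
    using GG_lin[OF GG_mult[OF G(2,3)] GG_mult[OF G(1,4)], of 1 1] by simp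
  have sl: "slim b (\<lambda>t. g' t * h t + g t * h' t) t = slim b g' t * slim b h t + slim b g t * slim b h' t"
    if "t \<in> I" for b t by (intro slimI tendsto_intros GG_tendsto G that)
  have "((\<lambda>s. (g s * h s - slim b g t * slim b h t) / of_real (s - t)) \<longlongrightarrow>
          slim b g' t * slim b h t + slim b g t * slim b h' t) (ess_side b t)" if "t \<in> I" for t b
  proof -
    have "((\<lambda>s. ((g s - slim b g t) / of_real (s - t)) * h s + slim b g t * ((h s - slim b h t) / of_real (s - t))) \<longlongrightarrow>
          slim b g' t * slim b h t + slim b g t * slim b h' t) (ess_side b t)"
      by (intro tendsto_intros G_deriv_tendsto[OF g that] G_deriv_tendsto[OF h that] GG_tendsto that G)
    then show ?thesis by (simp add: diff_divide_distrib add_divide_distrib algebra_simps)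
  qed
  then show ?thesis using G G' by (simp add: G_deriv_iff GG_mult sl slim_mult)
qed

lemma G_deriv_germI:
  assumes meas: "g \<in> borel_measurable (lebesgue_on I)" "h \<in> borel_measurable (lebesgue_on I)"
    and bd: "AE t in lebesgue_on I. norm (g t) \<le> B" "AE t in lebesgue_on I. norm (h t) \<le> C"
    and germ: "\<And>t b. t \<in> I \<Longrightarrow> \<exists>f f'. (f has_vector_derivative f' t) (at t) \<and> isCont f' t \<and>
        eventually (\<lambda>s. g s = f s) (ess_side b t) \<and> eventually (\<lambda>s. h s = f' s) (ess_side b t)"
  shows "G_deriv I g h"
proof -
  have key: "(g \<longlongrightarrow> slim b g t) (ess_side b t) \<and> (h \<longlongrightarrow> slim b h t) (ess_side b t) \<and>
     ((\<lambda>s. (g s - slim b g t) / of_real (s - t)) \<longlongrightarrow> slim b h t) (ess_side b t)" if t: "t \<in> I" for t b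
  proof -
    obtain f f' where f: "(f has_vector_derivative f' t) (at t)" "isCont f' t"
       and ev: "eventually (\<lambda>s. g s = f s) (ess_side b t)" "eventually (\<lambda>s. h s = f' s) (ess_side b t)"
      using germ[OF t, of b] by blast
    have "(f \<longlongrightarrow> f t) (ess_side b t)" "(f' \<longlongrightarrow> f' t) (ess_side b t)"
      using has_vector_derivative_continuous[OF f(1)] f(2)
      by (auto simp: isCont_def continuous_at intro: ess_side_tendsto_at)
    then have 1: "(g \<longlongrightarrow> f t) (ess_side b t)" "(h \<longlongrightarrow> f' t) (ess_side b t)"
      using ev by (auto simp: tendsto_cong)
    have "\<forall>\<^sub>F s in ess_side b t. (f s - f t) / of_real (s - t) = (g s - f t) / of_real (s - t)"
      using ev(1) by eventually_elim auto
    from Lim_transform_eventually[OF ess_side_tendsto_at[OF has_vector_derivative_complex_iff[THEN iffD1, OF f(1)]] this]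
    show ?thesis using 1 by (simp add: slimI)
  qed
  have "g \<in> GG I" "h \<in> GG I" using meas bd key by (auto intro!: GG_I)
  then show ?thesis using key by (simp add: G_deriv_iff)
qed

end

section \<open>Infinitely differentiable functions and their bounds\<close>

context line_interval begin

text \<open>Iterating a choice of derivative inside \<open>S\<close> yields the whole sequence.
  Membership in \<open>G_infty\<close> is thus shown by exhibiting a class closed under
  differentiation instead of writing down all derivatives.\<close>

lemma G_infty_coinduct:
  assumes "g \<in> S" and step: "\<And>g. g \<in> S \<Longrightarrow> \<exists>h\<in>S. G_deriv I g h"
  shows "g \<in> G_infty I"
proof -
  obtain F where F: "\<And>g. g \<in> S \<Longrightarrow> F g \<in> S \<and> G_deriv I g (F g)" using step by metis
  have S: "(F ^^ k) g \<in> S" for k by (induction k) (use assms(1) F in auto)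
  have "g \<in> GG I" using F[OF assms(1)] by (simp add: G_deriv_iff)
  moreover have "\<forall>k. G_deriv I ((F ^^ k) g) ((F ^^ Suc k) g)" using S F by auto
  ultimately show ?thesis unfolding G_infty_def
    by (intro CollectI conjI exI[of _ "\<lambda>k. (F ^^ k) g"]) auto
qed

lemma G_infty_deriv:
  assumes "g \<in> G_infty I" obtains h where "h \<in> G_infty I" "G_deriv I g h"
proof -
  obtain d where d: "d 0 = g" "\<And>k. G_deriv I (d k) (d (Suc k))" using assms by (auto simp: G_infty_def)
  have "d 1 \<in> G_infty I" unfolding G_infty_def
    using d(2)[of 1] d(2) by (intro CollectI conjI exI[of _ "\<lambda>k. d (Suc k)"]) (auto simp: G_deriv_iff)
  then show ?thesis using that[of "d 1"] d(2)[of 0] d(1) by simp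
qed

lemma G_infty_GG: "g \<in> G_infty I \<Longrightarrow> g \<in> GG I" by (simp add: G_infty_def)

lemma G_infty_cong:
  assumes "g \<in> G_infty I" "ae_eq I g g'" "g' \<in> GG I"
  shows "g' \<in> G_infty I"
proof (rule G_infty_coinduct[of _ "insert g' (G_infty I)"])
  fix k assume "k \<in> insert g' (G_infty I)"
  moreover have "\<exists>h\<in>insert g' (G_infty I). G_deriv I g' h"
    using G_deriv_cong[OF _ assms(2,3) ae_eq_refl] G_infty_deriv[OF assms(1)] G_infty_GG by (metis insertI2)
  ultimately show "\<exists>h\<in>insert g' (G_infty I). G_deriv I k h"
    using G_infty_deriv by (metis insertE insertI2)
qed simp

lemma G_infty_antideriv:
  assumes "G_deriv I g h" "h \<in> G_infty I" shows "g \<in> G_infty I"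
proof (rule G_infty_coinduct[of _ "insert g (G_infty I)"])
  fix k assume "k \<in> insert g (G_infty I)"
  then show "\<exists>h\<in>insert g (G_infty I). G_deriv I k h"
    using G_infty_deriv assms by (metis insertE insertI2)
qed simp

lemma G_infty_deriv_closed:
  assumes "G_deriv I g h" "g \<in> G_infty I" shows "h \<in> G_infty I"
proof -
  obtain h' where h': "h' \<in> G_infty I" "G_deriv I g h'" using G_infty_deriv[OF assms(2)] by blast
  show ?thesis
    using G_infty_cong[OF h'(1) G_deriv_unique[OF h'(2) assms(1)]] assms(1) by (simp add: G_deriv_iff)
qed

lemma G_deriv_gder: "g \<in> G_infty I \<Longrightarrow> G_deriv I g (gder I g)"
  unfolding gder_def by (rule someI_ex[of "G_deriv I g"]) (meson G_infty_deriv)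

lemma gder_G_infty: "g \<in> G_infty I \<Longrightarrow> gder I g \<in> G_infty I"
  using G_deriv_gder G_infty_deriv_closed by blast

lemma G_infty_lin:
  assumes "g \<in> G_infty I" "h \<in> G_infty I" shows "(\<lambda>t. \<alpha> * g t + \<beta> * h t) \<in> G_infty I"
proof (rule G_infty_coinduct)
  show "(\<lambda>t. \<alpha> * g t + \<beta> * h t) \<in> {\<lambda>t. \<alpha> * g t + \<beta> * h t | g h. g \<in> G_infty I \<and> h \<in> G_infty I}"
    using assms by blast
  fix k assume "k \<in> {\<lambda>t. \<alpha> * g t + \<beta> * h t | g h. g \<in> G_infty I \<and> h \<in> G_infty I}"
  then obtain g h where k: "k = (\<lambda>t. \<alpha> * g t + \<beta> * h t)" and gh: "g \<in> G_infty I" "h \<in> G_infty I" by blast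
  obtain g' where g': "g' \<in> G_infty I" "G_deriv I g g'" using gh(1) by (rule G_infty_deriv)
  obtain h' where h': "h' \<in> G_infty I" "G_deriv I h h'" using gh(2) by (rule G_infty_deriv)
  show "\<exists>h\<in>{\<lambda>t. \<alpha> * g t + \<beta> * h t | g h. g \<in> G_infty I \<and> h \<in> G_infty I}. G_deriv I k h"
    using G_deriv_lin[OF g'(2) h'(2), of \<alpha> \<beta>] g'(1) h'(1) unfolding k by blast
qed

lemma G_infty_const: "(\<lambda>_. c) \<in> G_infty I"
proof (rule G_infty_coinduct[of _ "{\<lambda>_. c, \<lambda>_. 0}"])
  have "G_deriv I (\<lambda>_. a) (\<lambda>_. 0)" for a
  proof (rule G_deriv_germI[of _ _ "norm a" 0])
    show "\<exists>f f'. (f has_vector_derivative f' t) (at t) \<and> isCont f' t \<and>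
        (\<forall>\<^sub>F s in ess_side b t. a = f s) \<and> (\<forall>\<^sub>F s in ess_side b t. 0 = f' s)" for t b
      by (rule exI[of _ "\<lambda>_. a"], rule exI[of _ "\<lambda>_. 0"]) auto
  qed auto
  then show "\<exists>h\<in>{\<lambda>_. c, \<lambda>_. 0}. G_deriv I g h" if "g \<in> {\<lambda>_. c, \<lambda>_. 0}" for g using that by auto
qed simp

text \<open>Products are not closed under differentiation, but their finite sums are, by the Leibniz
  rule; this class is the invariant for \<open>G_infty_coinduct\<close>.\<close>

inductive_set prod_span :: "(real \<Rightarrow> complex) set" where
  mult: "g \<in> G_infty I \<Longrightarrow> h \<in> G_infty I \<Longrightarrow> (\<lambda>t. g t * h t) \<in> prod_span"
| add: "p \<in> prod_span \<Longrightarrow> q \<in> prod_span \<Longrightarrow> (\<lambda>t. p t + q t) \<in> prod_span"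

lemma G_infty_mult:
  assumes "g \<in> G_infty I" "h \<in> G_infty I" shows "(\<lambda>t. g t * h t) \<in> G_infty I"
proof (rule G_infty_coinduct[of _ prod_span])
  show "(\<lambda>t. g t * h t) \<in> prod_span" using assms by (rule prod_span.mult)
  fix p assume "p \<in> prod_span"
  then show "\<exists>q\<in>prod_span. G_deriv I p q"
  proof induction
    case (mult g h)
    obtain g' where g': "g' \<in> G_infty I" "G_deriv I g g'" using mult(1) by (rule G_infty_deriv)
    obtain h' where h': "h' \<in> G_infty I" "G_deriv I h h'" using mult(2) by (rule G_infty_deriv)
    have "(\<lambda>t. g' t * h t + g t * h' t) \<in> prod_span"
      by (intro prod_span.intros g' h' mult)
    then show ?case using G_deriv_mult[OF g'(2) h'(2)] by blast
  next
    case (add p q)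
    then obtain p' q' where pq: "p' \<in> prod_span" "G_deriv I p p'" "q' \<in> prod_span" "G_deriv I q q'" by blast
    have "(\<lambda>t. p' t + q' t) \<in> prod_span" using pq by (intro prod_span.add)
    then show ?case using G_deriv_lin[OF pq(2,4), of 1 1] by auto
  qed
qed

text \<open>A relational substitute for \<open>gnorm I k g \<le> B\<close>: it asks for some
  derivative at each stage, so that neither the representative chosen by \<open>gder\<close> nor an
  essential supremum enters the estimates. \<open>gnorm_le\<close> leads back to the norms.\<close>

primrec bnd :: "nat \<Rightarrow> (real \<Rightarrow> complex) \<Rightarrow> real \<Rightarrow> bool" where
  "bnd 0 g B \<longleftrightarrow> g \<in> G_infty I \<and> (AE t in lebesgue_on I. norm (g t) \<le> B)"
| "bnd (Suc k) g B \<longleftrightarrow> g \<in> G_infty I \<and> (AE t in lebesgue_on I. norm (g t) \<le> B) \<and> (\<exists>h. G_deriv I g h \<and> bnd k h B)"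

lemma bnd_G_infty: "bnd k g B \<Longrightarrow> g \<in> G_infty I" by (cases k) auto

lemma bnd_AE: "bnd k g B \<Longrightarrow> AE t in lebesgue_on I. norm (g t) \<le> B" by (cases k) auto

lemma bnd_mono: "bnd k g B \<Longrightarrow> B \<le> C \<Longrightarrow> bnd k g C"
proof (induction k arbitrary: g)
  case 0
  then show ?case by (auto elim!: eventually_mono)
next
  case (Suc k)
  then show ?case by (auto elim!: eventually_mono)
qed

lemma bnd_SucD: "bnd (Suc k) g B \<Longrightarrow> bnd k g B"
  by (induction k arbitrary: g) auto

lemma bnd_cong:
  assumes "bnd k g B" "ae_eq I g g'" "g' \<in> GG I" shows "bnd k g' B"
proof -
  have 1: "g' \<in> G_infty I" using bnd_G_infty[OF assms(1)] assms(2,3) by (rule G_infty_cong)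
  have 2: "AE t in lebesgue_on I. norm (g' t) \<le> B"
    using bnd_AE[OF assms(1)] assms(2) unfolding ae_eq_def by eventually_elim auto
  show ?thesis
  proof (cases k)
    case (Suc l)
    then obtain h where "G_deriv I g h" "bnd l h B" using assms(1) by auto
    then show ?thesis using 1 2 Suc G_deriv_cong[OF _ assms(2,3) ae_eq_refl] by (auto simp: G_deriv_iff)
  qed (use 1 2 in auto)
qed

lemma bnd_deriv: "bnd (Suc k) g B \<Longrightarrow> G_deriv I g h \<Longrightarrow> bnd k h B"
  using bnd_cong G_deriv_unique by (auto simp: G_deriv_iff)

lemma bnd_exists:
  assumes "g \<in> G_infty I" obtains B where "B \<ge> 0" "bnd k g B"
proof -
  have "\<exists>B\<ge>0. bnd k g B" using assms
  proof (induction k arbitrary: g)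
    case 0
    then show ?case using GG_bound[OF G_infty_GG] by (metis bnd.simps(1))
  next
    case (Suc k)
    obtain B where B: "B \<ge> 0" "AE t in lebesgue_on I. norm (g t) \<le> B" using Suc GG_bound[OF G_infty_GG] by metis
    obtain h where h: "h \<in> G_infty I" "G_deriv I g h" using Suc.prems by (rule G_infty_deriv)
    obtain C where C: "C \<ge> 0" "bnd k h C" using Suc.IH[OF h(1)] by blast
    have "bnd k h (max B C)" using C by (auto intro: bnd_mono)
    moreover have "AE t in lebesgue_on I. norm (g t) \<le> max B C" using B(2) by eventually_elim auto
    ultimately show ?case using B h Suc.prems by (intro exI[of _ "max B C"]) auto
  qed
  then show ?thesis using that by blast
qed

lemma bnd_lin:
  assumes "bnd k g B" "bnd k h C" shows "bnd k (\<lambda>t. \<alpha> * g t + \<beta> * h t) (norm \<alpha> * B + norm \<beta> * C)"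
  using assms
proof (induction k arbitrary: g h)
  case 0
  have "AE t in lebesgue_on I. norm (\<alpha> * g t + \<beta> * h t) \<le> norm \<alpha> * B + norm \<beta> * C"
    using bnd_AE[OF 0(1)] bnd_AE[OF 0(2)] by eventually_elim
        (auto simp: norm_mult intro!: order_trans[OF norm_triangle_ineq] add_mono mult_left_mono)
  with 0 show ?case by (auto simp: G_infty_lin)
next
  case (Suc k)
  obtain g' h' where 1: "G_deriv I g g'" "bnd k g' B" "G_deriv I h h'" "bnd k h' C" using Suc.prems by auto
  have "AE t in lebesgue_on I. norm (\<alpha> * g t + \<beta> * h t) \<le> norm \<alpha> * B + norm \<beta> * C"
    using bnd_AE[OF Suc.prems(1)] bnd_AE[OF Suc.prems(2)] by eventually_elim
        (auto simp: norm_mult intro!: order_trans[OF norm_triangle_ineq] add_mono mult_left_mono)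
  moreover have "(\<lambda>t. \<alpha> * g t + \<beta> * h t) \<in> G_infty I" using Suc.prems by (auto simp: G_infty_lin)
  ultimately show ?case using G_deriv_lin[OF 1(1,3), of \<alpha> \<beta>] Suc.IH[OF 1(2,4)] by auto
qed

text \<open>Each use of the Leibniz rule doubles the number of terms, whence the crude factor
  \<open>2 ^ k\<close>.\<close>

lemma bnd_mult:
  assumes "bnd k g B" "bnd k h C" "0 \<le> B" "0 \<le> C" shows "bnd k (\<lambda>t. g t * h t) (2 ^ k * B * C)"
  using assms(1,2)
proof (induction k arbitrary: g h)
  case 0
  have "AE t in lebesgue_on I. norm (g t * h t) \<le> 2 ^ 0 * B * C"
    using bnd_AE[OF 0(1)] bnd_AE[OF 0(2)] by eventually_elim (auto simp: norm_mult intro!: mult_mono assms)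
  with 0 show ?case by (auto simp: G_infty_mult)
next
  case (Suc k)
  obtain g' h' where 1: "G_deriv I g g'" "bnd k g' B" "G_deriv I h h'" "bnd k h' C" using Suc.prems by auto
  have "AE t in lebesgue_on I. norm (g t * h t) \<le> B * C"
    using bnd_AE[OF Suc.prems(1)] bnd_AE[OF Suc.prems(2)] by eventually_elim (auto simp: norm_mult intro!: mult_mono assms)
  moreover have "B * C \<le> 2 ^ Suc k * B * C"
  proof -
    have "1 * (B * C) \<le> 2 ^ Suc k * (B * C)" by (intro mult_right_mono one_le_power mult_nonneg_nonneg assms) simp
    then show ?thesis by (simp add: mult.assoc)
  qed
  ultimately have 2: "AE t in lebesgue_on I. norm (g t * h t) \<le> 2 ^ Suc k * B * C"
    by (auto elim!: eventually_mono)
  have "bnd k (\<lambda>t. 1 * (g' t * h t) + 1 * (g t * h' t)) (norm (1::complex) * (2 ^ k * B * C) + norm (1::complex) * (2 ^ k * B * C))"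
    by (rule bnd_lin[OF Suc.IH[OF 1(2) bnd_SucD[OF Suc.prems(2)]] Suc.IH[OF bnd_SucD[OF Suc.prems(1)] 1(4)]])
  then have "bnd k (\<lambda>t. g' t * h t + g t * h' t) (2 ^ Suc k * B * C)" by (simp add: mult_ac)
  moreover have "(\<lambda>t. g t * h t) \<in> G_infty I" using Suc.prems by (auto simp: G_infty_mult)
  ultimately show ?case using G_deriv_mult[OF 1(1,3)] 2 by auto
qed

lemma gders_Suc: "gders I (Suc k) g = gders I k (gder I g)"
  by (simp add: gders_def funpow_Suc_right del: funpow.simps)

lemma gders_G_infty: "g \<in> G_infty I \<Longrightarrow> gders I k g \<in> G_infty I"
  by (induction k arbitrary: g) (auto simp: gders_Suc gder_G_infty, simp add: gders_def)

lemma bnd_gders: "bnd k g B \<Longrightarrow> i \<le> k \<Longrightarrow> AE t in lebesgue_on I. norm (gders I i g t) \<le> B"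
proof (induction k arbitrary: g i)
  case 0
  then show ?case by (simp add: gders_def)
next
  case (Suc k)
  show ?case
  proof (cases i)
    case 0
    then show ?thesis using bnd_AE[OF Suc.prems(1)] by (simp add: gders_def)
  next
    case (Suc j)
    then show ?thesis
      using Suc.IH[OF bnd_deriv[OF Suc.prems(1) G_deriv_gder[OF bnd_G_infty[OF Suc.prems(1)]]], of j] Suc.prems(2)
      by (simp add: gders_Suc)
  qed
qed

lemma gnorm_le:
  assumes "bnd k g B" "0 \<le> B" shows "gnorm I k g \<le> B"
proof -
  have "Linf_norm I (gders I i g) \<le> B" if "i \<le> k" for i
  proof -
    have m: "gders I i g \<in> borel_measurable (lebesgue_on I)"
      by (intro GG_measurable G_infty_GG gders_G_infty bnd_G_infty[OF assms(1)])
    have "esssup (lebesgue_on I) (\<lambda>t. ereal (norm (gders I i g t))) \<le> ereal B"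
      by (rule esssup_I) (use m bnd_gders[OF assms(1) that] in auto)
    \<comment> \<open>\<open>real_of_ereal\<close> reads the value minus infinity as 0, and that
      case is settled by \<open>0 \<le> B\<close>; plus infinity is excluded by the bound just
      shown.\<close>
    then show ?thesis unfolding Linf_norm_def using assms(2)
      by (cases "esssup (lebesgue_on I) (\<lambda>t. ereal (norm (gders I i g t)))") auto
  qed
  then show ?thesis unfolding gnorm_def by (subst Max_le_iff) auto
qed

end

section \<open>Cutting to a segment\<close>

text \<open>Half-open, so that adjacent segments add up pointwise without a correction at the common
  endpoint.\<close>

definition seg :: "real \<Rightarrow> real \<Rightarrow> (real \<Rightarrow> complex) \<Rightarrow> real \<Rightarrow> complex" where
  "seg s t g = (\<lambda>r. if s \<le> r \<and> r < t then g r else 0)"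

lemma seg_lin: "seg s t (\<lambda>r. \<alpha> * g r + \<beta> * h r) = (\<lambda>r. \<alpha> * seg s t g r + \<beta> * seg s t h r)"
  by (auto simp: seg_def)

lemma mult_seg: "(\<lambda>r. g r * seg s t h r) = seg s t (\<lambda>r. g r * h r)"
  by (auto simp: seg_def)

lemma seg_seg [simp]: "seg s t (seg s t g) = seg s t g"
  by (auto simp: seg_def)

lemma seg_sub: "a \<le> s \<Longrightarrow> t \<le> b \<Longrightarrow> seg a b (seg s t g) = seg s t g"
  by (auto simp: seg_def)

lemma seg_sub': "a \<le> s \<Longrightarrow> t \<le> b \<Longrightarrow> seg s t (seg a b g) = seg s t g"
  by (auto simp: seg_def)

lemma seg_split: "s \<le> t \<Longrightarrow> t \<le> u \<Longrightarrow> seg s u g = (\<lambda>r. seg s t g r + seg t u g r)"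
  by (auto simp: seg_def)

text \<open>Tells whether the germ on side \<open>b\<close> of \<open>p\<close> sees the segment:
  the endpoint \<open>s\<close> is seen from its right only, the endpoint \<open>t\<close> from its
  left only.\<close>

definition in_seg :: "bool \<Rightarrow> real \<Rightarrow> real \<Rightarrow> real \<Rightarrow> bool" where
  "in_seg b s t p \<longleftrightarrow> (if b then s \<le> p \<and> p < t else s < p \<and> p \<le> t)"

lemma ev_seg: "eventually (\<lambda>r. seg s t g r = (if in_seg b s t p then g r else 0)) (ess_side b p)"
proof -
  have e: "eventually (\<lambda>r. r \<in> side b p d) (ess_side b p)" if "d > 0" for d
    using that unfolding eventually_ess_side by auto
  \<comment> \<open>The comprehensions over \<open>unit\<close> are empty or singletons: an endpoint
    equal to \<open>p\<close> contributes no distance, and the 1 keeps the set nonempty.\<close>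
  define d where "d = Min ({1} \<union> {\<bar>s - p\<bar> | x::unit. s \<noteq> p} \<union> {\<bar>t - p\<bar> | x::unit. t \<noteq> p})"
  have fin: "finite ({1::real} \<union> {\<bar>s - p\<bar> | x::unit. s \<noteq> p} \<union> {\<bar>t - p\<bar> | x::unit. t \<noteq> p})" by auto
  have "d > 0" unfolding d_def by (subst Min_gr_iff[OF fin]) auto
  have "s \<noteq> p \<Longrightarrow> d \<le> \<bar>s - p\<bar>" "t \<noteq> p \<Longrightarrow> d \<le> \<bar>t - p\<bar>" unfolding d_def by (auto intro!: Min_le)
  then show ?thesis
    using e[OF \<open>d > 0\<close>] by (auto elim!: eventually_mono simp: side_def seg_def in_seg_def split: if_splits)
qed

context line_interval begin

lemma seg_measurable:
  assumes "g \<in> borel_measurable (lebesgue_on I)" shows "seg s t g \<in> borel_measurable (lebesgue_on I)"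
proof -
  have "(\<lambda>r. if r \<in> {s..<t} then g r else 0) \<in> borel_measurable (lebesgue_on I)"
    by (rule measurable_If_set) (use assms in \<open>auto simp: sets_restrict_space\<close>)
  then show ?thesis by (simp add: seg_def)
qed

lemma seg_GG: assumes "g \<in> GG I" shows "seg s t g \<in> GG I"
proof -
  obtain B where B: "B \<ge> 0" "AE t in lebesgue_on I. norm (g t) \<le> B" using assms by (rule GG_bound)
  show ?thesis
  proof (rule GG_I)
    show "seg s t g \<in> borel_measurable (lebesgue_on I)" using assms by (intro seg_measurable GG_measurable)
    show "AE r in lebesgue_on I. norm (seg s t g r) \<le> B" using B(2) by eventually_elim (use B(1) in \<open>auto simp: seg_def\<close>)
    fix p b assume p: "p \<in> I"
    show "\<exists>l. (seg s t g \<longlongrightarrow> l) (ess_side b p)"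
    proof (cases "in_seg b s t p")
      case True
      then show ?thesis using ev_seg[of s t g b p] GG_tendsto[OF assms p, of b] by (auto simp: tendsto_cong)
    next
      case False
      then show ?thesis using ev_seg[of s t g b p] by (intro exI[of _ 0]) (auto simp: tendsto_cong)
    qed
  qed
qed

lemma slim_zero: "slim b (\<lambda>_. 0) p = 0" by (intro slimI tendsto_const)

lemma slim_seg: "slim b (seg s t g) p = (if in_seg b s t p then slim b g p else 0)"
  using slim_cong_ev[OF ev_seg[of s t g b p]] by (simp add: slim_zero split: if_splits)

text \<open>On each side of each point the cut function is locally either \<open>g\<close> or zero,
  so the jumps made by cutting do not show in the one-sided difference quotients. Cutting therefore
  commutes with differentiation.\<close>

lemma G_deriv_seg: assumes d: "G_deriv I g h" shows "G_deriv I (seg s t g) (seg s t h)"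
  unfolding G_deriv_iff
proof (intro conjI ballI allI)
  show "seg s t g \<in> GG I" "seg s t h \<in> GG I" using d by (auto simp: G_deriv_iff seg_GG)
  fix p b assume p: "p \<in> I"
  show "((\<lambda>r. (seg s t g r - slim b (seg s t g) p) / of_real (r - p)) \<longlongrightarrow> slim b (seg s t h) p) (ess_side b p)"
  proof (cases "in_seg b s t p")
    case True
    have "\<forall>\<^sub>F r in ess_side b p. (g r - slim b g p) / of_real (r - p) = (seg s t g r - slim b (seg s t g) p) / of_real (r - p)"
      using ev_seg[of s t g b p] by eventually_elim (use True in \<open>simp add: slim_seg\<close>)
    from Lim_transform_eventually[OF G_deriv_tendsto[OF d p, of b] this] show ?thesis using True by (simp add: slim_seg)
  next
    case False
    have "\<forall>\<^sub>F r in ess_side b p. 0 = (seg s t g r - slim b (seg s t g) p) / of_real (r - p)"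
      using ev_seg[of s t g b p] by eventually_elim (use False in \<open>simp add: slim_seg\<close>)
    from Lim_transform_eventually[OF tendsto_const this] show ?thesis using False by (simp add: slim_seg)
  qed
qed

lemma seg_G_infty: assumes "g \<in> G_infty I" shows "seg s t g \<in> G_infty I"
proof (rule G_infty_coinduct[of _ "seg s t ` G_infty I"])
  show "\<exists>h\<in>seg s t ` G_infty I. G_deriv I k h" if kS: "k \<in> seg s t ` G_infty I" for k
  proof -
    obtain h where k: "k = seg s t h" "h \<in> G_infty I" using kS by blast
    obtain h' where "h' \<in> G_infty I" "G_deriv I h h'" using k(2) by (rule G_infty_deriv)
    then show ?thesis using G_deriv_seg k(1) by blast
  qed
qed (use assms in auto)

lemma bnd_seg: assumes "bnd k g B" "0 \<le> B" shows "bnd k (seg s t g) B"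
  using assms(1)
proof (induction k arbitrary: g)
  case 0
  have "AE r in lebesgue_on I. norm (seg s t g r) \<le> B"
    using bnd_AE[OF 0] by eventually_elim (use assms(2) in \<open>auto simp: seg_def\<close>)
  then show ?case using 0 by (simp add: seg_G_infty)
next
  case (Suc k)
  have "AE r in lebesgue_on I. norm (seg s t g r) \<le> B"
    using bnd_AE[OF Suc.prems] by eventually_elim (use assms(2) in \<open>auto simp: seg_def\<close>)
  then show ?case using Suc by (auto simp: seg_G_infty intro: G_deriv_seg)
qed

section \<open>Test functions and the order of a distribution on a segment\<close>

lemma RR_lin:
  assumes "\<phi> \<in> RR I" "\<psi> \<in> RR I" shows "(\<lambda>t. \<alpha> * \<phi> t + \<beta> * \<psi> t) \<in> RR I"
proof -
  obtain K where K: "compact K" "K \<subseteq> I" "AE t in lebesgue_on I. t \<notin> K \<longrightarrow> \<phi> t = 0" using assms by (auto simp: RR_def)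
  obtain L where L: "compact L" "L \<subseteq> I" "AE t in lebesgue_on I. t \<notin> L \<longrightarrow> \<psi> t = 0" using assms by (auto simp: RR_def)
  have "AE t in lebesgue_on I. t \<notin> K \<union> L \<longrightarrow> \<alpha> * \<phi> t + \<beta> * \<psi> t = 0"
    using K(3) L(3) by eventually_elim auto
  then show ?thesis using assms K L unfolding RR_def
    by (intro CollectI conjI exI[of _ "K \<union> L"] G_infty_lin) auto
qed

lemma seg_RR: "g \<in> G_infty I \<Longrightarrow> s \<in> I \<Longrightarrow> t \<in> I \<Longrightarrow> seg s t g \<in> RR I"
  unfolding RR_def by (intro CollectI conjI exI[of _ "{s..t}"] seg_G_infty cIcc_I) (auto simp: seg_def)

lemma RR_zero: "(\<lambda>_. 0) \<in> RR I"
  unfolding RR_def by (auto simp: G_infty_const intro!: exI[of _ "{}"])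

lemma RR_G_infty: "\<phi> \<in> RR I \<Longrightarrow> \<phi> \<in> G_infty I" by (simp add: RR_def)

lemma RR_dual_lin:
  "f \<in> RR_dual I \<Longrightarrow> \<phi> \<in> RR I \<Longrightarrow> \<psi> \<in> RR I \<Longrightarrow> f (\<lambda>t. \<alpha> * \<phi> t + \<beta> * \<psi> t) = \<alpha> * f \<phi> + \<beta> * f \<psi>"
  by (simp add: RR_dual_def)

lemma RR_dual_add: "f \<in> RR_dual I \<Longrightarrow> \<phi> \<in> RR I \<Longrightarrow> \<psi> \<in> RR I \<Longrightarrow> f (\<lambda>t. \<phi> t + \<psi> t) = f \<phi> + f \<psi>"
  using RR_dual_lin[of f \<phi> \<psi> 1 1] by simp

lemma RR_dual_diff: "f \<in> RR_dual I \<Longrightarrow> \<phi> \<in> RR I \<Longrightarrow> \<psi> \<in> RR I \<Longrightarrow> f (\<lambda>t. \<phi> t - \<psi> t) = f \<phi> - f \<psi>"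
  using RR_dual_lin[of f \<phi> \<psi> 1 "-1"] by simp

lemma RR_dual_scale: "f \<in> RR_dual I \<Longrightarrow> \<phi> \<in> RR I \<Longrightarrow> f (\<lambda>t. \<alpha> * \<phi> t) = \<alpha> * f \<phi>"
  using RR_dual_lin[of f \<phi> \<phi> \<alpha> 0] by simp

lemma RR_dual_zero: "f \<in> RR_dual I \<Longrightarrow> f (\<lambda>_. 0) = 0"
  using RR_dual_scale[OF _ RR_zero, of f 0] by simp

lemma RR_dual_cong: "f \<in> RR_dual I \<Longrightarrow> \<phi> \<in> RR I \<Longrightarrow> \<psi> \<in> RR I \<Longrightarrow> ae_eq I \<phi> \<psi> \<Longrightarrow> f \<phi> = f \<psi>"
  by (simp add: RR_dual_def)

lemma RR_on_subset: assumes "admissible_subinterval I J" shows "RR_on I J \<subseteq> RR I"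
proof
  fix \<phi> assume "\<phi> \<in> RR_on I J"
  then have "\<phi> \<in> G_infty I" "AE t in lebesgue_on I. t \<notin> J \<longrightarrow> \<phi> t = 0" by (auto simp: RR_on_def)
  moreover from this(2) have "AE t in lebesgue_on I. t \<notin> closure J \<longrightarrow> \<phi> t = 0"
    by eventually_elim (use closure_subset[of J] in auto)
  moreover have "compact (closure J)" "closure J \<subseteq> I"
    using assms by (auto simp: admissible_subinterval_def compact_closure)
  ultimately show "\<phi> \<in> RR I" unfolding RR_def by blast
qed

lemma RR_zero_nhd_RR: "RR_zero_nhd I (RR I)"
  unfolding RR_zero_nhd_def using RR_on_subset by (auto simp: RR_lin intro!: exI[of _ 1])

lemma topspace_RR: "topspace (RR_topology I) = RR I"
proof -
  have "RR_openin I (RR I)" unfolding RR_openin_def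
    using RR_lin[of _ _ 1 1] by (auto intro!: exI[of _ "RR I"] RR_zero_nhd_RR)
  moreover have "RR_openin I W \<Longrightarrow> W \<subseteq> RR I" for W by (simp add: RR_openin_def)
  ultimately show ?thesis unfolding topspace_def openin_RR_topology by blast
qed

text \<open>A distribution has finite order on a segment: continuity at 0 gives a neighbourhood
  mapped into the unit ball, its trace on the functions vanishing outside \<open>{s..t}\<close>
  contains a ball of one norm, and scaling turns this into a linear bound.\<close>

lemma RR_dual_bound:
  assumes f: "f \<in> RR_dual I" and s: "s \<in> I" and t: "t \<in> I"
  obtains k C where "0 \<le> C" "\<And>\<psi> B. bnd k \<psi> B \<Longrightarrow> 0 \<le> B \<Longrightarrow> norm (f (seg s t \<psi>)) \<le> C * B"
proof -
  have "continuous_map (RR_topology I) euclidean f" using f by (simp add: RR_dual_def)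
  then have "openin (RR_topology I) {\<phi> \<in> topspace (RR_topology I). f \<phi> \<in> ball 0 1}"
    by (rule openin_continuous_map_preimage) auto
  then have "RR_openin I {\<phi> \<in> RR I. f \<phi> \<in> ball 0 1}" by (simp add: topspace_RR openin_RR_topology)
  moreover have "(\<lambda>_. 0) \<in> {\<phi> \<in> RR I. f \<phi> \<in> ball 0 1}" using RR_zero RR_dual_zero[OF f] by simp
  ultimately obtain U where U: "RR_zero_nhd I U" "(\<lambda>\<psi> t. 0 + \<psi> t) ` U \<subseteq> {\<phi> \<in> RR I. f \<phi> \<in> ball 0 1}"
    unfolding RR_openin_def by (meson conjunct2 bspec)
  have "admissible_subinterval I {s..t}" unfolding admissible_subinterval_def
    using cIcc_I[OF s t] by (auto simp: is_interval_cc)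
  then obtain k e where ke: "e > 0" "{\<phi> \<in> RR_on I {s..t}. gnorm I k \<phi> < e} \<subseteq> U"
    using U(1) unfolding RR_zero_nhd_def by blast
  show ?thesis
  proof (rule that[of "2 / e" k])
    show "0 \<le> 2 / e" using ke by simp
    fix \<psi> B assume b: "bnd k \<psi> B" and B: "0 \<le> B"
    have R: "seg s t \<psi> \<in> RR I" using seg_RR[OF bnd_G_infty[OF b] s t] .
    have *: "norm (f (seg s t \<psi>)) \<le> 2 / e * B'" if B': "B' > B" for B'
    proof -
      \<comment> \<open>Brings the bound from at most \<open>B'\<close> down to
        \<open>e / 2\<close>, strictly inside the ball of radius \<open>e\<close>. Working with
        \<open>B' > B\<close> avoids dividing by zero when \<open>B = 0\<close>; the excess is
        removed at the end.\<close>
      let ?c = "of_real (e / (2 * B')) :: complex"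
      let ?\<phi> = "\<lambda>r. ?c * seg s t \<psi> r"
      have c: "norm ?c = e / (2 * B')" 
        by (simp only: norm_of_real) (use B B' ke(1) in simp)
      have "bnd k (\<lambda>r. ?c * seg s t \<psi> r + 0 * seg s t \<psi> r) (norm ?c * B + norm (0::complex) * B)"
        by (rule bnd_lin[OF bnd_seg[OF b B] bnd_seg[OF b B]])
      then have "bnd k ?\<phi> (e / (2 * B') * B)" unfolding c by simp
      then have bb: "bnd k ?\<phi> (e / 2)" by (rule bnd_mono) (use B B' ke(1) in \<open>auto simp: field_simps\<close>)
      have "gnorm I k ?\<phi> \<le> e / 2" using gnorm_le[OF bb] ke(1) by simp
      then have "gnorm I k ?\<phi> < e" using ke(1) by simp
      moreover have "?\<phi> \<in> RR_on I {s..t}" using bnd_G_infty[OF bb] by (auto simp: RR_on_def seg_def)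
      ultimately have "?\<phi> \<in> U" using ke by auto
      then have "norm (f ?\<phi>) < 1" using U(2) by auto
      then have "norm ?c * norm (f (seg s t \<psi>)) < 1" unfolding RR_dual_scale[OF f R] norm_mult .
      then show ?thesis unfolding c using B B' ke(1) by (simp add: field_simps)
    qed
    show "norm (f (seg s t \<psi>)) \<le> 2 / e * B"
    proof (rule field_le_epsilon)
      fix d :: real assume "d > 0"
      then have "norm (f (seg s t \<psi>)) \<le> 2 / e * (B + d * e / 2)" using ke(1) by (intro *) auto
      then show "norm (f (seg s t \<psi>)) \<le> 2 / e * B + d" using ke(1) by (simp add: field_simps)
    qed
  qed
qed

end

section \<open>Primitives\<close>

text \<open>The primitive vanishing at minus infinity. It is applied to globally integrable
  functions such as segments, and so requires neither a base point nor oriented integrals.\<close>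

definition cumul :: "(real \<Rightarrow> complex) \<Rightarrow> real \<Rightarrow> complex" where
  "cumul \<phi> r = (LINT x|lebesgue. (if x < r then \<phi> x else 0))"

definition lint :: "real \<Rightarrow> real \<Rightarrow> (real \<Rightarrow> complex) \<Rightarrow> complex" where
  "lint s t \<phi> = (LINT x|lebesgue. seg s t \<phi> x)"

lemma seg_indicator: "seg s t \<phi> = (\<lambda>x. indicator {s..<t} x *\<^sub>R \<phi> x)"
  by (auto simp: seg_def indicator_def)

lemma integrable_indicator_Ico [simp]: "integrable lebesgue (indicat_real {s..<t})" for s t :: real
  by (rule integrable_real_indicator) (cases "s \<le> t"; simp)+

lemma integrable_indicator_Icc [simp]: "integrable lebesgue (indicat_real {s..t})" for s t :: real
  by (rule integrable_real_indicator) (cases "s \<le> t"; simp)+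

lemma integrable_seg: "integrable lebesgue \<phi> \<Longrightarrow> integrable lebesgue (seg s t \<phi>)"
  unfolding seg_indicator by (rule integrable_mult_indicator) auto

lemma integrable_cut: "integrable lebesgue \<phi> \<Longrightarrow> integrable lebesgue (\<lambda>x. if x < r then \<phi> x else 0)" for \<phi> :: "real \<Rightarrow> complex"
proof -
  assume "integrable lebesgue \<phi>"
  then have "integrable lebesgue (\<lambda>x. indicator {..<r} x *\<^sub>R \<phi> x)" by (rule integrable_mult_indicator[rotated]) simp
  moreover have "(\<lambda>x. indicator {..<r} x *\<^sub>R \<phi> x) = (\<lambda>x. if x < r then \<phi> x else 0)" by auto
  ultimately show ?thesis by simp
qed

lemma cumul_diff:
  assumes "integrable lebesgue \<phi>" "r \<le> r'" shows "cumul \<phi> r' - cumul \<phi> r = lint r r' \<phi>"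
proof -
  have "cumul \<phi> r' - cumul \<phi> r = (LINT x|lebesgue. (if x < r' then \<phi> x else 0) - (if x < r then \<phi> x else 0))"
    unfolding cumul_def by (rule Bochner_Integration.integral_diff[symmetric]) (intro integrable_cut assms)+
  also have "\<dots> = lint r r' \<phi>" unfolding lint_def
    by (rule Bochner_Integration.integral_cong) (use assms in \<open>auto simp: seg_def\<close>)
  finally show ?thesis .
qed

lemma lint_norm_le:
  assumes ae: "AE x in lebesgue. x \<in> {s<..<t} \<longrightarrow> norm (\<phi> x) \<le> B" and st: "s \<le> t"
  shows "norm (lint s t \<phi>) \<le> B * (t - s)"
proof (cases "s < t")
  case True
  have B: "0 \<le> B"
  proof (rule ccontr)
    assume "\<not> 0 \<le> B"
    have "AE x in lebesgue. x \<notin> {s<..<t}"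
      using ae by eventually_elim (use \<open>\<not> 0 \<le> B\<close> norm_ge_zero order_trans in blast)
    then have "{s<..<t} \<in> null_sets lebesgue" by (subst AE_iff_null_sets) auto
    then show False using True by auto
  qed
  show ?thesis
  proof (cases "integrable lebesgue (seg s t \<phi>)")
    case int: True
    have ne: "AE x in lebesgue. x \<noteq> s" using AE_not_in[of "{s}" lebesgue] by (auto elim: eventually_mono)
    have "norm (lint s t \<phi>) \<le> (LINT x|lebesgue. norm (seg s t \<phi> x))"
      unfolding lint_def by (rule integral_norm_bound)
    also have "\<dots> \<le> (LINT x|lebesgue. indicator {s..<t} x * B)"
    proof (rule integral_mono_AE)
      show "integrable lebesgue (\<lambda>x. norm (seg s t \<phi> x))" using int by simp
      show "AE x in lebesgue. norm (seg s t \<phi> x) \<le> indicator {s..<t} x * B"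
        using ae ne by eventually_elim (auto simp: seg_def indicator_def)
    qed simp
    also have "\<dots> = B * (t - s)" using True by simp
    finally show ?thesis .
  next
    case False
    \<comment> \<open>The Bochner integral of a non-integrable function is 0 by convention, so the
      estimate reduces to nonnegativity of the right-hand side.\<close>
    then show ?thesis using B st by (simp add: lint_def not_integrable_integral_eq)
  qed
next
  case False
  then have "seg s t \<phi> = (\<lambda>_. 0)" by (auto simp: seg_def fun_eq_iff)
  then show ?thesis using False st by (simp add: lint_def)
qed

lemma lint_const: "s \<le> t \<Longrightarrow> lint s t (\<lambda>_. c) = of_real (t - s) * c"
  unfolding lint_def seg_indicator by (simp add: scaleR_conv_of_real)

lemma lint_lin:
  assumes "integrable lebesgue (seg s t g)" "integrable lebesgue (seg s t h)"
  shows "lint s t (\<lambda>x. \<alpha> * g x + \<beta> * h x) = \<alpha> * lint s t g + \<beta> * lint s t h"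
  using assms by (simp add: lint_def seg_lin)

lemma lint_split:
  assumes "integrable lebesgue (seg s u \<phi>)" "s \<le> t" "t \<le> u"
  shows "lint s u \<phi> = lint s t \<phi> + lint t u \<phi>"
proof -
  have "integrable lebesgue (seg s t \<phi>)" "integrable lebesgue (seg t u \<phi>)"
    using integrable_seg[OF assms(1), of s t] integrable_seg[OF assms(1), of t u] assms(2,3)
    by (simp_all add: seg_sub')
  then show ?thesis using assms by (simp add: lint_def seg_split[OF assms(2,3)])
qed

text \<open>Only the length of the inner segment enters, whatever the limits \<open>s\<close> and
  \<open>t\<close> of integration are. The factor \<open>q - p\<close> in \<open>x_seg_bound\<close>
  originates here.\<close>

lemma lint_seg_norm_le:
  assumes "AE x in lebesgue. x \<in> {p<..<q} \<longrightarrow> norm (\<phi> x) \<le> B" "p \<le> q" "0 \<le> B"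
  shows "norm (lint s t (seg p q \<phi>)) \<le> B * (q - p)"
proof -
  have eq: "seg s t (seg p q \<phi>) = seg (max s p) (min t q) \<phi>" by (auto simp: seg_def)
  show ?thesis
  proof (cases "max s p \<le> min t q")
    case True
    have "AE x in lebesgue. x \<in> {max s p<..<min t q} \<longrightarrow> norm (\<phi> x) \<le> B"
      using assms(1) by eventually_elim auto
    from lint_norm_le[OF this True] have "norm (lint s t (seg p q \<phi>)) \<le> B * (min t q - max s p)"
      by (simp add: lint_def eq)
    also have "\<dots> \<le> B * (q - p)" using assms by (intro mult_left_mono) auto
    finally show ?thesis .
  next
    case False
    then have "seg (max s p) (min t q) \<phi> = (\<lambda>_. 0)" by (auto simp: seg_def fun_eq_iff)
    then show ?thesis using assms by (simp add: lint_def eq)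
  qed
qed

definition at_side :: "bool \<Rightarrow> real \<Rightarrow> real filter" where
  "at_side b t = (if b then at_right t else at_left t)"

lemma ess_side_le: "ess_side b t \<le> at_side b t"
  by (simp add: ess_side_def at_side_def ess_right_def ess_left_def)

text \<open>Close to \<open>t\<close> the integrand is almost everywhere within \<open>e / 2\<close>
  of \<open>L\<close>, and so are its averages. The conclusion holds along the ordinary one-sided
  filter, not just the essential one, so that both sides can later be glued to a genuine
  derivative.\<close>

lemma cumul_deriv:
  assumes int: "integrable lebesgue \<phi>" and lim: "(\<phi> \<longlongrightarrow> L) (ess_side b t)"
  shows "((\<lambda>r. (cumul \<phi> r - cumul \<phi> t) / of_real (r - t)) \<longlongrightarrow> L) (at_side b t)"
proof (rule tendstoI)
  fix e :: real assume e: "e > 0"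
  then have "eventually (\<lambda>x. dist (\<phi> x) L < e / 2) (ess_side b t)" using tendstoD[OF lim, of "e/2"] by simp
  then obtain d where d: "d > 0" "AE s in lebesgue. s \<in> side b t d \<longrightarrow> dist (\<phi> s) L < e / 2"
    unfolding eventually_ess_side by blast
  have key: "norm (lint p q \<phi> - of_real (q - p) * L) \<le> e / 2 * (q - p)"
    if pq: "p \<le> q" "{p<..<q} \<subseteq> side b t d" for p q
  proof -
    have "integrable lebesgue (seg p q (\<lambda>_. L))"
      unfolding seg_indicator by (rule integrable_scaleR_left) simp
    then have "lint p q \<phi> - of_real (q - p) * L = lint p q (\<lambda>x. \<phi> x - L)"
      using lint_lin[OF integrable_seg[OF int], of p q "\<lambda>_. L" 1 "-1"] pq by (simp add: lint_const)
    moreover have "norm (lint p q (\<lambda>x. \<phi> x - L)) \<le> e / 2 * (q - p)"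
    proof (rule lint_norm_le[OF _ pq(1)])
      show "AE x in lebesgue. x \<in> {p<..<q} \<longrightarrow> norm (\<phi> x - L) \<le> e / 2"
        using d(2) by eventually_elim (use pq in \<open>auto simp: dist_norm\<close>)
    qed
    ultimately show ?thesis by simp
  qed
  have "dist ((cumul \<phi> r - cumul \<phi> t) / of_real (r - t)) L < e" if r: "r \<in> side b t d" for r
  proof -
    have ne: "r \<noteq> t" using r by (auto simp: side_def split: if_splits)
    have "norm (cumul \<phi> r - cumul \<phi> t - of_real (r - t) * L) \<le> e / 2 * \<bar>r - t\<bar>"
    proof (cases b)
      case True
      then have "t \<le> r" "{t<..<r} \<subseteq> side b t d" using r by (auto simp: side_def)
      from key[OF this] cumul_diff[OF int this(1)] show ?thesis using \<open>t \<le> r\<close> by simp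
    next
      case False
      then have "r \<le> t" "{r<..<t} \<subseteq> side b t d" using r by (auto simp: side_def)
      have "cumul \<phi> r - cumul \<phi> t - of_real (r - t) * L = - (lint r t \<phi> - of_real (t - r) * L)"
        using cumul_diff[OF int \<open>r \<le> t\<close>] by (simp add: algebra_simps)
      then show ?thesis using key[OF \<open>r \<le> t\<close> \<open>{r<..<t} \<subseteq> side b t d\<close>] \<open>r \<le> t\<close> by (simp only: norm_minus_cancel) simp
    qed
    moreover have "(cumul \<phi> r - cumul \<phi> t) / of_real (r - t) - L = (cumul \<phi> r - cumul \<phi> t - of_real (r - t) * L) / of_real (r - t)"
      using ne by (simp add: diff_divide_distrib)
    ultimately have "dist ((cumul \<phi> r - cumul \<phi> t) / of_real (r - t)) L \<le> e / 2"
      using ne by (simp only: dist_norm norm_divide norm_of_real) (simp add: divide_le_eq)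
    then show ?thesis using e by simp
  qed
  moreover have "eventually (\<lambda>r. r \<in> side b t d) (at_side b t)"
    unfolding at_side_def side_def using d(1)
    by (cases b) (auto simp: eventually_at_right_field eventually_at_left_field intro: exI[of _ "t+d"] exI[of _ "t-d"])
  ultimately show "\<forall>\<^sub>F r in at_side b t. dist ((cumul \<phi> r - cumul \<phi> t) / of_real (r - t)) L < e"
    by (auto elim: eventually_mono)
qed

lemma cumul_lipschitz:
  assumes "integrable lebesgue \<phi>" "AE x in lebesgue. norm (\<phi> x) \<le> B"
  shows "norm (cumul \<phi> r - cumul \<phi> t) \<le> B * \<bar>r - t\<bar>"
proof -
  have *: "norm (cumul \<phi> r - cumul \<phi> t) \<le> B * \<bar>r - t\<bar>" if "t \<le> r" for r t
  proof -
    have "AE x in lebesgue. x \<in> {t<..<r} \<longrightarrow> norm (\<phi> x) \<le> B" using assms(2) by eventually_elim simp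
    then show ?thesis using lint_norm_le[of t r \<phi> B] cumul_diff[OF assms(1) that] that by simp
  qed
  show ?thesis using *[of t r] *[of r t] by (cases "t \<le> r") (auto simp: norm_minus_commute abs_minus_commute)
qed

context line_interval begin

lemma mem_I: "s \<in> I \<Longrightarrow> t \<in> I \<Longrightarrow> s \<le> x \<Longrightarrow> x \<le> t \<Longrightarrow> x \<in> I"
  using cIcc_I[of s t] by auto

lemma AE_seg: assumes "AE x in lebesgue_on I. P (g x)" "P 0" "s \<in> I" "t \<in> I" shows "AE x in lebesgue. P (seg s t g x)"
  using assms(1) mem_I[OF assms(3,4)] assms(2) unfolding AE_I by (auto elim!: eventually_mono simp: seg_def)

lemma seg_lebesgue_measurable:
  assumes "g \<in> borel_measurable (lebesgue_on I)" "s \<in> I" "t \<in> I"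
  shows "seg s t g \<in> borel_measurable lebesgue"
proof -
  have "(\<lambda>x. if x \<in> I then seg s t g x else 0) \<in> borel_measurable lebesgue"
    using seg_measurable[OF assms(1)] by (subst borel_measurable_if) auto
  moreover have "(\<lambda>x. if x \<in> I then seg s t g x else 0) = seg s t g"
    using mem_I[OF assms(2,3)] by (auto simp: seg_def fun_eq_iff)
  ultimately show ?thesis by simp
qed

lemma seg_integrable: 
  assumes g: "g \<in> GG I" and st: "s \<in> I" "t \<in> I" shows "integrable lebesgue (seg s t g)"
proof -
  obtain B where B: "B \<ge> 0" "AE t in lebesgue_on I. norm (g t) \<le> B" using g by (rule GG_bound)
  have "integrable lebesgue (\<lambda>x. indicator {s..t} x * B)" by simp
  then have "integrable lebesgue (seg s t (seg s t g))"
  proof (rule Bochner_Integration.integrable_bound)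
    show "AE x in lebesgue. norm (seg s t (seg s t g) x) \<le> norm (indicator {s..t} x * B)"
      using AE_seg[of "\<lambda>z. norm z \<le> B", OF B(2) _ st] B(1) by (auto elim!: eventually_mono simp: seg_def indicator_def)
    show "seg s t (seg s t g) \<in> borel_measurable lebesgue" using seg_lebesgue_measurable[OF GG_measurable[OF g] st] by simp
  qed
  then show ?thesis by simp
qed

lemma G_deriv_cumul:
  assumes g: "g \<in> GG I" and st: "s \<in> I" "t \<in> I"
  shows "G_deriv I (cumul (seg s t g)) (seg s t g)"
proof -
  let ?\<phi> = "seg s t g" and ?F = "cumul (seg s t g)"
  have int: "integrable lebesgue ?\<phi>" by (rule seg_integrable[OF g st])
  obtain B where B: "B \<ge> 0" "AE t in lebesgue_on I. norm (g t) \<le> B" using g by (rule GG_bound)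
  have lip: "norm (?F r - ?F p) \<le> B * \<bar>r - p\<bar>" for r p
    using AE_seg[of "\<lambda>z. norm z \<le> B", OF B(2) _ st] B(1) by (intro cumul_lipschitz[OF int]) auto
  have cont: "continuous_on UNIV ?F"
    by (rule lipschitz_on_continuous_on[of B], rule lipschitz_onI) (use lip B in \<open>auto simp: dist_norm\<close>)
  have F: "(?F \<longlongrightarrow> ?F p) (ess_side b p)" for p b
    using cont by (intro ess_side_tendsto_at) (simp add: continuous_on_eq_continuous_at isCont_def)
  have "?F \<in> GG I"
  proof (rule GG_I)
    show "?F \<in> borel_measurable (lebesgue_on I)"
      by (intro continuous_imp_measurable_on_sets_lebesgue continuous_on_subset[OF cont]) auto
    have "norm (?F r) \<le> (LINT x|lebesgue. norm (?\<phi> x))" for r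
    proof -
      have "norm (?F r) \<le> (LINT x|lebesgue. norm (if x < r then ?\<phi> x else 0))"
        unfolding cumul_def by (rule integral_norm_bound)
      also have "\<dots> \<le> (LINT x|lebesgue. norm (?\<phi> x))"
        by (intro integral_mono integrable_norm integrable_cut int) auto
      finally show ?thesis .
    qed
    then show "AE r in lebesgue_on I. norm (?F r) \<le> (LINT x|lebesgue. norm (?\<phi> x))" by simp
    show "\<exists>l. (?F \<longlongrightarrow> l) (ess_side b p)" for p b using F by blast
  qed
  moreover have "seg s t g \<in> GG I" using g by (rule seg_GG)
  ultimately show ?thesis
    using cumul_deriv[OF int GG_tendsto[OF \<open>seg s t g \<in> GG I\<close>]]
    by (auto simp: G_deriv_iff slimI[OF F] intro!: filterlim_mono[OF _ order_refl ess_side_le])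
qed

text \<open>The operator \<open>V\<close> of the overview. It starts at 0 and is cut at
  \<open>T\<close>, so for regulated \<open>\<psi>\<close> and \<open>s < T\<close> its only
  possible jump is at \<open>T\<close>, by minus \<open>lint s T \<psi>\<close>.\<close>

definition vint :: "real \<Rightarrow> real \<Rightarrow> (real \<Rightarrow> complex) \<Rightarrow> real \<Rightarrow> complex" where
  "vint s T \<psi> = seg s T (\<lambda>t. lint s t \<psi>)"

lemma vint_seg [simp]: "seg s T (vint s T \<psi>) = vint s T \<psi>" by (simp add: vint_def)

lemma vint_cumul: "vint s T \<psi> = seg s T (cumul (seg s T \<psi>))"
proof -
  have "lint s t \<psi> = cumul (seg s T \<psi>) t" if "t < T" for t
    unfolding lint_def cumul_def
    by (rule Bochner_Integration.integral_cong) (use that in \<open>auto simp: seg_def\<close>)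
  then show ?thesis by (auto simp: vint_def seg_def[of s T "\<lambda>t. lint s t \<psi>"] seg_def[of s T "cumul (seg s T \<psi>)"])
qed

lemma G_deriv_vint:
  assumes "\<psi> \<in> GG I" "s \<in> I" "T \<in> I" shows "G_deriv I (vint s T \<psi>) (seg s T \<psi>)"
  using G_deriv_seg[OF G_deriv_cumul[OF assms], of s T] by (simp add: vint_cumul)

lemma vint_G_infty:
  assumes "\<psi> \<in> G_infty I" "s \<in> I" "T \<in> I" shows "vint s T \<psi> \<in> G_infty I"
  by (rule G_infty_antideriv[OF G_deriv_vint[OF G_infty_GG[OF assms(1)] assms(2,3)] seg_G_infty[OF assms(1)]])

lemma vint_RR: "\<psi> \<in> G_infty I \<Longrightarrow> s \<in> I \<Longrightarrow> T \<in> I \<Longrightarrow> vint s T \<psi> \<in> RR I"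
  using seg_RR[OF vint_G_infty, of \<psi> s T s T] by simp

text \<open>The primitive is bounded by \<open>(T - s) * B\<close> and its derivative, the cut
  \<open>\<psi>\<close>, obeys the old bound \<open>B\<close>; the factor
  \<open>max 1 (T - s)\<close> serves both. The passage from \<open>k\<close> to
  \<open>Suc k\<close> is what drives the reduction of order.\<close>

lemma bnd_vint:
  assumes b: "bnd k \<psi> B" and s: "s \<in> I" and T: "T \<in> I" and sT: "s \<le> T" and B: "0 \<le> B"
  shows "bnd (Suc k) (vint s T \<psi>) (max 1 (T - s) * B)"
proof -
  have "AE x in lebesgue. x \<in> {s<..<T} \<longrightarrow> norm (\<psi> x) \<le> B"
    using bnd_AE[OF b] unfolding AE_I by eventually_elim (use mem_I[OF s T] in auto)
  have "norm (lint s t \<psi>) \<le> B * (t - s)" if "s \<le> t" "t < T" for t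
  proof (rule lint_norm_le[OF _ that(1)])
    show "AE x in lebesgue. x \<in> {s<..<t} \<longrightarrow> norm (\<psi> x) \<le> B"
      using \<open>AE x in lebesgue. x \<in> {s<..<T} \<longrightarrow> norm (\<psi> x) \<le> B\<close> by eventually_elim (use that in auto)
  qed
  moreover have "B * (t - s) \<le> max 1 (T - s) * B" if "s \<le> t" "t < T" for t
    unfolding mult.commute[of B] using that B by (intro mult_right_mono) auto
  ultimately have *: "norm (lint s t \<psi>) \<le> max 1 (T - s) * B" if "s \<le> t" "t < T" for t
    using that order_trans by blast
  then have 1: "norm (vint s T \<psi> t) \<le> max 1 (T - s) * B" for t
    using B by (auto simp: vint_def seg_def)
  have "B \<le> max 1 (T - s) * B" using B mult_right_mono[of 1 "max 1 (T - s)" B] by simp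
  then have "bnd k (seg s T \<psi>) (max 1 (T - s) * B)" by (rule bnd_mono[OF bnd_seg[OF b B]])
  moreover have "\<psi> \<in> G_infty I" using b by (rule bnd_G_infty)
  ultimately show ?thesis
    using 1 G_deriv_vint[OF G_infty_GG s T, of \<psi>] vint_G_infty[OF _ s T, of \<psi>] by (auto simp only: bnd.simps intro!: AE_I2)
qed

end

section \<open>Kinks\<close>

definition cpoly :: "complex poly \<Rightarrow> real \<Rightarrow> complex" where
  "cpoly P t = poly P (of_real t)"

lemma cpoly_deriv: "(cpoly P has_vector_derivative cpoly (pderiv P) t) (at t)"
  unfolding cpoly_def by (rule has_vector_derivative_real_field) (rule poly_DERIV)

lemma cpoly_isCont: "isCont (cpoly P) t"
  using has_vector_derivative_continuous[OF cpoly_deriv] .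

text \<open>Smooth functions that decay, together with all derivatives, faster than any power on the side
  where the seed \<open>w\<close> does.\<close>

inductive_set decay :: "(real \<Rightarrow> complex) \<Rightarrow> (real \<Rightarrow> complex) set" for w where
  seed: "w \<in> decay w"
| times_id: "h \<in> decay w \<Longrightarrow> (\<lambda>t. of_real t * h t) \<in> decay w"
| times_seed: "h \<in> decay w \<Longrightarrow> (\<lambda>t. w t * h t) \<in> decay w"
| lin: "h \<in> decay w \<Longrightarrow> k \<in> decay w \<Longrightarrow> (\<lambda>t. \<alpha> * h t + \<beta> * k t) \<in> decay w"

text \<open>The seed satisfies a quadratic equation of logistic type, so its derivative is again a
  combination of itself and its square; the product rule keeps all other generators inside the
  class.\<close>

lemma decay_deriv:
  assumes w: "\<And>t. (w has_vector_derivative \<alpha> * w t + \<beta> * (w t * w t)) (at t)" and "h \<in> decay w"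
  shows "\<exists>h'\<in>decay w. \<forall>t. (h has_vector_derivative h' t) (at t)"
  using assms(2)
proof induction
  case seed
  have "(\<lambda>t. \<alpha> * w t + \<beta> * (w t * w t)) \<in> decay w" by (intro decay.intros)
  then show ?case by (rule bexI[rotated]) (simp add: w)
next
  case (times_id h)
  then obtain h' where h': "h' \<in> decay w" "\<And>t. (h has_vector_derivative h' t) (at t)" by blast
  have "(\<lambda>t. 1 * h t + 1 * (of_real t * h' t)) \<in> decay w" by (intro decay.lin times_id decay.times_id h')
  moreover have "((\<lambda>t. of_real t * h t) has_vector_derivative 1 * h t + 1 * (of_real t * h' t)) (at t)" for t
    using has_vector_derivative_mult[OF has_vector_derivative_of_real[OF DERIV_ident] h'(2)]
    by (simp add: add.commute)
  ultimately show ?case by - (rule bexI[rotated], assumption, blast)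
next
  case (times_seed h)
  then obtain h' where h': "h' \<in> decay w" "\<And>t. (h has_vector_derivative h' t) (at t)" by blast
  have "(\<lambda>t. 1 * (w t * h' t) + 1 * (\<alpha> * (w t * h t) + \<beta> * (w t * (w t * h t)))) \<in> decay w"
    by (intro decay.lin decay.times_seed times_seed h')
  moreover have "((\<lambda>t. w t * h t) has_vector_derivative 1 * (w t * h' t) + 1 * (\<alpha> * (w t * h t) + \<beta> * (w t * (w t * h t)))) (at t)" for t
    using has_vector_derivative_mult[OF w h'(2)] by (simp add: algebra_simps)
  ultimately show ?case by - (rule bexI[rotated], assumption, blast)
next
  case (lin h k \<gamma> \<delta>)
  then obtain h' k' where h': "h' \<in> decay w" "\<And>t. (h has_vector_derivative h' t) (at t)"
    "k' \<in> decay w" "\<And>t. (k has_vector_derivative k' t) (at t)" by blast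
  have "(\<lambda>t. \<gamma> * h' t + \<delta> * k' t) \<in> decay w" by (intro decay.lin h')
  moreover have "((\<lambda>t. \<gamma> * h t + \<delta> * k t) has_vector_derivative \<gamma> * h' t + \<delta> * k' t) (at t)" for t
    by (intro has_vector_derivative_add has_vector_derivative_mult_right h')
  ultimately show ?case by - (rule bexI[rotated], assumption, blast)
qed

text \<open>Multiplication by the variable raises the power, so the induction has to be over all
  \<open>m\<close> at once even though only \<open>m = 0\<close> is wanted in the end.\<close>

lemma decay_bounded:
  assumes w1: "\<And>t. norm (w t) \<le> 1" and w: "\<And>m. \<exists>B. \<forall>t\<in>S. norm (of_real t ^ m * w t) \<le> B"
    and "h \<in> decay w"
  shows "\<exists>B. \<forall>t\<in>S. norm (of_real t ^ m * h t) \<le> B"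
  using assms(3)
proof (induction arbitrary: m)
  case seed
  then show ?case using w by blast
next
  case (times_id h)
  from times_id.IH[of "Suc m"] show ?case by (simp add: mult_ac)
next
  case (times_seed h)
  obtain B where B: "\<forall>t\<in>S. norm (of_real t ^ m * h t) \<le> B" using times_seed.IH by blast
  have "norm (of_real t ^ m * (w t * h t)) \<le> B" if "t \<in> S" for t
  proof -
    have "norm (of_real t ^ m * (w t * h t)) = norm (w t) * norm (of_real t ^ m * h t)"
      by (simp add: norm_mult mult_ac)
    also have "\<dots> \<le> 1 * norm (of_real t ^ m * h t)" by (intro mult_right_mono w1) simp
    finally show ?thesis using B that by auto
  qed
  then show ?case by blast
next
  case (lin h k \<alpha> \<beta>)
  obtain B where B: "\<forall>t\<in>S. norm (of_real t ^ m * h t) \<le> B" using lin.IH(1) by blast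
  obtain C where C: "\<forall>t\<in>S. norm (of_real t ^ m * k t) \<le> C" using lin.IH(2) by blast
  have "norm (of_real t ^ m * (\<alpha> * h t + \<beta> * k t)) \<le> norm \<alpha> * B + norm \<beta> * C" if "t \<in> S" for t
  proof -
    have "of_real t ^ m * (\<alpha> * h t + \<beta> * k t) = \<alpha> * (of_real t ^ m * h t) + \<beta> * (of_real t ^ m * k t)"
      by (simp add: algebra_simps)
    then have "norm (of_real t ^ m * (\<alpha> * h t + \<beta> * k t)) \<le> norm \<alpha> * norm (of_real t ^ m * h t) + norm \<beta> * norm (of_real t ^ m * k t)"
      by (metis norm_mult norm_triangle_ineq)
    also have "\<dots> \<le> norm \<alpha> * B + norm \<beta> * C" using B C that by (intro add_mono mult_left_mono) auto
    finally show ?thesis .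
  qed
  then show ?case by blast
qed

text \<open>Logistic functions: \<open>wR\<close> decays exponentially to the right,
  \<open>wL\<close> to the left, and they add up to 1. Unlike a bump function they have derivatives
  that are polynomials in themselves.\<close>

definition wR :: "real \<Rightarrow> complex" where "wR t = of_real (1 / (1 + exp t))"
definition wL :: "real \<Rightarrow> complex" where "wL t = of_real (1 / (1 + exp (- t)))"

lemma wR_wL: "wR t + wL t = 1"
proof -
  have "1 / (1 + exp t) + 1 / (1 + exp (- t)) = 1"
  proof -
    have pos: "1 + exp t > 0" "exp t > 0" using exp_gt_zero[of t] by linarith+
    then have "1 / (1 + exp (- t)) = exp t / (1 + exp t)" by (simp add: exp_minus field_simps)
    moreover have "1 + exp t \<noteq> 0" using pos by linarith
    ultimately show ?thesis by (metis add_divide_distrib divide_self)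
  qed
  then show ?thesis unfolding wR_def wL_def by (metis of_real_1 of_real_add)
qed

lemma wR_deriv: "(wR has_vector_derivative -1 * wR t + 1 * (wR t * wR t)) (at t)"
proof -
  have e: "1 + exp t \<noteq> 0" by (smt (verit) exp_gt_zero)
  have "(1 - d) / (d * d) = - (1 / d) + 1 / d * (1 / d)" if "d \<noteq> 0" for d :: real
    using that by (simp add: field_simps)
  from this[OF e] have "((\<lambda>t. 1 / (1 + exp t)) has_real_derivative - (1 / (1 + exp t)) + 1 / (1 + exp t) * (1 / (1 + exp t))) (at t)"
    using e by (auto intro!: derivative_eq_intros)
  then have "((\<lambda>t. of_real (1 / (1 + exp t)) :: complex) has_vector_derivative
      of_real (- (1 / (1 + exp t)) + 1 / (1 + exp t) * (1 / (1 + exp t)))) (at t)"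
    by (intro has_vector_derivative_of_real) (simp add: has_real_derivative_iff_has_vector_derivative)
  then show ?thesis by (simp add: wR_def[abs_def])
qed

lemma wL_deriv: "(wL has_vector_derivative 1 * wL t + -1 * (wL t * wL t)) (at t)"
proof -
  have "wL = (\<lambda>t. 1 - wR t)" using wR_wL by (auto simp: fun_eq_iff algebra_simps)
  moreover have "((\<lambda>t. 1 - wR t) has_vector_derivative 0 - (-1 * wR t + 1 * (wR t * wR t))) (at t)"
    by (intro has_vector_derivative_diff has_vector_derivative_const wR_deriv)
  moreover have "0 - (-1 * wR t + 1 * (wR t * wR t)) = 1 * wL t + -1 * (wL t * wL t)"
    unfolding \<open>wL = (\<lambda>t. 1 - wR t)\<close> by (simp add: algebra_simps)
  ultimately show ?thesis by metis
qed

lemma power_le_fact_exp: "0 \<le> t \<Longrightarrow> t ^ m \<le> fact m * exp (t::real)"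
proof -
  assume t: "0 \<le> t"
  have "(\<Sum>n\<in>{m}. t ^ n /\<^sub>R fact n) \<le> (\<Sum>n. t ^ n /\<^sub>R fact n)"
    using t by (intro sum_le_suminf summable_exp_generic) auto
  then show ?thesis by (simp add: exp_def field_simps)
qed

text \<open>For \<open>t \<ge> 0\<close> the summand \<open>fact m\<close> comes from comparing the
  power with the exponential series; for negative \<open>t\<close> in the range,
  \<open>\<bar>t\<bar> \<le> \<bar>p\<bar>\<close>.\<close>

lemma logistic_decay: "\<exists>B. \<forall>t\<in>{p..}. \<bar>t\<bar> ^ m * (1 / (1 + exp t)) \<le> (B::real)"
proof (intro exI ballI)
  fix t assume t: "t \<in> {p..}"
  have "1 + exp t > 0" using exp_gt_zero[of t] by linarith
  then have e: "1 / (1 + exp t) \<le> 1" "1 / (1 + exp t) \<ge> 0" by (auto simp: divide_le_eq)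
  show "\<bar>t\<bar> ^ m * (1 / (1 + exp t)) \<le> \<bar>p\<bar> ^ m + fact m"
  proof (cases "t \<ge> 0")
    case True
    have "t ^ m * (1 / (1 + exp t)) \<le> fact m * exp t * (1 / (1 + exp t))"
      using power_le_fact_exp[OF True] e by (intro mult_right_mono) auto
    also have "\<dots> = fact m * (exp t / (1 + exp t))" by simp
    also have "\<dots> \<le> fact m * 1" by (intro mult_left_mono) (auto simp: divide_le_eq add_pos_pos)
    also have "\<dots> \<le> \<bar>p\<bar> ^ m + fact m" by simp
    finally show ?thesis using True by simp
  next
    case False
    have "\<bar>t\<bar> ^ m * (1 / (1 + exp t)) \<le> \<bar>p\<bar> ^ m * 1"
      using False t e by (intro mult_mono power_mono) auto
    also have "\<dots> \<le> \<bar>p\<bar> ^ m + fact m" by simp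
    finally show ?thesis .
  qed
qed

lemma decay_wR_bounded: "h \<in> decay wR \<Longrightarrow> \<exists>B. \<forall>t\<in>{p..}. norm (h t) \<le> B"
proof -
  assume h: "h \<in> decay wR"
  have "norm (wR t) \<le> 1" for t unfolding wR_def norm_of_real by (simp add: divide_le_eq add_pos_pos abs_of_pos)
  moreover have "\<exists>B. \<forall>t\<in>{p..}. norm (of_real t ^ m * wR t) \<le> B" for m
    using logistic_decay[of p m] by (simp add: wR_def norm_mult norm_power norm_divide add_pos_pos abs_of_pos del: of_real_divide of_real_add)
  ultimately show ?thesis using decay_bounded[OF _ _ h, of "{p..}" 0] by simp
qed

lemma decay_wL_bounded: "h \<in> decay wL \<Longrightarrow> \<exists>B. \<forall>t\<in>{..p}. norm (h t) \<le> B"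
proof -
  assume h: "h \<in> decay wL"
  have "norm (wL t) \<le> 1" for t unfolding wL_def norm_of_real by (simp add: divide_le_eq add_pos_pos abs_of_pos)
  moreover have "\<exists>B. \<forall>t\<in>{..p}. norm (of_real t ^ m * wL t) \<le> B" for m
  proof -
    obtain B where B: "\<forall>t\<in>{-p..}. \<bar>t\<bar> ^ m * (1 / (1 + exp t)) \<le> B" using logistic_decay by blast
    have "norm (of_real t ^ m * wL t) \<le> B" if "t \<in> {..p}" for t
      using B[rule_format, of "-t"] that
      by (simp add: wL_def norm_mult norm_power norm_divide add_pos_pos abs_of_pos del: of_real_divide of_real_add)
    then show ?thesis by blast
  qed
  ultimately show ?thesis using decay_bounded[OF _ _ h, of "{..p}" 0] by simp
qed

section \<open>Functions glued at one point from two decaying branches\<close>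

definition kink :: "real \<Rightarrow> (real \<Rightarrow> complex) \<Rightarrow> (real \<Rightarrow> complex) \<Rightarrow> real \<Rightarrow> complex" where
  "kink p L R = (\<lambda>r. if r < p then L r else R r)"

lemma ev_kink: "eventually (\<lambda>r. kink p L R r = (if (if b then p \<le> t else p < t) then R r else L r)) (ess_side b t)"
proof -
  define d where "d = (if t = p then 1 else \<bar>t - p\<bar>)"
  have "d > 0" by (simp add: d_def)
  then have "eventually (\<lambda>r. r \<in> side b t d) (ess_side b t)" unfolding eventually_ess_side by auto
  then show ?thesis by (rule eventually_mono) (auto simp: kink_def side_def d_def split: if_splits)
qed

lemma kink_isCont:
  assumes "isCont L t" "isCont R t" "t = p \<Longrightarrow> L p = R p" shows "isCont (kink p L R) t"
proof -
  consider "t < p" | "t > p" | "t = p" by linarith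
  then show ?thesis
  proof cases
    case 1
    then have "eventually (\<lambda>r. kink p L R r = L r) (nhds t)"
      using eventually_nhds_in_open[of "{..<p}" t] by (auto simp: kink_def elim: eventually_mono)
    then show ?thesis using assms(1) isCont_cong by blast
  next
    case 2
    then have "eventually (\<lambda>r. kink p L R r = R r) (nhds t)"
      using eventually_nhds_in_open[of "{p<..}" t] by (auto simp: kink_def elim: eventually_mono)
    then show ?thesis using assms(2) isCont_cong by blast
  next
    case 3
    have "(kink p L R \<longlongrightarrow> kink p L R p) (at p)"
    proof (rule filterlim_split_at)
      have "eventually (\<lambda>r. L r = kink p L R r) (at_left p)"
        by (auto simp: kink_def eventually_at_filter)
      moreover have "(L \<longlongrightarrow> L p) (at_left p)" using assms(1) 3 by (auto simp: isCont_def filterlim_at_split)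
      ultimately show "(kink p L R \<longlongrightarrow> kink p L R p) (at_left p)"
        using assms(3)[OF 3] by (auto simp: kink_def intro: Lim_transform_eventually)
      have "eventually (\<lambda>r. R r = kink p L R r) (at_right p)"
        by (auto simp: kink_def eventually_at_filter)
      moreover have "(R \<longlongrightarrow> R p) (at_right p)" using assms(2) 3 by (auto simp: isCont_def filterlim_at_split)
      ultimately show "(kink p L R \<longlongrightarrow> kink p L R p) (at_right p)"
        by (auto simp: kink_def intro: Lim_transform_eventually)
    qed
    then show ?thesis using 3 by (simp add: isCont_def)
  qed
qed

text \<open>Serves to see that for \<open>i \<noteq> j\<close> the \<open>i\<close>-th derivative of
  the \<open>j\<close>-th power of \<open>X - a\<close> vanishes at \<open>a\<close>: a linear
  factor survives if \<open>i < j\<close>, and the constant is 0 if \<open>j < i\<close>.\<close>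

lemma higher_pderiv_linear_power:
  "\<exists>c. (pderiv ^^ i) ([:- a, 1:] ^ j) = smult c ([:- a, 1:] ^ (j - i)) \<and> (j < i \<longrightarrow> c = 0)" for a :: complex
proof (induction i)
  case (Suc i)
  then obtain c where c: "(pderiv ^^ i) ([:- a, 1:] ^ j) = smult c ([:- a, 1:] ^ (j - i))" "j < i \<longrightarrow> c = 0" by blast
  show ?case
  proof (cases "i < j")
    case True
    then have "j - i = Suc (j - Suc i)" by simp
    then have "(pderiv ^^ Suc i) ([:- a, 1:] ^ j) = smult (c * of_nat (Suc (j - Suc i))) ([:- a, 1:] ^ (j - Suc i))"
      using c(1) by (simp add: pderiv_smult pderiv_power_Suc pderiv_pCons del: of_nat_Suc power_Suc)
    then show ?thesis using True by - (rule exI, rule conjI, assumption, simp)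
  next
    case False
    then have "(pderiv ^^ Suc i) ([:- a, 1:] ^ j) = smult 0 ([:- a, 1:] ^ (j - Suc i))"
      using c(1) by (simp add: pderiv_smult)
    then show ?thesis by - (rule exI, rule conjI, assumption, simp)
  qed
qed (auto intro: exI[of _ 1])

context line_interval begin

lemma borel_measurable_I: "f \<in> borel_measurable borel \<Longrightarrow> f \<in> borel_measurable (lebesgue_on I)"
  by (intro measurable_restrict_space1 measurable_completion) simp

text \<open>Each branch is used only on the half-line where it is bounded, which makes the glued
  functions bounded on an unbounded interval as well.\<close>

lemma kink_G_deriv:
  assumes L: "L \<in> decay wL" "L' \<in> decay wL" "\<And>t. (L has_vector_derivative L' t) (at t)"
    and R: "R \<in> decay wR" "R' \<in> decay wR" "\<And>t. (R has_vector_derivative R' t) (at t)"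
  shows "G_deriv I (kink p L R) (kink p L' R')"
proof -
  have cont: "isCont f t" if "f \<in> decay wL \<union> decay wR" for f t
    using that decay_deriv[OF wL_deriv] decay_deriv[OF wR_deriv] has_vector_derivative_continuous by blast
  have meas: "kink p f g \<in> borel_measurable (lebesgue_on I)" if "f \<in> decay wL" "g \<in> decay wR" for f g
  proof (rule borel_measurable_I)
    have [measurable]: "f \<in> borel_measurable borel" "g \<in> borel_measurable borel"
      using cont that by (auto intro!: borel_measurable_continuous_onI continuous_at_imp_continuous_on)
    show "kink p f g \<in> borel_measurable borel" unfolding kink_def by measurable
  qed
  have bd: "\<exists>B. \<forall>t. norm (kink p f g t) \<le> B" if fg: "f \<in> decay wL" "g \<in> decay wR" for f g
  proof -
    obtain B where B: "\<forall>t\<in>{..p}. norm (f t) \<le> B" using decay_wL_bounded[OF fg(1)] by blast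
    obtain C where C: "\<forall>t\<in>{p..}. norm (g t) \<le> C" using decay_wR_bounded[OF fg(2)] by blast
    have "norm (kink p f g t) \<le> max B C" for t
      using B[rule_format, of t] C[rule_format, of t] by (auto simp: kink_def)
    then show ?thesis by blast
  qed
  obtain B where B: "\<forall>t. norm (kink p L R t) \<le> B" using bd[OF L(1) R(1)] by blast
  obtain C where C: "\<forall>t. norm (kink p L' R' t) \<le> C" using bd[OF L(2) R(2)] by blast
  show ?thesis
  proof (rule G_deriv_germI[OF meas[OF L(1) R(1)] meas[OF L(2) R(2)]])
    show "AE t in lebesgue_on I. norm (kink p L R t) \<le> B" "AE t in lebesgue_on I. norm (kink p L' R' t) \<le> C"
      using B C by auto
    fix t b
    show "\<exists>f f'. (f has_vector_derivative f' t) (at t) \<and> isCont f' t \<and>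
        (\<forall>\<^sub>F s in ess_side b t. kink p L R s = f s) \<and> (\<forall>\<^sub>F s in ess_side b t. kink p L' R' s = f' s)"
    proof (cases "if b then p \<le> t else p < t")
      case True
      then show ?thesis using ev_kink[of p L R b t, unfolded if_P[OF True]] ev_kink[of p L' R' b t, unfolded if_P[OF True]] R(3) cont R(2)
        by - (rule exI[of _ R], rule exI[of _ R'], auto)
    next
      case False
      then show ?thesis using ev_kink[of p L R b t, unfolded if_not_P[OF False]] ev_kink[of p L' R' b t, unfolded if_not_P[OF False]] L(3) cont L(2)
        by - (rule exI[of _ L], rule exI[of _ L'], auto)
    qed
  qed
qed

lemma kink_deriv_ex:
  assumes L: "L \<in> decay wL" and R: "R \<in> decay wR" and d: "\<And>t. R t - L t = cpoly P t"
  obtains L' R' where "L' \<in> decay wL" "R' \<in> decay wR" "\<And>t. R' t - L' t = cpoly (pderiv P) t"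
    "G_deriv I (kink p L R) (kink p L' R')"
proof -
  obtain L' where L': "L' \<in> decay wL" "\<And>t. (L has_vector_derivative L' t) (at t)"
    using decay_deriv[OF wL_deriv L] by blast
  obtain R' where R': "R' \<in> decay wR" "\<And>t. (R has_vector_derivative R' t) (at t)"
    using decay_deriv[OF wR_deriv R] by blast
  have "R' t - L' t = cpoly (pderiv P) t" for t
  proof -
    have "(cpoly P has_vector_derivative R' t - L' t) (at t)"
      using has_vector_derivative_diff[OF R'(2) L'(2)] d by simp
    then show ?thesis using cpoly_deriv vector_derivative_unique_at by blast
  qed
  then show ?thesis using that L'(1) R'(1) kink_G_deriv[OF L L' R R'] by blast
qed

lemma kink_G_infty:
  assumes L: "L \<in> decay wL" and R: "R \<in> decay wR"
  shows "kink p L R \<in> G_infty I"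
proof (rule G_infty_coinduct[of _ "{kink p L R | L R. L \<in> decay wL \<and> R \<in> decay wR}"])
  fix k assume "k \<in> {kink p L R | L R. L \<in> decay wL \<and> R \<in> decay wR}"
  then obtain L R where k: "k = kink p L R" and L: "L \<in> decay wL" and R: "R \<in> decay wR" by blast
  obtain L' where L': "L' \<in> decay wL" "\<And>t. (L has_vector_derivative L' t) (at t)"
    using decay_deriv[OF wL_deriv L] by blast
  obtain R' where R': "R' \<in> decay wR" "\<And>t. (R has_vector_derivative R' t) (at t)"
    using decay_deriv[OF wR_deriv R] by blast
  show "\<exists>h\<in>{kink p L R | L R. L \<in> decay wL \<and> R \<in> decay wR}. G_deriv I k h"
    using kink_G_deriv[OF L L' R R'] k L'(1) R'(1) by blast
qed (use assms in blast)

text \<open>The difference of the branches is carried along as a polynomial, so that the jump of the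
  \<open>i\<close>-th derivative at \<open>p\<close> can be read off as the value there of the
  \<open>i\<close>-th derivative of \<open>P\<close>.\<close>

lemma kink_gders:
  assumes L: "L \<in> decay wL" and R: "R \<in> decay wR" and d: "\<And>t. R t - L t = cpoly P t"
  shows "\<exists>L'\<in>decay wL. \<exists>R'\<in>decay wR. (\<forall>t. R' t - L' t = cpoly ((pderiv ^^ i) P) t) \<and>
           ae_eq I (gders I i (kink p L R)) (kink p L' R')"
proof (induction i)
  case 0
  then show ?case using assms by - (rule bexI[of _ L], rule bexI[of _ R], auto simp: gders_def ae_eq_refl)
next
  case (Suc i)
  then obtain L1 R1 where 1: "L1 \<in> decay wL" "R1 \<in> decay wR" "\<And>t. R1 t - L1 t = cpoly ((pderiv ^^ i) P) t"
      "ae_eq I (gders I i (kink p L R)) (kink p L1 R1)" by blast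
  obtain L' R' where 2: "L' \<in> decay wL" "R' \<in> decay wR" "\<And>t. R' t - L' t = cpoly (pderiv ((pderiv ^^ i) P)) t"
    "G_deriv I (kink p L1 R1) (kink p L' R')" using kink_deriv_ex[OF 1(1-3)] by blast
  let ?g = "gders I i (kink p L R)"
  have G: "?g \<in> G_infty I" by (intro gders_G_infty kink_G_infty L R)
  have "G_deriv I ?g (kink p L' R')"
    using G_deriv_cong[OF 2(4) ae_eq_sym[OF 1(4)] G_infty_GG[OF G] ae_eq_refl] 2(4) by (simp add: G_deriv_iff)
  then have "ae_eq I (gder I ?g) (kink p L' R')" using G_deriv_unique[OF G_deriv_gder[OF G]] by blast
  moreover have "gder I ?g = gders I (Suc i) (kink p L R)" by (simp add: gders_def)
  ultimately show ?case using 2 by auto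
qed

text \<open>A step of \<open>P\<close> at \<open>p\<close>, made bounded on the possibly infinite interval by subtracting it from the smooth
  function \<open>P * wR\<close>: elements of \<open>FF_k\<close> are bounded. For \<open>P = (X - p)^j\<close> only the \<open>j\<close>-th derivative jumps.\<close>

definition step_poly :: "real \<Rightarrow> complex poly \<Rightarrow> real \<Rightarrow> complex" where
  "step_poly p P = kink p (\<lambda>r. - 1 * (cpoly P r * wL r) + 0 * wL r) (\<lambda>r. cpoly P r * wR r)"

lemma decay_cpoly: "(\<lambda>r. cpoly P r * w r) \<in> decay w"
proof (induction P)
  case 0
  have "(\<lambda>r. 0 * w r + 0 * w r) \<in> decay w" by (intro decay.intros)
  then show ?case by (simp add: cpoly_def)
next
  case (pCons a P)
  have "(\<lambda>r. a * w r + 1 * (of_real r * (cpoly P r * w r))) \<in> decay w"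
    by (intro decay.lin decay.seed decay.times_id pCons)
  then show ?case by (simp add: cpoly_def algebra_simps)
qed

lemma step_poly_eq: "step_poly p P r = cpoly P r * (wR r - (if r < p then 1 else 0))"
proof -
  have "wL r = 1 - wR r" using wR_wL[of r] by (simp add: algebra_simps)
  then show ?thesis by (simp add: step_poly_def kink_def right_diff_distrib)
qed

lemma step_poly_FF_k:
  assumes p: "p \<in> I" shows "step_poly p ([:- of_real p, 1:] ^ j) \<in> FF_k I j"
proof -
  let ?P = "[:- of_real p, 1 :: complex:] ^ j" let ?g = "step_poly p ?P"
  let ?L = "\<lambda>r. - 1 * (cpoly ?P r * wL r) + 0 * wL r" and ?R = "\<lambda>r. cpoly ?P r * wR r"
  have L: "?L \<in> decay wL" by (intro decay.lin decay.seed decay_cpoly)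
  have R: "?R \<in> decay wR" by (rule decay_cpoly)
  have d: "?R t - ?L t = cpoly ?P t" for t
  proof -
    have "?R t - ?L t = cpoly ?P t * (wR t + wL t)" by (simp add: algebra_simps)
    then show ?thesis by (simp only: wR_wL mult_1_right)
  qed
  have cont: "isCont f t" if "f \<in> decay wL \<union> decay wR" for f t
    using that decay_deriv[OF wL_deriv] decay_deriv[OF wR_deriv] has_vector_derivative_continuous by blast
  have G: "?g \<in> G_infty I" unfolding step_poly_def by (rule kink_G_infty[OF L R])
  have ex: "\<exists>L'\<in>decay wL. \<exists>R'\<in>decay wR. (\<forall>t. R' t - L' t = cpoly ((pderiv ^^ i) ?P) t) \<and> ae_eq I (gders I i ?g) (kink p L' R')" for i
    unfolding step_poly_def by (rule kink_gders[OF L R d])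
  have "gders I i ?g \<in> bdd_continuous I" if ij: "i \<noteq> j" for i
  proof -
    obtain L' R' where 1: "L' \<in> decay wL" "R' \<in> decay wR" "\<forall>t. R' t - L' t = cpoly ((pderiv ^^ i) ?P) t"
      "ae_eq I (gders I i ?g) (kink p L' R')" using ex[of i] by blast
    obtain c where c: "(pderiv ^^ i) ?P = smult c ([:- of_real p, 1:] ^ (j - i))" "j < i \<longrightarrow> c = 0"
      using higher_pderiv_linear_power[of i "of_real p" j] by blast
    \<comment> \<open>Either \<open>j < i\<close> and then \<open>c = 0\<close>, or
      \<open>i < j\<close> and a positive power of \<open>X - p\<close> is evaluated at
      \<open>p\<close>.\<close>
    have "R' p - L' p = 0" using 1(3) c ij by (cases "j < i") (auto simp: cpoly_def)
    then have "L' p = R' p" by simp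
    then have "isCont (kink p L' R') t" for t using cont 1 by (intro kink_isCont) auto
    then have "continuous_on I (kink p L' R')" by (intro continuous_at_imp_continuous_on) auto
    moreover obtain B where B: "\<forall>t\<in>{..p}. norm (L' t) \<le> B" using decay_wL_bounded[OF 1(1)] by blast
    obtain C where C: "\<forall>t\<in>{p..}. norm (R' t) \<le> C" using decay_wR_bounded[OF 1(2)] by blast
    have "norm (kink p L' R' t) \<le> max B C" for t
      using B[rule_format, of t] C[rule_format, of t] by (auto simp: kink_def)
    then have "bounded (kink p L' R' ` I)" unfolding bounded_iff by blast
    ultimately show ?thesis using 1(4) unfolding bdd_continuous_def by blast
  qed
  moreover have "gders I j ?g \<in> piecewise_continuous I"
  proof -
    obtain L' R' where 1: "L' \<in> decay wL" "R' \<in> decay wR"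
      "ae_eq I (gders I j ?g) (kink p L' R')" using ex[of j] by blast
    have "isCont (kink p L' R') t" if "t \<noteq> p" for t using cont 1 that by (intro kink_isCont) auto
    then have "{t \<in> K. \<not> isCont (kink p L' R') t} \<subseteq> {p}" for K by auto
    then have "finite {t \<in> K. \<not> isCont (kink p L' R') t}" for K by (rule finite_subset) simp
    then show ?thesis using 1(3) unfolding piecewise_continuous_def by blast
  qed
  ultimately show ?thesis using G by (simp add: FF_k_def)
qed

lemma FF_k_FF: "g \<in> FF_k I k \<Longrightarrow> g \<in> FF I"
  unfolding FF_def by (intro CollectI exI[of _ "{g}"] exI[of _ "\<lambda>_. 1"]) auto

lemma FF_lin: assumes "g \<in> FF I" "h \<in> FF I" shows "(\<lambda>t. \<alpha> * g t + \<beta> * h t) \<in> FF I"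
proof -
  obtain P c where P: "g = (\<lambda>t. \<Sum>f\<in>P. c f * f t)" "finite P" "P \<subseteq> (\<Union>k. FF_k I k)" using assms(1) by (auto simp: FF_def)
  obtain Q d where Q: "h = (\<lambda>t. \<Sum>f\<in>Q. d f * f t)" "finite Q" "Q \<subseteq> (\<Union>k. FF_k I k)" using assms(2) by (auto simp: FF_def)
  define e where "e f = \<alpha> * (if f \<in> P then c f else 0) + \<beta> * (if f \<in> Q then d f else 0)" for f
  have "\<alpha> * g t + \<beta> * h t = (\<Sum>f\<in>P \<union> Q. e f * f t)" for t
  proof -
    have "(\<Sum>f\<in>P. c f * f t) = (\<Sum>f\<in>P \<union> Q. (if f \<in> P then c f else 0) * f t)"
      using P(2) Q(2) by (intro sum.mono_neutral_cong_left) auto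
    moreover have "(\<Sum>f\<in>Q. d f * f t) = (\<Sum>f\<in>P \<union> Q. (if f \<in> Q then d f else 0) * f t)"
      using P(2) Q(2) by (intro sum.mono_neutral_cong_left) auto
    ultimately show ?thesis unfolding P(1) Q(1) e_def
      by (simp only: sum_distrib_left sum.distrib[symmetric]) (simp add: algebra_simps)
  qed
  then show ?thesis unfolding FF_def using P(2,3) Q(2,3)
    by (intro CollectI exI[of _ "P \<union> Q"] exI[of _ e]) auto
qed

text \<open>Expands \<open>P\<close> in powers of \<open>X - p\<close> in the manner of Horner:
  writing \<open>X\<close> as \<open>(X - p) + p\<close> either raises the exponent \<open>j\<close>
  or leaves a scalar, hence the induction over \<open>P\<close> with \<open>j\<close>
  arbitrary.\<close>

lemma step_poly_FF: assumes p: "p \<in> I" shows "step_poly p P \<in> FF I"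
proof -
  have "step_poly p (P * [:- of_real p, 1:] ^ j) \<in> FF I" for j
  proof (induction P arbitrary: j)
    case 0
    have "(\<lambda>r. 0 * step_poly p 1 r + 0 * step_poly p 1 r) \<in> FF I"
      using FF_lin[OF FF_k_FF[OF step_poly_FF_k[OF p, of 0]] FF_k_FF[OF step_poly_FF_k[OF p, of 0]], of 0 0] by simp
    moreover have "step_poly p 0 = (\<lambda>r. 0)" by (simp add: step_poly_eq cpoly_def fun_eq_iff)
    ultimately show ?case by simp
  next
    case (pCons a P)
    let ?q = "[:- of_real p, 1::complex:]"
    have "step_poly p (pCons a P * ?q ^ j) = (\<lambda>r. a * step_poly p (?q ^ j) r +
        1 * (1 * step_poly p (P * ?q ^ Suc j) r + of_real p * step_poly p (P * ?q ^ j) r))"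
      by (simp add: step_poly_eq cpoly_def fun_eq_iff algebra_simps)
    also have "\<dots> \<in> FF I" by (intro FF_lin pCons.IH FF_k_FF[OF step_poly_FF_k[OF p]])
    finally show ?case .
  qed
  from this[of 0] show ?thesis by simp
qed

text \<open>The smooth part \<open>cpoly P r * wR r\<close> does not depend on the location of the
  step, so it cancels in the difference of the steps at \<open>s\<close> and
  \<open>t\<close>.\<close>

lemma seg_cpoly_FF: assumes "s \<in> I" "t \<in> I" "s \<le> t" shows "seg s t (cpoly P) \<in> FF I"
proof -
  have "seg s t (cpoly P) = (\<lambda>r. 1 * step_poly s P r + -1 * step_poly t P r)"
    using assms(3) by (auto simp: step_poly_eq seg_def fun_eq_iff algebra_simps)
  also have "\<dots> \<in> FF I" by (intro FF_lin step_poly_FF assms)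
  finally show ?thesis .
qed

section \<open>Polynomial pieces\<close>

text \<open>A polynomial may be unbounded on \<open>I\<close> and then lies outside
  \<open>GG I\<close>, so \<open>G_deriv_seg\<close> cannot be quoted; the bounds come from
  compactness of \<open>{s..t}\<close>.\<close>

lemma G_deriv_seg_cpoly: "G_deriv I (seg s t (cpoly P)) (seg s t (cpoly (pderiv P)))"
proof -
  have bd: "\<exists>B. \<forall>r. norm (seg s t (cpoly Q) r) \<le> B" for Q
  proof -
    have "compact (cpoly Q ` {s..t})"
      by (intro compact_continuous_image continuous_at_imp_continuous_on ballI cpoly_isCont) auto
    then have "bounded (cpoly Q ` {s..t})" by (rule compact_imp_bounded)
    then obtain B where "\<forall>r\<in>{s..t}. norm (cpoly Q r) \<le> B" by (auto simp: bounded_iff)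
    then have "norm (seg s t (cpoly Q) r) \<le> max 0 B" for r by (auto simp: seg_def le_max_iff_disj)
    then show ?thesis by blast
  qed
  obtain B where B: "\<forall>r. norm (seg s t (cpoly P) r) \<le> B" using bd by blast
  obtain C where C: "\<forall>r. norm (seg s t (cpoly (pderiv P)) r) \<le> C" using bd by blast
  have meas: "seg s t (cpoly Q) \<in> borel_measurable (lebesgue_on I)" for Q
    by (intro seg_measurable borel_measurable_I borel_measurable_continuous_onI continuous_at_imp_continuous_on ballI cpoly_isCont)
  show ?thesis
  proof (rule G_deriv_germI[OF meas meas])
    show "AE r in lebesgue_on I. norm (seg s t (cpoly P) r) \<le> B" "AE r in lebesgue_on I. norm (seg s t (cpoly (pderiv P)) r) \<le> C"
      using B C by auto
    fix p b
    show "\<exists>f f'. (f has_vector_derivative f' p) (at p) \<and> isCont f' p \<and>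
        (\<forall>\<^sub>F r in ess_side b p. seg s t (cpoly P) r = f r) \<and> (\<forall>\<^sub>F r in ess_side b p. seg s t (cpoly (pderiv P)) r = f' r)"
    proof (cases "in_seg b s t p")
      case True
      then show ?thesis using ev_seg[of s t "cpoly P" b p] ev_seg[of s t "cpoly (pderiv P)" b p] cpoly_deriv cpoly_isCont
        by - (rule exI[of _ "cpoly P"], rule exI[of _ "cpoly (pderiv P)"], auto)
    next
      case False
      then show ?thesis using ev_seg[of s t "cpoly P" b p] ev_seg[of s t "cpoly (pderiv P)" b p]
        by - (rule exI[of _ "\<lambda>_. 0"], rule exI[of _ "\<lambda>_. 0"], auto)
    qed
  qed
qed

lemma seg_cpoly_G_infty: "seg s t (cpoly P) \<in> G_infty I"
  by (rule G_infty_coinduct[of _ "range (\<lambda>P. seg s t (cpoly P))"]) (auto intro: G_deriv_seg_cpoly)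

lemma slim_seg_cpoly: "slim b (seg s t (cpoly P)) p = (if in_seg b s t p then cpoly P p else 0)"
proof -
  have "slim b (cpoly P) p = cpoly P p"
    using cpoly_isCont[of p P] by (intro slimI ess_side_tendsto_at) (simp add: isCont_def)
  then show ?thesis by (simp add: slim_seg)
qed

lemma Delta_seg_cpoly:
  assumes c: "\<And>\<phi>. \<phi> \<in> RR_F I \<Longrightarrow> g \<phi> = (\<Sum>t | t \<in> I \<and> jump t \<phi> \<noteq> 0. c t * jump t \<phi>)"
    and s: "s \<in> I" and t: "t \<in> I" and st: "s < t"
  shows "g (seg s t (cpoly P)) = c s * cpoly P s - c t * cpoly P t"
proof -
  let ?\<phi> = "seg s t (cpoly P)"
  have "?\<phi> \<in> RR_F I" using seg_RR[OF seg_cpoly_G_infty s t, of s t P] seg_cpoly_FF[OF s t] st by (simp add: RR_F_def)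
  then have "g ?\<phi> = (\<Sum>r | r \<in> I \<and> jump r ?\<phi> \<noteq> 0. c r * jump r ?\<phi>)" by (rule c)
  also have j: "jump r ?\<phi> = (if r = s then cpoly P s else if r = t then - cpoly P t else 0)" for r
    using st by (auto simp: jump_def slim_seg_cpoly in_seg_def simp flip: slim_True slim_False)
  \<comment> \<open>If \<open>P\<close> vanishes at an endpoint, the index set is smaller than
    \<open>{s, t}\<close>, but the additional terms are zero.\<close>
  have "(\<Sum>r | r \<in> I \<and> jump r ?\<phi> \<noteq> 0. c r * jump r ?\<phi>) = (\<Sum>r\<in>{s, t}. c r * jump r ?\<phi>)"
    using s t by (intro sum.mono_neutral_left) (auto simp: j split: if_splits)
  also have "\<dots> = c s * cpoly P s - c t * cpoly P t" using st by (simp add: j)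
  finally show ?thesis .
qed

end

section \<open>Functionals in Delta on primitives\<close>

lemma ex_antiderivative_poly: "\<exists>Q. pderiv Q = (P :: complex poly)"
proof -
  have "\<exists>Q. pderiv Q = (\<Sum>i\<le>n. monom (coeff P i) i)" for n
  proof (induction n)
    case 0
    show ?case by (rule exI[of _ "monom (coeff P 0) 1"]) (simp add: pderiv_monom)
  next
    case (Suc n)
    then obtain Q where "pderiv Q = (\<Sum>i\<le>n. monom (coeff P i) i)" by blast
    then show ?case
      by (intro exI[of _ "Q + monom (coeff P (Suc n) / of_nat (Suc (Suc n))) (Suc (Suc n))"])
        (simp add: pderiv_add pderiv_monom del: of_nat_Suc)
  qed
  from this[of "degree P"] show ?thesis by (simp add: poly_as_sum_of_monoms)
qed

lemma lint_cpoly: assumes "a \<le> b" shows "lint a b (cpoly (pderiv Q)) = cpoly Q b - cpoly Q a"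
proof -
  have cont: "continuous_on {a..b} (cpoly (pderiv Q))"
    by (intro continuous_at_imp_continuous_on ballI cpoly_isCont)
  have "lint a b (cpoly (pderiv Q)) = (LINT x|lebesgue. indicator {a..b} x *\<^sub>R cpoly (pderiv Q) x)"
  proof -
    have m: "cpoly (pderiv Q) \<in> borel_measurable lebesgue"
      by (rule measurable_completion)
        (auto intro!: borel_measurable_continuous_onI continuous_at_imp_continuous_on cpoly_isCont)
    have "AE x in lebesgue. x \<noteq> b" using AE_not_in[of "{b}" lebesgue] by (auto elim: eventually_mono)
    then have "AE x in lebesgue. seg a b (cpoly (pderiv Q)) x = indicator {a..b} x *\<^sub>R cpoly (pderiv Q) x"
      by eventually_elim (auto simp: seg_def indicator_def)
    then show ?thesis unfolding lint_def using m
      by (intro integral_cong_AE) (auto simp: seg_indicator intro!: borel_measurable_scaleR borel_measurable_indicator)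
  qed
  also have "\<dots> = (LINT x|lborel. indicator {a..b} x *\<^sub>R cpoly (pderiv Q) x)"
    by (rule integral_completion)
      (intro borel_measurable_scaleR borel_measurable_indicator, auto intro!: borel_measurable_continuous_onI continuous_at_imp_continuous_on cpoly_isCont)
  also have "\<dots> = cpoly Q b - cpoly Q a"
    by (rule integral_FTC_Icc[OF assms _ cont]) (rule has_vector_derivative_at_within[OF cpoly_deriv])
  finally show ?thesis .
qed

section \<open>Piecewise polynomial approximation and the values of \<open>Delta\<close>
  functionals\<close>

context line_interval begin

text \<open>The two pieces live on disjoint sets, so the bound stays \<open>e\<close> instead of
  doubling; errors do not accumulate over a partition.\<close>

lemma bnd_join:
  assumes "bnd k (seg a b f) e" "bnd k (seg b d h) e" "0 \<le> e"
  shows "bnd k (\<lambda>r. seg a b f r + seg b d h r) e"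
  using assms(1,2)
proof (induction k arbitrary: f h)
  case 0
  have "AE r in lebesgue_on I. norm (seg a b f r + seg b d h r) \<le> e"
    using bnd_AE[OF 0(1)] bnd_AE[OF 0(2)] by eventually_elim (auto simp: seg_def)
  then show ?case using 0 G_infty_lin[of "seg a b f" "seg b d h" 1 1] by simp
next
  case (Suc k)
  obtain f' where f': "G_deriv I (seg a b f) f'" "bnd k f' e" using Suc.prems(1) by auto
  obtain h' where h': "G_deriv I (seg b d h) h'" "bnd k h' e" using Suc.prems(2) by auto
  \<comment> \<open>Cutting the derivatives again restores the form required by the induction
    hypothesis.\<close>
  have "G_deriv I (seg a b f) (seg a b f')" "G_deriv I (seg b d h) (seg b d h')"
    using G_deriv_seg[OF f'(1), of a b] G_deriv_seg[OF h'(1), of b d] by auto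
  from G_deriv_lin[OF this, of 1 1]
  have "G_deriv I (\<lambda>r. seg a b f r + seg b d h r) (\<lambda>r. seg a b f' r + seg b d h' r)" by simp
  moreover have "bnd k (\<lambda>r. seg a b f' r + seg b d h' r) e"
    by (intro Suc.IH bnd_seg f' h' assms)
  moreover have "AE r in lebesgue_on I. norm (seg a b f r + seg b d h r) \<le> e"
    using bnd_AE[OF Suc.prems(1)] bnd_AE[OF Suc.prems(2)] by eventually_elim (auto simp: seg_def)
  moreover have "(\<lambda>r. seg a b f r + seg b d h r) \<in> G_infty I"
    using bnd_G_infty[OF Suc.prems(1)] bnd_G_infty[OF Suc.prems(2)] G_infty_lin[of "seg a b f" "seg b d h" 1 1] by simp
  ultimately show ?case by auto
qed

lemma seg_diff_cpoly_G_infty: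
  "\<psi> \<in> G_infty I \<Longrightarrow> seg a c (\<lambda>r. \<psi> r - cpoly Q r) \<in> G_infty I"
proof -
  assume "\<psi> \<in> G_infty I"
  then have "(\<lambda>r. 1 * seg a c \<psi> r + -1 * seg a c (cpoly Q) r) \<in> G_infty I"
    by (intro G_infty_lin seg_G_infty seg_cpoly_G_infty)
  moreover have "(\<lambda>r. 1 * seg a c \<psi> r + -1 * seg a c (cpoly Q) r) = seg a c (\<lambda>r. \<psi> r - cpoly Q r)"
    by (auto simp: seg_def)
  ultimately show ?thesis by simp
qed

text \<open>Induction on the order: approximate the derivative, integrate the polynomial, and adjust
  the constant. The new error of order zero is small because \<open>\<psi>\<close> and the
  polynomial have the same one-sided limit at \<open>x\<close>. On \<open>side b x d\<close> one
  polynomial serves all subsegments.\<close>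

lemma approx_one_sided:
  assumes \<psi>: "\<psi> \<in> G_infty I" and x: "x \<in> I" and e: "e > 0"
  shows "\<exists>Q. \<exists>d>0. \<forall>a c. {a<..<c} \<subseteq> side b x d \<longrightarrow> bnd k (seg a c (\<lambda>r. \<psi> r - cpoly Q r)) e"
  using \<psi>
proof (induction k arbitrary: \<psi>)
  have close: "\<exists>d>0. \<forall>a c. {a<..<c} \<subseteq> side b x d \<longrightarrow> (AE r in lebesgue_on I. norm (seg a c (\<lambda>r. \<psi> r - cpoly Q r) r) \<le> e)"
    if \<psi>: "\<psi> \<in> G_infty I" and Q: "cpoly Q x = slim b \<psi> x" for Q \<psi>
  proof -
    have "(cpoly Q \<longlongrightarrow> cpoly Q x) (ess_side b x)"
      using cpoly_isCont by (intro ess_side_tendsto_at) (simp add: isCont_def)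
    then have "((\<lambda>r. \<psi> r - cpoly Q r) \<longlongrightarrow> slim b \<psi> x - cpoly Q x) (ess_side b x)"
      by (intro tendsto_diff GG_tendsto G_infty_GG \<psi> x)
    then have "((\<lambda>r. \<psi> r - cpoly Q r) \<longlongrightarrow> 0) (ess_side b x)" by (simp add: Q)
    from tendstoD[OF this e] obtain d where d: "d > 0" "AE r in lebesgue. r \<in> side b x d \<longrightarrow> norm (\<psi> r - cpoly Q r) < e"
      unfolding eventually_ess_side by auto
    have "AE r in lebesgue_on I. norm (seg a c (\<lambda>r. \<psi> r - cpoly Q r) r) \<le> e" if ac: "{a<..<c} \<subseteq> side b x d" for a c
    proof -
      have "AE r in lebesgue. r \<noteq> a" using AE_not_in[of "{a}" lebesgue] by (auto elim: eventually_mono)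
      with d(2) have "AE r in lebesgue. norm (seg a c (\<lambda>r. \<psi> r - cpoly Q r) r) \<le> e"
      proof eventually_elim
        case (elim r)
        show ?case
        proof (cases "a \<le> r \<and> r < c")
          case True
          then have "r \<in> {a<..<c}" using elim(2) by auto
          then have "r \<in> side b x d" using ac by blast
          then show ?thesis using elim(1) True by (auto simp: seg_def)
        qed (use e in \<open>auto simp: seg_def\<close>)
      qed
      then show ?thesis unfolding AE_I by (auto elim: eventually_mono)
    qed
    then show ?thesis using d(1) by blast
  qed
  {
    case 0
    have "cpoly [:slim b \<psi> x:] x = slim b \<psi> x" by (simp add: cpoly_def)
    from close[OF 0 this] obtain d where d: "d > 0" "\<forall>a c. {a<..<c} \<subseteq> side b x d \<longrightarrow>
        (AE r in lebesgue_on I. norm (seg a c (\<lambda>r. \<psi> r - cpoly [:slim b \<psi> x:] r) r) \<le> e)" by blast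
    show ?case by (rule exI[of _ "[:slim b \<psi> x:]"], rule exI[of _ d]) (use d seg_diff_cpoly_G_infty[OF 0] in simp)
  next
    case (Suc k)
    obtain \<psi>' where \<psi>': "\<psi>' \<in> G_infty I" "G_deriv I \<psi> \<psi>'" using Suc.prems by (rule G_infty_deriv)
    obtain Q' d' where Q': "d' > 0" "\<forall>a c. {a<..<c} \<subseteq> side b x d' \<longrightarrow> bnd k (seg a c (\<lambda>r. \<psi>' r - cpoly Q' r)) e"
      using Suc.IH[OF \<psi>'(1)] by blast
    obtain Q0 where Q0: "pderiv Q0 = Q'" using ex_antiderivative_poly by blast
    \<comment> \<open>The added constant makes the value at \<open>x\<close> equal to the one-sided
      limit of \<open>\<psi>\<close> and does not affect the derivative.\<close>
    define Q where "Q = Q0 + [:slim b \<psi> x - cpoly Q0 x:]"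
    have Q: "pderiv Q = Q'" "cpoly Q x = slim b \<psi> x"
      by (auto simp: Q_def pderiv_add pderiv_pCons Q0 cpoly_def)
    obtain d where d: "d > 0" "\<forall>a c. {a<..<c} \<subseteq> side b x d \<longrightarrow>
        (AE r in lebesgue_on I. norm (seg a c (\<lambda>r. \<psi> r - cpoly Q r) r) \<le> e)" using close[OF Suc.prems Q(2)] by blast
    have "bnd (Suc k) (seg a c (\<lambda>r. \<psi> r - cpoly Q r)) e" if "{a<..<c} \<subseteq> side b x (min d d')" for a c
    proof -
      have "{a<..<c} \<subseteq> side b x d" "{a<..<c} \<subseteq> side b x d'"
        using that by (auto simp: side_def subset_iff split: if_splits)
      then have 1: "AE r in lebesgue_on I. norm (seg a c (\<lambda>r. \<psi> r - cpoly Q r) r) \<le> e"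
        "bnd k (seg a c (\<lambda>r. \<psi>' r - cpoly Q' r)) e" using d Q' by blast+
      have "G_deriv I (\<lambda>r. 1 * seg a c \<psi> r + -1 * seg a c (cpoly Q) r) (\<lambda>r. 1 * seg a c \<psi>' r + -1 * seg a c (cpoly Q') r)"
        unfolding Q(1)[symmetric] by (intro G_deriv_lin G_deriv_seg G_deriv_seg_cpoly \<psi>')
      moreover have "(\<lambda>r. 1 * seg a c \<psi> r + -1 * seg a c (cpoly Q) r) = seg a c (\<lambda>r. \<psi> r - cpoly Q r)"
        "(\<lambda>r. 1 * seg a c \<psi>' r + -1 * seg a c (cpoly Q') r) = seg a c (\<lambda>r. \<psi>' r - cpoly Q' r)"
        by (auto simp: seg_def)
      ultimately show ?thesis using 1 seg_diff_cpoly_G_infty[OF Suc.prems] by auto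
    qed
    then show ?case using d(1) Q'(1) by (intro exI[of _ Q] exI[of _ "min d d'"]) auto
  }
qed

lemma vint_seg_arg [simp]: "vint s T (seg s T \<phi>) = vint s T \<phi>" by (simp add: vint_cumul)

lemma lint_seg_arg [simp]: "lint s T (seg s T \<phi>) = lint s T \<phi>" by (simp add: lint_def)

lemma seg_affine: "seg a b (\<lambda>r. z + lint a r \<psi>) = (\<lambda>r. z * seg a b (\<lambda>_. 1) r + 1 * vint a b \<psi> r)"
  by (auto simp: seg_def vint_def)

lemma seg_affine_RR: "\<psi> \<in> G_infty I \<Longrightarrow> a \<in> I \<Longrightarrow> b \<in> I \<Longrightarrow> seg a b (\<lambda>r. z + lint a r \<psi>) \<in> RR I"
  unfolding seg_affine by (intro RR_lin seg_RR vint_RR G_infty_const)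

lemma vint_lin:
  assumes "\<phi> \<in> GG I" "\<psi> \<in> GG I" "s \<in> I" "T \<in> I"
  shows "vint s T (\<lambda>r. \<alpha> * \<phi> r + \<beta> * \<psi> r) = (\<lambda>r. \<alpha> * vint s T \<phi> r + \<beta> * vint s T \<psi> r)"
proof -
  have "lint s t (\<lambda>r. \<alpha> * \<phi> r + \<beta> * \<psi> r) = \<alpha> * lint s t \<phi> + \<beta> * lint s t \<psi>" if "s \<le> t" "t < T" for t
    using that mem_I[OF assms(3,4)] assms by (intro lint_lin seg_integrable) auto
  then show ?thesis by (auto simp: vint_def seg_def)
qed

text \<open>The jump formula for a primitive of \<open>\<psi>\<close> on \<open>[a, b)\<close>: a
  jump \<open>z\<close> at \<open>a\<close> and minus the final value at \<open>b\<close>. The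
  starting value \<open>z\<close> is arbitrary because a later piece starts with what the earlier
  pieces have accumulated.\<close>

definition step_exact :: "cdistr \<Rightarrow> (real \<Rightarrow> complex) \<Rightarrow> real \<Rightarrow> real \<Rightarrow> (real \<Rightarrow> complex) \<Rightarrow> bool" where
  "step_exact g c a b \<psi> \<longleftrightarrow> \<psi> \<in> G_infty I \<and>
     (\<forall>z. g (seg a b (\<lambda>r. z + lint a r \<psi>)) = c a * z - c b * (z + lint a b \<psi>))"

lemma step_exact_cpoly:
  assumes g: "g \<in> RR_dual I"
    and c: "\<And>\<phi>. \<phi> \<in> RR_F I \<Longrightarrow> g \<phi> = (\<Sum>t | t \<in> I \<and> jump t \<phi> \<noteq> 0. c t * jump t \<phi>)"
    and a: "a \<in> I" and b: "b \<in> I" and ab: "a \<le> b"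
  shows "step_exact g c a b (seg a b (cpoly P))"
  unfolding step_exact_def
proof (intro conjI allI)
  show "seg a b (cpoly P) \<in> G_infty I" by (rule seg_cpoly_G_infty)
  fix z
  obtain Q where Q: "pderiv Q = P" using ex_antiderivative_poly by blast
  have l: "lint a r (seg a b (cpoly P)) = cpoly Q r - cpoly Q a" if "a \<le> r" "r \<le> b" for r
    using lint_cpoly[OF that(1), of Q] that Q by (simp add: lint_def seg_sub')
  show "g (seg a b (\<lambda>r. z + lint a r (seg a b (cpoly P)))) = c a * z - c b * (z + lint a b (seg a b (cpoly P)))"
  proof (cases "a = b")
    case True
    then have "seg a b h = (\<lambda>_. 0)" for h by (auto simp: seg_def fun_eq_iff)
    then show ?thesis using True RR_dual_zero[OF g] by (simp add: lint_def)
  next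
    case False
    have "seg a b (\<lambda>r. z + lint a r (seg a b (cpoly P))) = seg a b (cpoly (Q + [:z - cpoly Q a:]))"
      using l by (auto simp: seg_def[of a b "\<lambda>r. z + lint a r _ "] seg_def[of a b "cpoly (Q + _)"] fun_eq_iff cpoly_def)
    then show ?thesis
      using Delta_seg_cpoly[OF c a b, of "Q + [:z - cpoly Q a:]"] False ab
        lint_cpoly[OF ab, of Q] Q by simp (simp add: cpoly_def algebra_simps)
  qed
qed

text \<open>Starting the second piece at \<open>z + lint a b \<psi>1\<close> makes the primitive
  continuous at \<open>b\<close>, so the two terms with weight \<open>c b\<close> cancel and only
  the outer endpoints remain.\<close>

lemma step_exact_join:
  assumes g: "g \<in> RR_dual I" and I: "a \<in> I" "b \<in> I" "d \<in> I" and ab: "a \<le> b" "b \<le> d"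
    and 1: "step_exact g c a b \<psi>1" and 2: "step_exact g c b d \<psi>2"
  shows "step_exact g c a d (\<lambda>r. seg a b \<psi>1 r + seg b d \<psi>2 r)"
proof -
  let ?\<psi> = "\<lambda>r. seg a b \<psi>1 r + seg b d \<psi>2 r"
  have G: "\<psi>1 \<in> G_infty I" "\<psi>2 \<in> G_infty I" using 1 2 by (auto simp: step_exact_def)
  have G3: "?\<psi> \<in> G_infty I" using G_infty_lin[OF seg_G_infty[OF G(1)] seg_G_infty[OF G(2)], of 1 a b 1 b d] by simp
  have l1: "lint a r ?\<psi> = lint a r \<psi>1" if "r \<le> b" for r
  proof -
    have "seg a r ?\<psi> = seg a r \<psi>1" using that by (auto simp: seg_def fun_eq_iff)
    then show ?thesis by (simp add: lint_def)
  qed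
  have l2: "lint a r ?\<psi> = lint a b \<psi>1 + lint b r \<psi>2" if "b \<le> r" "r \<le> d" for r
  proof -
    have "seg a r ?\<psi> = (\<lambda>x. seg a b \<psi>1 x + seg b r \<psi>2 x)" using that ab by (auto simp: seg_def fun_eq_iff)
    moreover have "r \<in> I" using mem_I[OF I(2,3)] that by blast
    ultimately show ?thesis unfolding lint_def
      using seg_integrable[OF G_infty_GG[OF G(1)] I(1,2)] seg_integrable[OF G_infty_GG[OF G(2)] I(2) \<open>r \<in> I\<close>] by simp
  qed
  have "g (seg a d (\<lambda>r. z + lint a r ?\<psi>)) = c a * z - c d * (z + lint a d ?\<psi>)" for z
  proof -
    have "seg a d (\<lambda>r. z + lint a r ?\<psi>) = (\<lambda>r. seg a b (\<lambda>r. z + lint a r \<psi>1) r + seg b d (\<lambda>r. (z + lint a b \<psi>1) + lint b r \<psi>2) r)"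
    proof
      fix r
      show "seg a d (\<lambda>r. z + lint a r ?\<psi>) r = seg a b (\<lambda>r. z + lint a r \<psi>1) r + seg b d (\<lambda>r. (z + lint a b \<psi>1) + lint b r \<psi>2) r"
        using ab l1[of r] l2[of r] by (cases "r < b") (simp_all add: seg_def[of a d] seg_def[of a b "\<lambda>r. z + _ r"] seg_def[of b d "\<lambda>r. z + _ + _ r"])
    qed
    then have "g (seg a d (\<lambda>r. z + lint a r ?\<psi>)) = g (seg a b (\<lambda>r. z + lint a r \<psi>1)) + g (seg b d (\<lambda>r. (z + lint a b \<psi>1) + lint b r \<psi>2))"
      by (simp only: RR_dual_add[OF g seg_affine_RR[OF G(1) I(1,2)] seg_affine_RR[OF G(2) I(2,3)]])
    also have "\<dots> = c a * z - c d * (z + lint a d ?\<psi>)"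
      using 1 2 l2[of d] ab by (simp add: step_exact_def)
    finally show ?thesis .
  qed
  then show ?thesis using G3 by (simp add: step_exact_def)
qed

text \<open>Bolzano bisection. The property passes to unions of adjacent intervals by
  \<open>step_exact_join\<close> and \<open>bnd_join\<close>, and a short interval around
  \<open>x\<close> splits at \<open>x\<close> into two parts, each with its own one-sided
  polynomial.\<close>

lemma ex_step_exact_approx:
  assumes g: "g \<in> RR_dual I"
    and c: "\<And>\<phi>. \<phi> \<in> RR_F I \<Longrightarrow> g \<phi> = (\<Sum>t | t \<in> I \<and> jump t \<phi> \<noteq> 0. c t * jump t \<phi>)"
    and s: "s \<in> I" and T: "T \<in> I" and sT: "s \<le> T" and \<psi>: "\<psi> \<in> G_infty I" and e: "e > 0"
  shows "\<exists>\<psi>1. step_exact g c s T \<psi>1 \<and> bnd k (seg s T (\<lambda>r. \<psi> r - \<psi>1 r)) e"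
proof -
  define P where "P a b \<longleftrightarrow> a \<in> I \<and> b \<in> I \<and> (\<exists>\<psi>1. step_exact g c a b \<psi>1 \<and> bnd k (seg a b (\<lambda>r. \<psi> r - \<psi>1 r)) e)" for a b
  have P_trans: "P a d" if Ps: "P a b" "P b d" and le: "a \<le> b" "b \<le> d" for a b d
  proof -
    obtain \<psi>1 where 1: "step_exact g c a b \<psi>1" "bnd k (seg a b (\<lambda>r. \<psi> r - \<psi>1 r)) e" "a \<in> I" "b \<in> I"
      using Ps(1) unfolding P_def by blast
    obtain \<psi>2 where 2: "step_exact g c b d \<psi>2" "bnd k (seg b d (\<lambda>r. \<psi> r - \<psi>2 r)) e" "d \<in> I"
      using Ps(2) unfolding P_def by blast
    have "bnd k (\<lambda>r. seg a b (\<lambda>r. \<psi> r - \<psi>1 r) r + seg b d (\<lambda>r. \<psi> r - \<psi>2 r) r) e"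
      using bnd_join[OF 1(2) 2(2)] e by simp
    moreover have "(\<lambda>r. seg a b (\<lambda>r. \<psi> r - \<psi>1 r) r + seg b d (\<lambda>r. \<psi> r - \<psi>2 r) r) =
        seg a d (\<lambda>r. \<psi> r - (seg a b \<psi>1 r + seg b d \<psi>2 r))"
      using le by (auto simp: seg_def fun_eq_iff)
    ultimately show ?thesis unfolding P_def
      using step_exact_join[OF g 1(3,4) 2(3) le 1(1) 2(1)] 1(3) 2(3) by auto
  qed
  have side: "\<exists>d>0. \<forall>a y. a \<in> I \<and> y \<in> I \<and> a \<le> y \<and> {a<..<y} \<subseteq> side b x d \<longrightarrow> P a y" if x: "x \<in> I" for x b
  proof -
    obtain Q d where Q: "d > 0" "\<forall>a c. {a<..<c} \<subseteq> side b x d \<longrightarrow> bnd k (seg a c (\<lambda>r. \<psi> r - cpoly Q r)) e"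
      using approx_one_sided[OF \<psi> x e, of b k] by blast
    have "P a y" if "a \<in> I" "y \<in> I" "a \<le> y" "{a<..<y} \<subseteq> side b x d" for a y
    proof -
      have "seg a y (\<lambda>r. \<psi> r - seg a y (cpoly Q) r) = seg a y (\<lambda>r. \<psi> r - cpoly Q r)" by (auto simp: seg_def)
      then have "bnd k (seg a y (\<lambda>r. \<psi> r - seg a y (cpoly Q) r)) e" using Q(2) that(4) by simp
      then show ?thesis unfolding P_def using step_exact_cpoly[OF g c that(1-3)] that by blast
    qed
    then show ?thesis using Q(1) by blast
  qed
  have "P s T" using sT
  proof (induction rule: Bolzano)
    case (trans a b c)
    then show ?case by (rule P_trans)
  next
    case (local x)
    then have x: "x \<in> I" using mem_I[OF s T] by blast
    obtain d1 where d1: "d1 > 0" "\<And>a y. a \<in> I \<Longrightarrow> y \<in> I \<Longrightarrow> a \<le> y \<Longrightarrow> {a<..<y} \<subseteq> side True x d1 \<Longrightarrow> P a y"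
      using side[OF x, of True] by blast
    obtain d2 where d2: "d2 > 0" "\<And>a y. a \<in> I \<Longrightarrow> y \<in> I \<Longrightarrow> a \<le> y \<Longrightarrow> {a<..<y} \<subseteq> side False x d2 \<Longrightarrow> P a y"
      using side[OF x, of False] by blast
    obtain d3 where d3: "d3 > 0" "ball x d3 \<subseteq> I" using open_I x open_contains_ball by blast
    have "P a b" if "a \<le> x" "x \<le> b" "b - a < min d3 (min d1 d2)" for a b
    proof -
      have "a \<in> I" "b \<in> I" using that d3(2) by (auto simp: subset_iff dist_real_def)
      then have "P a x" using x that by (intro d2(2)) (auto simp: side_def)
      moreover have "P x b" using \<open>b \<in> I\<close> x that by (intro d1(2)) (auto simp: side_def)
      ultimately show ?thesis using P_trans[of a x b] that by simp
    qed
    then show ?case using d1(1) d2(1) d3(1) by (intro exI[of _ "min d3 (min d1 d2)"]) auto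
  qed
  then show ?thesis by (simp add: P_def)
qed

text \<open>For an approximant the formula is \<open>step_exact\<close> with \<open>z = 0\<close>,
  which removes the weight at \<open>s\<close>. Both sides depend continuously on
  \<open>\<psi>\<close> in the norm of order \<open>k\<close>, so the error can be made arbitrarily
  small.\<close>

lemma Delta_vint:
  assumes g: "g \<in> RR_dual I"
    and c: "\<And>\<phi>. \<phi> \<in> RR_F I \<Longrightarrow> g \<phi> = (\<Sum>t | t \<in> I \<and> jump t \<phi> \<noteq> 0. c t * jump t \<phi>)"
    and s: "s \<in> I" and T: "T \<in> I" and sT: "s \<le> T" and \<psi>: "\<psi> \<in> G_infty I"
  shows "g (vint s T \<psi>) = - c T * lint s T \<psi>"
proof -
  obtain k C where C: "0 \<le> C" "\<And>\<psi> B. bnd k \<psi> B \<Longrightarrow> 0 \<le> B \<Longrightarrow> norm (g (seg s T \<psi>)) \<le> C * B"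
    by (rule RR_dual_bound[OF g s T]) (rule that, assumption, blast)
  \<comment> \<open>The first summand bounds the effect of the approximation error on
    \<open>g\<close>, the second its effect on the integral weighted by \<open>c T\<close>.\<close>
  define M where "M = C * max 1 (T - s) + norm (c T) * (T - s)"
  have M: "0 \<le> M" unfolding M_def using C(1) sT by simp
  have est: "norm (g (vint s T \<psi>) + c T * lint s T \<psi>) \<le> M * e" if e: "e > 0" for e
  proof -
    obtain \<psi>1 where 1: "step_exact g c s T \<psi>1" "bnd k (seg s T (\<lambda>r. \<psi> r - \<psi>1 r)) e"
      using ex_step_exact_approx[OF g c s T sT \<psi> e] by blast
    let ?d = "seg s T (\<lambda>r. \<psi> r - \<psi>1 r)"
    have G1: "\<psi>1 \<in> G_infty I" using 1 by (simp add: step_exact_def)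
    have "g (vint s T \<psi>1) = - c T * lint s T \<psi>1"
      using conjunct2[OF 1(1)[unfolded step_exact_def], rule_format, of 0] by (simp add: vint_def)
    moreover have "vint s T ?d = (\<lambda>r. vint s T \<psi> r - vint s T \<psi>1 r)"
      using vint_lin[OF G_infty_GG[OF \<psi>] G_infty_GG[OF G1] s T, of 1 "-1"] by simp
    moreover have "lint s T ?d = lint s T \<psi> - lint s T \<psi>1"
      using lint_lin[OF seg_integrable[OF G_infty_GG[OF \<psi>] s T] seg_integrable[OF G_infty_GG[OF G1] s T], of 1 "-1"] by simp
    ultimately have eq: "g (vint s T \<psi>) + c T * lint s T \<psi> = g (vint s T ?d) + c T * lint s T ?d"
      by (simp only: RR_dual_diff[OF g vint_RR[OF \<psi> s T] vint_RR[OF G1 s T]]) (simp add: algebra_simps)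
    have "bnd k (vint s T ?d) (max 1 (T - s) * e)"
      using bnd_SucD[OF bnd_vint[OF 1(2) s T sT]] e by simp
    from C(2)[OF this] have "norm (g (vint s T ?d)) \<le> C * (max 1 (T - s) * e)" using e by simp
    moreover have "norm (lint s T ?d) \<le> e * (T - s)"
    proof (rule lint_norm_le[OF _ sT])
      show "AE x in lebesgue. x \<in> {s<..<T} \<longrightarrow> norm (?d x) \<le> e"
        using bnd_AE[OF 1(2)] unfolding AE_I by eventually_elim (use mem_I[OF s T] in auto)
    qed
    then have "norm (c T * lint s T ?d) \<le> norm (c T) * (e * (T - s))"
      by (simp only: norm_mult) (rule mult_left_mono, auto)
    ultimately have "norm (g (vint s T ?d) + c T * lint s T ?d) \<le> C * (max 1 (T - s) * e) + norm (c T) * (e * (T - s))"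
      by (intro order_trans[OF norm_triangle_ineq] add_mono)
    then show ?thesis unfolding eq M_def by (simp add: algebra_simps)
  qed
  have "norm (g (vint s T \<psi>) + c T * lint s T \<psi>) \<le> 0 + e" if "e > 0" for e
  proof -
    \<comment> \<open>Dividing by \<open>M + 1\<close> instead of \<open>M\<close> covers
      \<open>M = 0\<close>.\<close>
    have "norm (g (vint s T \<psi>) + c T * lint s T \<psi>) \<le> M * (e / (M + 1))" using that M by (intro est) auto
    also have "\<dots> \<le> e" using that M by (simp add: field_simps)
    finally show ?thesis by simp
  qed
  then have "norm (g (vint s T \<psi>) + c T * lint s T \<psi>) \<le> 0" by (rule field_le_epsilon)
  then show ?thesis by (simp add: eq_neg_iff_add_eq_0)
qed

end

section \<open>Solutions are regular\<close>

lemma has_vector_derivative_vecI: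
  fixes f :: "real \<Rightarrow> complex^'n"
  assumes "\<And>i. ((\<lambda>s. f s $ i) has_vector_derivative D $ i) (at t)"
  shows "(f has_vector_derivative D) (at t)"
  using assms unfolding has_vector_derivative_def has_derivative_within
  by (auto intro!: vec_tendstoI bounded_linear_scaleR_left)

text \<open>Difference quotients are bounded by \<open>\<bar>K\<bar> * \<bar>y - x\<bar>\<close>, so
  the derivative is zero everywhere. The absolute value is taken because the sign of
  \<open>K\<close> is left open.\<close>

lemma eq_if_quadratic_increments:
  fixes h :: "real \<Rightarrow> complex"
  assumes "\<And>p q. s \<le> p \<Longrightarrow> p \<le> q \<Longrightarrow> q \<le> T \<Longrightarrow> norm (h q - h p) \<le> K * (q - p)^2" and "s \<le> T"
  shows "h T = h s"
proof -
  have K: "norm (h y - h x) \<le> \<bar>K\<bar> * (y - x)^2" if "x \<in> {s..T}" "y \<in> {s..T}" for x y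
  proof -
    have "norm (h y - h x) \<le> K * (y - x)^2"
      using assms(1)[of x y] assms(1)[of y x] that by (cases "x \<le> y") (auto simp: norm_minus_commute power2_commute)
    also have "\<dots> \<le> \<bar>K\<bar> * (y - x)^2" by (intro mult_right_mono) auto
    finally show ?thesis .
  qed
  have "(h has_derivative (\<lambda>_. 0)) (at x within {s..T})" if x: "x \<in> {s..T}" for x
    unfolding has_derivative_iff_norm
  proof (intro conjI bounded_linear_zero)
    have "eventually (\<lambda>y. norm (norm (h y - h x - 0) / norm (y - x)) \<le> \<bar>K\<bar> * \<bar>y - x\<bar>) (at x within {s..T})"
      unfolding eventually_at_filter
    proof (rule always_eventually, safe)
      fix y assume y: "y \<noteq> x" "y \<in> {s..T}"
      have "norm (h y - h x) \<le> \<bar>K\<bar> * \<bar>y - x\<bar> * \<bar>y - x\<bar>"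
        using K[OF x y(2)] by (simp add: power2_eq_square mult.assoc)
      then show "norm (norm (h y - h x - 0) / norm (y - x)) \<le> \<bar>K\<bar> * \<bar>y - x\<bar>"
        using y(1) by (simp add: divide_le_eq)
    qed
    moreover have "((\<lambda>y. \<bar>K\<bar> * \<bar>y - x\<bar>) \<longlongrightarrow> \<bar>K\<bar> * \<bar>x - x\<bar>) (at x within {s..T})" by (intro tendsto_intros)
    then have "((\<lambda>y. \<bar>K\<bar> * \<bar>y - x\<bar>) \<longlongrightarrow> 0) (at x within {s..T})" by simp
    ultimately show "((\<lambda>y. norm (h y - h x - 0) / norm (y - x)) \<longlongrightarrow> 0) (at x within {s..T})"
      by (rule Lim_null_comparison)
  qed
  then obtain z where "\<forall>x\<in>{s..T}. h x = z"
    using has_derivative_zero_constant[of "{s..T}" h] by auto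
  then show ?thesis using assms(2) by auto
qed

context line_interval begin

lemma bnd_le: "bnd l g B \<Longrightarrow> k \<le> l \<Longrightarrow> bnd k g B"
  by (induction l) (auto simp: le_Suc_eq dest: bnd_SucD simp del: bnd.simps)

lemma RR_cong: assumes "\<phi> \<in> RR I" "ae_eq I \<phi> \<phi>'" "\<phi>' \<in> GG I" shows "\<phi>' \<in> RR I"
proof -
  obtain K where K: "compact K" "K \<subseteq> I" "AE t in lebesgue_on I. t \<notin> K \<longrightarrow> \<phi> t = 0" using assms by (auto simp: RR_def)
  have "AE t in lebesgue_on I. t \<notin> K \<longrightarrow> \<phi>' t = 0"
    using K(3) assms(2) unfolding ae_eq_def by eventually_elim auto
  then show ?thesis using K G_infty_cong[OF _ assms(2,3)] assms(1) unfolding RR_def by blast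
qed

lemma seg_continuous_GG:
  assumes cont: "continuous_on I f" and s: "s \<in> I" and T: "T \<in> I" shows "seg s T f \<in> GG I"
proof -
  have "compact (f ` {s..T})"
    by (intro compact_continuous_image continuous_on_subset[OF cont] cIcc_I s T) simp
  then obtain B where B: "\<forall>r\<in>{s..T}. norm (f r) \<le> B" using compact_imp_bounded by (metis bounded_iff image_eqI)
  show ?thesis
  proof (rule GG_I)
    show "seg s T f \<in> borel_measurable (lebesgue_on I)"
      by (intro seg_measurable continuous_imp_measurable_on_sets_lebesgue cont) simp
    show "AE r in lebesgue_on I. norm (seg s T f r) \<le> max 0 B" using B by (auto simp: seg_def le_max_iff_disj)
    fix p b assume "p \<in> I"
    then have "isCont f p" using cont open_I continuous_on_eq_continuous_at by blast
    then have "(f \<longlongrightarrow> f p) (ess_side b p)" by (intro ess_side_tendsto_at) (simp add: isCont_def)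
    then have "((\<lambda>r. if in_seg b s T p then f r else 0) \<longlongrightarrow> (if in_seg b s T p then f p else 0)) (ess_side b p)"
      by simp
    then show "\<exists>l. (seg s T f \<longlongrightarrow> l) (ess_side b p)"
      using tendsto_cong[OF ev_seg[of s T f b p]] by blast
  qed
qed

end

section \<open>The system in components: identities, order and regularity\<close>

locale distr_ode = line_interval I for I +
  fixes a :: "'n::finite \<Rightarrow> 'n \<Rightarrow> real \<Rightarrow> complex" and x g :: "'n \<Rightarrow> cdistr" and c :: "'n \<Rightarrow> real \<Rightarrow> complex"
  assumes nonempty: "I \<noteq> {}"
    and a: "\<And>i j. a i j \<in> G_infty I" and x: "\<And>i. x i \<in> RR_dual I" and g: "\<And>i. g i \<in> RR_dual I"
    and c: "\<And>i \<phi>. \<phi> \<in> RR_F I \<Longrightarrow> g i \<phi> = (\<Sum>t | t \<in> I \<and> jump t \<phi> \<noteq> 0. c i t * jump t \<phi>)"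
    and eq: "\<And>i \<phi>. \<phi> \<in> RR I \<Longrightarrow> - x i (gder I \<phi>) + g i \<phi> = (\<Sum>j\<in>UNIV. x j (\<lambda>t. a i j t * \<phi> t))"
begin

text \<open>The value at \<open>t\<close> of the classical solution is minus the weight that the \<open>Delta\<close> term puts on a
  jump at \<open>t\<close>.\<close>

definition u :: "'n \<Rightarrow> real \<Rightarrow> complex" where "u i t = - c i t"

text \<open>Replaces the chosen \<open>gder I \<phi>\<close> by any derivative at hand. For this
  \<open>\<phi>'\<close> has to be a test function: the complement of \<open>K\<close> is open and
  \<open>\<phi>\<close> vanishes almost everywhere in it, so the one-sided derivatives there are
  zero.\<close>

lemma eq_deriv:
  assumes "\<phi> \<in> RR I" "G_deriv I \<phi> \<phi>'"
  shows "x i \<phi>' = g i \<phi> - (\<Sum>j\<in>UNIV. x j (\<lambda>t. a i j t * \<phi> t))" 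
proof -
  have G: "\<phi> \<in> G_infty I" using assms(1) by (rule RR_G_infty)
  have ae: "ae_eq I (gder I \<phi>) \<phi>'" by (rule G_deriv_unique[OF G_deriv_gder[OF G] assms(2)])
  obtain K where K: "compact K" "K \<subseteq> I" "AE t in lebesgue_on I. t \<notin> K \<longrightarrow> \<phi> t = 0" using assms by (auto simp: RR_def)
  have "AE t in lebesgue_on I. t \<notin> K \<longrightarrow> \<phi>' t = 0"
  proof -
    have "AE t in lebesgue_on I. \<phi>' t = slim True \<phi>' t" using assms(2) by (intro AE_slim) (simp add: G_deriv_iff)
    moreover have "AE t in lebesgue_on I. t \<in> I" using AE_space[of "lebesgue_on I"] by (simp add: space_restrict_space)
    ultimately show ?thesis
    proof eventually_elim
      case (elim t)
      have "\<phi>' t = 0" if "t \<notin> K"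
      proof -
        have "eventually (\<lambda>s. s \<in> - K) (ess_side True t)"
          using that K(1) by (intro ess_side_eventually_at eventually_at_in_open') (auto intro: compact_imp_closed)
        moreover have "eventually (\<lambda>s. s \<notin> K \<longrightarrow> \<phi> s = 0) (ess_side True t)" by (rule ev_of_AE[OF K(3) elim(2)])
        ultimately have ev: "eventually (\<lambda>s. \<phi> s = 0) (ess_side True t)" by eventually_elim auto
        then have s0: "slim True \<phi> t = 0" using slim_cong_ev[OF ev] by (simp add: slim_zero)
        have "\<forall>\<^sub>F s in ess_side True t. (\<phi> s - slim True \<phi> t) / of_real (s - t) = 0"
          using ev by eventually_elim (simp add: s0)
        then have "((\<lambda>s. (\<phi> s - slim True \<phi> t) / of_real (s - t)) \<longlongrightarrow> 0) (ess_side True t)"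
          by (rule tendsto_eventually)
        then have "slim True \<phi>' t = 0" using G_deriv_tendsto[OF assms(2) elim(2), of True] tendsto_unique ess_side_not_bot by blast
        then show ?thesis using elim(1) by simp
      qed
      then show ?case by blast
    qed
  qed
  moreover have "\<phi>' \<in> G_infty I" by (rule G_infty_deriv_closed[OF assms(2) G])
  ultimately have R: "\<phi>' \<in> RR I" using K unfolding RR_def by blast
  then have "gder I \<phi> \<in> RR I" by (rule RR_cong[OF _ ae_eq_sym[OF ae] G_infty_GG[OF gder_G_infty[OF G]]])
  then have "x i (gder I \<phi>) = x i \<phi>'" using RR_dual_cong[OF x _ R ae] by blast
  then show ?thesis using eq[OF assms(1), of i] by (simp add: algebra_simps)
qed

lemma x_seg_eq:
  assumes s: "s \<in> I" and T: "T \<in> I" and sT: "s \<le> T" and \<psi>: "\<psi> \<in> G_infty I"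
  shows "x i (seg s T \<psi>) = u i T * lint s T \<psi> - (\<Sum>j\<in>UNIV. x j (seg s T (\<lambda>t. a i j t * vint s T \<psi> t)))"
proof -
  have "x i (seg s T \<psi>) = g i (vint s T \<psi>) - (\<Sum>j\<in>UNIV. x j (\<lambda>t. a i j t * vint s T \<psi> t))"
    by (rule eq_deriv[OF vint_RR[OF \<psi> s T] G_deriv_vint[OF G_infty_GG[OF \<psi>] s T]])
  moreover have "g i (vint s T \<psi>) = u i T * lint s T \<psi>"
    using Delta_vint[OF g c s T sT \<psi>] by (simp add: u_def)
  moreover have "(\<Sum>j\<in>UNIV. x j (\<lambda>t. a i j t * vint s T \<psi> t)) = (\<Sum>j\<in>UNIV. x j (seg s T (\<lambda>t. a i j t * vint s T \<psi> t)))"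
  proof -
    have "(\<lambda>t. a i j t * vint s T \<psi> t) = seg s T (\<lambda>t. a i j t * vint s T \<psi> t)" for j
      using mult_seg[of "a i j" s T "vint s T \<psi>"] by simp
    from arg_cong[OF this, of "x _"] show ?thesis by (rule sum.cong[OF refl])
  qed
  ultimately show ?thesis by (simp only:)
qed

text \<open>The indicator of \<open>[p, q)\<close> has derivative zero in this calculus, since jumps
  are ignored, so the term with \<open>x i\<close> drops out. The right-hand side is kept in terms
  of \<open>x j\<close> because the Lipschitz bound for \<open>u\<close> is drawn from it before
  regularity is known.\<close>

lemma u_diff:
  assumes p: "p \<in> I" and q: "q \<in> I" and pq: "p \<le> q"
  shows "u i q - u i p = (\<Sum>j\<in>UNIV. x j (seg p q (a i j)))"
proof (cases "p = q")
  case True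
  then have "seg p q h = (\<lambda>_. 0)" for h by (auto simp: seg_def fun_eq_iff)
  then show ?thesis using True RR_dual_zero[OF x] by simp
next
  case False
  have one: "cpoly 1 = (\<lambda>_. 1)" by (auto simp: cpoly_def)
  have "seg p q (cpoly (pderiv 1)) = (\<lambda>_. 0)" by (auto simp: seg_def cpoly_def)
  then have "G_deriv I (seg p q (cpoly 1)) (\<lambda>_. 0)" using G_deriv_seg_cpoly[of p q 1] by simp
  moreover have "seg p q (cpoly 1) \<in> RR I" using seg_RR[OF seg_cpoly_G_infty p q, of p q 1] by simp
  ultimately have "x i (\<lambda>_. 0) = g i (seg p q (cpoly 1)) - (\<Sum>j\<in>UNIV. x j (\<lambda>t. a i j t * seg p q (cpoly 1) t))"
    by (intro eq_deriv)
  moreover have "g i (seg p q (cpoly 1)) = c i p - c i q"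
    using Delta_seg_cpoly[OF c p q, of i 1] False pq by (simp add: one)
  moreover have "(\<lambda>t. a i j t * seg p q (cpoly 1) t) = seg p q (a i j)" for j by (auto simp: one seg_def)
  ultimately show ?thesis using RR_dual_zero[OF x] by (simp add: u_def)
qed

lemma ex_coeff_bound: "\<exists>M\<ge>0. \<forall>i j. bnd k (a i j) M"
proof -
  have "\<exists>M. 0 \<le> M \<and> bnd k (a i j) M" for i j by (rule bnd_exists[OF a, of k i j]) blast
  then obtain M where M: "\<And>i j. 0 \<le> M i j \<and> bnd k (a i j) (M i j)" by metis
  have "M i j \<le> (\<Sum>p\<in>UNIV. M (fst p) (snd p))" for i j
    using member_le_sum[of "(i, j)" UNIV "\<lambda>p. M (fst p) (snd p)"] M by auto
  then show ?thesis using M bnd_mono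
    by (intro exI[of _ "\<Sum>p\<in>UNIV. M (fst p) (snd p)"] conjI allI sum_nonneg) blast+
qed

text \<open>A single order and constant for all components, since the identity for one component
  involves all the others.\<close>

definition order_le :: "real \<Rightarrow> real \<Rightarrow> nat \<Rightarrow> bool" where
  "order_le s T k \<longleftrightarrow> (\<exists>C\<ge>0. \<forall>j \<psi> B. bnd k \<psi> B \<longrightarrow> 0 \<le> B \<longrightarrow> norm (x j (seg s T \<psi>)) \<le> C * B)"

lemma ex_order_le: assumes s: "s \<in> I" and T: "T \<in> I" shows "\<exists>k. order_le s T k"
proof -
  have "\<forall>j. \<exists>k C. 0 \<le> C \<and> (\<forall>\<psi> B. bnd k \<psi> B \<longrightarrow> 0 \<le> B \<longrightarrow> norm (x j (seg s T \<psi>)) \<le> C * B)"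
  proof
    fix j
    show "\<exists>k C. 0 \<le> C \<and> (\<forall>\<psi> B. bnd k \<psi> B \<longrightarrow> 0 \<le> B \<longrightarrow> norm (x j (seg s T \<psi>)) \<le> C * B)"
      by (rule RR_dual_bound[OF x[of j] s T]) blast
  qed
  then obtain k C where kC: "\<And>j. 0 \<le> C j" "\<And>j \<psi> B. bnd (k j) \<psi> B \<Longrightarrow> 0 \<le> B \<Longrightarrow> norm (x j (seg s T \<psi>)) \<le> C j * B"
    by metis
  have "norm (x j (seg s T \<psi>)) \<le> (\<Sum>j\<in>UNIV. C j) * B" if b: "bnd (Max (range k)) \<psi> B" and B: "0 \<le> B" for j \<psi> B
  proof -
    have "bnd (k j) \<psi> B" by (rule bnd_le[OF b]) simp
    then have "norm (x j (seg s T \<psi>)) \<le> C j * B" using kC(2) B by blast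
    also have "\<dots> \<le> (\<Sum>j\<in>UNIV. C j) * B" by (intro mult_right_mono member_le_sum B kC(1)) auto
    finally show ?thesis .
  qed
  moreover have "0 \<le> (\<Sum>j\<in>UNIV. C j)" by (intro sum_nonneg kC(1))
  ultimately show ?thesis unfolding order_le_def by blast
qed

text \<open>The primitive in \<open>x_seg_eq\<close> gains one derivative, so the order of the distribution drops to zero.\<close>

lemma order_le_pred:
  assumes s: "s \<in> I" and T: "T \<in> I" and sT: "s \<le> T" and o: "order_le s T (Suc k)"
  shows "order_le s T k"
proof -
  obtain C where C: "C \<ge> 0" "\<And>j \<psi> B. bnd (Suc k) \<psi> B \<Longrightarrow> 0 \<le> B \<Longrightarrow> norm (x j (seg s T \<psi>)) \<le> C * B"
    using o unfolding order_le_def by blast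
  obtain M where M: "M \<ge> 0" "\<And>i j. bnd (Suc k) (a i j) M" using ex_coeff_bound by blast
  define U where "U = (\<Sum>i\<in>UNIV. norm (u i T))"
  \<comment> \<open>The constant of the order bound times those of \<open>bnd_mult\<close> and
    \<open>bnd_vint\<close>.\<close>
  define N where "N = C * (2 ^ Suc k * M * max 1 (T - s))"
  have N: "0 \<le> N" unfolding N_def using C M by (auto intro!: mult_nonneg_nonneg)
  have "norm (x i (seg s T \<psi>)) \<le> (U * (T - s) + real CARD('n) * N) * B" if b: "bnd k \<psi> B" and B: "0 \<le> B" for i \<psi> B
  proof -
    have "norm (x j (seg s T (\<lambda>t. a i j t * vint s T \<psi> t))) \<le> N * B" for j
    proof -
      have "bnd (Suc k) (\<lambda>t. a i j t * vint s T \<psi> t) (2 ^ Suc k * M * (max 1 (T - s) * B))"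
        by (rule bnd_mult[OF M(2) bnd_vint[OF b s T sT B] M(1)]) (use B in simp)
      then have "norm (x j (seg s T (\<lambda>t. a i j t * vint s T \<psi> t))) \<le> C * (2 ^ Suc k * M * (max 1 (T - s) * B))"
        by (rule C(2)) (use B M in simp)
      then show ?thesis by (simp add: N_def mult_ac)
    qed
    then have "norm (\<Sum>j\<in>UNIV. x j (seg s T (\<lambda>t. a i j t * vint s T \<psi> t))) \<le> real CARD('n) * (N * B)"
      by (intro sum_norm_bound)
    moreover have "norm (u i T * lint s T \<psi>) \<le> U * (B * (T - s))"
      unfolding norm_mult
    proof (rule mult_mono)
      show "norm (u i T) \<le> U" unfolding U_def by (rule member_le_sum) auto
      show "0 \<le> U" unfolding U_def by (intro sum_nonneg) auto
      show "norm (lint s T \<psi>) \<le> B * (T - s)"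
      proof (rule lint_norm_le[OF _ sT])
        show "AE x in lebesgue. x \<in> {s<..<T} \<longrightarrow> norm (\<psi> x) \<le> B"
          using bnd_AE[OF b] unfolding AE_I by eventually_elim (use mem_I[OF s T] in auto)
      qed
    qed simp
    ultimately have "norm (x i (seg s T \<psi>)) \<le> U * (B * (T - s)) + real CARD('n) * (N * B)"
      unfolding x_seg_eq[OF s T sT bnd_G_infty[OF b]] by (intro order_trans[OF norm_triangle_ineq4] add_mono)
    then show ?thesis by (simp add: algebra_simps)
  qed
  moreover have "0 \<le> U * (T - s) + real CARD('n) * N"
    using sT N unfolding U_def by (auto intro!: add_nonneg_nonneg mult_nonneg_nonneg sum_nonneg)
  ultimately show ?thesis unfolding order_le_def by blast
qed

lemma order_le_0: assumes s: "s \<in> I" and T: "T \<in> I" and sT: "s \<le> T" shows "order_le s T 0"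
proof -
  obtain k where "order_le s T k" using ex_order_le[OF s T] by blast
  then show ?thesis by (induction k) (auto intro: order_le_pred[OF s T sT])
qed

text \<open>The identity is applied on the fixed segment \<open>[s, T)\<close> to a function
  supported in \<open>[p, q)\<close>, so its primitive is of size \<open>(q - p) * B\<close>
  everywhere while the order-zero constant does not depend on \<open>p\<close> and \<open>q\<close>.
  This excludes point masses.\<close>

lemma x_seg_bound:
  assumes s: "s \<in> I" and T: "T \<in> I" and sT: "s \<le> T"
  shows "\<exists>K\<ge>0. \<forall>i p q \<psi> B. s \<le> p \<longrightarrow> p \<le> q \<longrightarrow> q \<le> T \<longrightarrow> bnd 0 \<psi> B \<longrightarrow> 0 \<le> B \<longrightarrow>
           norm (x i (seg p q \<psi>)) \<le> K * (q - p) * B"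
proof -
  obtain C where C: "C \<ge> 0" "\<And>j \<psi> B. bnd 0 \<psi> B \<Longrightarrow> 0 \<le> B \<Longrightarrow> norm (x j (seg s T \<psi>)) \<le> C * B"
    using order_le_0[OF assms] unfolding order_le_def by blast
  obtain M where M: "M \<ge> 0" "\<And>i j. bnd 0 (a i j) M" using ex_coeff_bound by blast
  define U where "U = (\<Sum>i\<in>UNIV. norm (u i T))"
  have "norm (x i (seg p q \<psi>)) \<le> (U + real CARD('n) * (C * M)) * (q - p) * B"
    if pq: "s \<le> p" "p \<le> q" "q \<le> T" and b: "bnd 0 \<psi> B" and B: "0 \<le> B" for i p q \<psi> B
  proof -
    have G: "seg p q \<psi> \<in> G_infty I" using bnd_G_infty[OF b] by (rule seg_G_infty)
    have "AE x in lebesgue. x \<in> {p<..<q} \<longrightarrow> norm (\<psi> x) \<le> B"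
      using bnd_AE[OF b] unfolding AE_I by eventually_elim (use mem_I[OF s T] pq in auto)
    then have l: "norm (lint s t (seg p q \<psi>)) \<le> B * (q - p)" for t
      using pq(2) B by (rule lint_seg_norm_le)
    have V: "bnd 0 (vint s T (seg p q \<psi>)) (B * (q - p))"
      using l vint_G_infty[OF G s T] B pq(2) by (auto simp: vint_def seg_def)
    have "norm (x j (seg s T (\<lambda>t. a i j t * vint s T (seg p q \<psi>) t))) \<le> C * M * ((q - p) * B)" for j
    proof -
      have "bnd 0 (\<lambda>t. a i j t * vint s T (seg p q \<psi>) t) (2 ^ 0 * M * (B * (q - p)))"
        by (rule bnd_mult[OF M(2) V M(1)]) (use B pq in simp)
      then have "norm (x j (seg s T (\<lambda>t. a i j t * vint s T (seg p q \<psi>) t))) \<le> C * (2 ^ 0 * M * (B * (q - p)))"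
        by (rule C(2)) (use B M pq in simp)
      then show ?thesis by (simp add: mult_ac)
    qed
    then have "norm (\<Sum>j\<in>UNIV. x j (seg s T (\<lambda>t. a i j t * vint s T (seg p q \<psi>) t))) \<le> real CARD('n) * (C * M * ((q - p) * B))"
      by (intro sum_norm_bound)
    moreover have "norm (u i T * lint s T (seg p q \<psi>)) \<le> U * (B * (q - p))"
      unfolding norm_mult
    proof (rule mult_mono[OF _ l])
      show "norm (u i T) \<le> U" unfolding U_def by (rule member_le_sum) auto
      show "0 \<le> U" unfolding U_def by (intro sum_nonneg) auto
    qed simp
    moreover have "seg p q \<psi> = seg s T (seg p q \<psi>)" using pq by (simp add: seg_sub)
    ultimately have "norm (x i (seg p q \<psi>)) \<le> U * (B * (q - p)) + real CARD('n) * (C * M * ((q - p) * B))"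
      using x_seg_eq[OF s T sT G, of i] by (simp only:) (intro order_trans[OF norm_triangle_ineq4] add_mono)
    then show ?thesis by (simp add: algebra_simps)
  qed
  moreover have "0 \<le> U + real CARD('n) * (C * M)"
    using C M unfolding U_def by (auto intro!: add_nonneg_nonneg mult_nonneg_nonneg sum_nonneg)
  ultimately show ?thesis by blast
qed

lemma u_lipschitz:
  assumes s: "s \<in> I" and T: "T \<in> I" and sT: "s \<le> T"
  shows "\<exists>L\<ge>0. \<forall>i p q. s \<le> p \<longrightarrow> p \<le> q \<longrightarrow> q \<le> T \<longrightarrow> norm (u i q - u i p) \<le> L * (q - p)"
proof -
  obtain K where K: "K \<ge> 0" "\<And>i p q \<psi> B. s \<le> p \<Longrightarrow> p \<le> q \<Longrightarrow> q \<le> T \<Longrightarrow> bnd 0 \<psi> B \<Longrightarrow> 0 \<le> B \<Longrightarrow>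
           norm (x i (seg p q \<psi>)) \<le> K * (q - p) * B" using x_seg_bound[OF assms] by blast
  obtain M where M: "M \<ge> 0" "\<And>i j. bnd 0 (a i j) M" using ex_coeff_bound by blast
  have "norm (u i q - u i p) \<le> real CARD('n) * K * M * (q - p)" if pq: "s \<le> p" "p \<le> q" "q \<le> T" for i p q
  proof -
    have "p \<in> I" "q \<in> I" using mem_I[OF s T] pq by auto
    then have "norm (u i q - u i p) = norm (\<Sum>j\<in>UNIV. x j (seg p q (a i j)))" using u_diff pq by simp
    also have "\<dots> \<le> real CARD('n) * (K * (q - p) * M)"
      by (intro sum_norm_bound K(2) pq M)
    finally show ?thesis by (simp add: mult_ac)
  qed
  then show ?thesis using K(1) M(1) by (intro exI[of _ "real CARD('n) * K * M"]) auto
qed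

lemma ex_bracket: "t \<in> I \<Longrightarrow> \<exists>s T. s \<in> I \<and> T \<in> I \<and> s < t \<and> t < T"
proof -
  assume "t \<in> I"
  then obtain d where "d > 0" "cball t d \<subseteq> I" using open_I open_contains_cball by blast
  then show ?thesis by (intro exI[of _ "t - d"] exI[of _ "t + d"]) (auto simp: dist_real_def subset_iff)
qed

lemma u_continuous: "continuous_on I (u i)"
proof (intro continuous_at_imp_continuous_on ballI)
  fix t assume "t \<in> I"
  then obtain s T where st: "s \<in> I" "T \<in> I" "s < t" "t < T" using ex_bracket by blast
  obtain L where L: "L \<ge> 0" "\<And>p q. s \<le> p \<Longrightarrow> p \<le> q \<Longrightarrow> q \<le> T \<Longrightarrow> norm (u i q - u i p) \<le> L * (q - p)"
    using u_lipschitz[of s T] st by auto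
  have "L-lipschitz_on {s..T} (u i)"
  proof (rule lipschitz_onI[OF _ L(1)])
    fix p q assume "p \<in> {s..T}" "q \<in> {s..T}"
    then show "dist (u i p) (u i q) \<le> L * dist p q"
      using L(2)[of p q] L(2)[of q p] by (cases "p \<le> q") (auto simp: dist_norm norm_minus_commute)
  qed
  then have "continuous_on {s..T} (u i)" by (rule lipschitz_on_continuous_on)
  then have "continuous_on {s<..<T} (u i)" by (rule continuous_on_subset) auto
  then show "isCont (u i) t" using st by (simp add: continuous_on_eq_continuous_at)
qed

lemma seg_u_mult_GG:
  assumes "s \<in> I" "T \<in> I" "\<psi> \<in> GG I" shows "seg s T (\<lambda>t. u i t * \<psi> t) \<in> GG I"
proof -
  have "(\<lambda>t. seg s T (u i) t * \<psi> t) \<in> GG I" by (intro GG_mult seg_continuous_GG u_continuous assms)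
  moreover have "(\<lambda>t. seg s T (u i) t * \<psi> t) = seg s T (\<lambda>t. u i t * \<psi> t)" by (auto simp: seg_def)
  ultimately show ?thesis by simp
qed

lemma seg_u_mult_integrable:
  assumes "s \<in> I" "T \<in> I" "\<psi> \<in> GG I" shows "integrable lebesgue (seg s T (\<lambda>t. u i t * \<psi> t))"
  using seg_integrable[OF seg_u_mult_GG[OF assms] assms(1,2)] by simp

text \<open>In the identity on \<open>[p, q)\<close>, replacing \<open>u i q\<close> by
  \<open>u i t\<close> under the integral costs \<open>L * (q - p)\<close> times an integral of size
  \<open>B * (q - p)\<close>; in the remaining sum one factor \<open>q - p\<close> comes from the
  primitive and one from \<open>x_seg_bound\<close>. The defect \<open>D\<close> is additive over
  adjacent segments, so these estimates bound the increments of \<open>D s\<close>.\<close>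

lemma x_seg_eq_lint:
  assumes s: "s \<in> I" and T: "T \<in> I" and sT: "s \<le> T" and \<psi>: "\<psi> \<in> G_infty I"
  shows "x i (seg s T \<psi>) = lint s T (\<lambda>t. u i t * \<psi> t)"
proof -
  obtain K where K: "K \<ge> 0" "\<And>i p q \<psi> B. s \<le> p \<Longrightarrow> p \<le> q \<Longrightarrow> q \<le> T \<Longrightarrow> bnd 0 \<psi> B \<Longrightarrow> 0 \<le> B \<Longrightarrow>
           norm (x i (seg p q \<psi>)) \<le> K * (q - p) * B" using x_seg_bound[OF assms(1-3)] by blast
  obtain L where L: "L \<ge> 0" "\<And>p q. s \<le> p \<Longrightarrow> p \<le> q \<Longrightarrow> q \<le> T \<Longrightarrow> norm (u i q - u i p) \<le> L * (q - p)"
    using u_lipschitz[OF assms(1-3)] by blast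
  obtain M where M: "M \<ge> 0" "\<And>i j. bnd 0 (a i j) M" using ex_coeff_bound by blast
  obtain B where B: "B \<ge> 0" "bnd 0 \<psi> B" using bnd_exists[OF \<psi>] by blast
  have GG\<psi>: "\<psi> \<in> GG I" using \<psi> by (rule G_infty_GG)
  define D where "D p q = x i (seg p q \<psi>) - lint p q (\<lambda>t. u i t * \<psi> t)" for p q
  have quad: "norm (D p q) \<le> (L * B + real CARD('n) * (K * M * B)) * (q - p)^2" if pq: "s \<le> p" "p \<le> q" "q \<le> T" for p q
  proof -
    have p: "p \<in> I" and q: "q \<in> I" using mem_I[OF s T] pq by auto
    have aeB: "AE x in lebesgue. x \<in> {p<..<q} \<longrightarrow> norm (\<psi> x) \<le> B"
      using bnd_AE[OF B(2)] unfolding AE_I by eventually_elim (use mem_I[OF p q] in auto)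
    have l: "norm (lint p t \<psi>) \<le> B * (q - p)" if "p \<le> t" "t \<le> q" for t
    proof -
      have "AE x in lebesgue. x \<in> {p<..<t} \<longrightarrow> norm (\<psi> x) \<le> B" using aeB by eventually_elim (use that in auto)
      then have "norm (lint p t \<psi>) \<le> B * (t - p)" using that(1) by (rule lint_norm_le)
      also have "\<dots> \<le> B * (q - p)" using that B by (intro mult_left_mono) auto
      finally show ?thesis .
    qed
    have V: "bnd 0 (vint p q \<psi>) (B * (q - p))"
      using l vint_G_infty[OF \<psi> p q] B pq(2) by (auto simp: vint_def seg_def)
    have "norm (x j (seg p q (\<lambda>t. a i j t * vint p q \<psi> t))) \<le> K * (q - p) * (2 ^ 0 * M * (B * (q - p)))" for j
      by (rule K(2)[OF pq bnd_mult[OF M(2) V M(1)]]) (use B M pq in simp_all)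
    then have 1: "norm (\<Sum>j\<in>UNIV. x j (seg p q (\<lambda>t. a i j t * vint p q \<psi> t))) \<le> real CARD('n) * (K * (q - p) * (2 ^ 0 * M * (B * (q - p))))"
      by (intro sum_norm_bound)
    have "lint p q (\<lambda>t. u i q * \<psi> t + (-1) * (u i t * \<psi> t)) = u i q * lint p q \<psi> + (-1) * lint p q (\<lambda>t. u i t * \<psi> t)"
      by (rule lint_lin[OF seg_integrable[OF GG\<psi> p q] seg_u_mult_integrable[OF p q GG\<psi>]])
    then have 2: "u i q * lint p q \<psi> - lint p q (\<lambda>t. u i t * \<psi> t) = lint p q (\<lambda>t. (u i q - u i t) * \<psi> t)"
      by (simp add: algebra_simps)
    have 3: "norm (lint p q (\<lambda>t. (u i q - u i t) * \<psi> t)) \<le> L * (q - p) * B * (q - p)"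
    proof (rule lint_norm_le[OF _ pq(2)])
      show "AE t in lebesgue. t \<in> {p<..<q} \<longrightarrow> norm ((u i q - u i t) * \<psi> t) \<le> L * (q - p) * B"
        using aeB
      proof eventually_elim
        case (elim t)
        have "norm ((u i q - u i t) * \<psi> t) \<le> L * (q - p) * B" if t: "t \<in> {p<..<q}"
          unfolding norm_mult
        proof (rule mult_mono)
          have "norm (u i q - u i t) \<le> L * (q - t)" using L(2)[of t q] t pq by auto
          also have "\<dots> \<le> L * (q - p)" using L(1) t by (intro mult_left_mono) auto
          finally show "norm (u i q - u i t) \<le> L * (q - p)" .
          show "norm (\<psi> t) \<le> B" using elim t by blast
        qed (use L pq in auto)
        then show ?case by blast
      qed
    qed
    have "D p q = lint p q (\<lambda>t. (u i q - u i t) * \<psi> t) - (\<Sum>j\<in>UNIV. x j (seg p q (\<lambda>t. a i j t * vint p q \<psi> t)))"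
      unfolding D_def x_seg_eq[OF p q pq(2) \<psi>] 2[symmetric] by simp
    then have "norm (D p q) \<le> L * (q - p) * B * (q - p) + real CARD('n) * (K * (q - p) * (2 ^ 0 * M * (B * (q - p))))"
      using 1 3 by (simp only:) (intro order_trans[OF norm_triangle_ineq4] add_mono)
    then show ?thesis by (simp add: algebra_simps power2_eq_square)
  qed
  have add: "D s q - D s p = D p q" if pq: "s \<le> p" "p \<le> q" "q \<le> T" for p q
  proof -
    have p: "p \<in> I" and q: "q \<in> I" using mem_I[OF s T] pq by auto
    have "x i (seg s q \<psi>) = x i (seg s p \<psi>) + x i (seg p q \<psi>)"
      unfolding seg_split[OF pq(1,2)] by (rule RR_dual_add[OF x seg_RR[OF \<psi> s p] seg_RR[OF \<psi> p q]])
    moreover have "lint s q (\<lambda>t. u i t * \<psi> t) = lint s p (\<lambda>t. u i t * \<psi> t) + lint p q (\<lambda>t. u i t * \<psi> t)"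
      by (rule lint_split[OF seg_u_mult_integrable[OF s q GG\<psi>] pq(1,2)])
    ultimately show ?thesis by (simp add: D_def)
  qed
  have "D s T = D s s"
    by (rule eq_if_quadratic_increments[of s T "D s" "L * B + real CARD('n) * (K * M * B)", OF _ sT]) (use quad add in simp)
  also have "D s s = 0"
  proof -
    have "seg s s h = (\<lambda>_. 0)" for h by (auto simp: seg_def fun_eq_iff)
    then show ?thesis by (simp add: D_def lint_def RR_dual_zero[OF x])
  qed
  finally show ?thesis by (simp add: D_def)
qed

end

section \<open>From segments to the whole interval, and the classical equation\<close>

context distr_ode begin

lemma ex_seg_cover:
  assumes K: "compact K" "K \<subseteq> I" shows "\<exists>s T. s \<in> I \<and> T \<in> I \<and> s < T \<and> K \<subseteq> {s..<T}"
proof (cases "K = {}")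
  case True
  obtain t where "t \<in> I" using nonempty by blast
  from ex_bracket[OF this] obtain s T where "s \<in> I" "T \<in> I" "s < t" "t < T" by blast
  then show ?thesis using True by (intro exI[of _ s] exI[of _ T]) auto
next
  case False
  obtain m where m: "m \<in> K" "\<forall>k\<in>K. m \<le> k" using compact_attains_inf[OF K(1) False] by blast
  obtain M where M: "M \<in> K" "\<forall>k\<in>K. k \<le> M" using compact_attains_sup[OF K(1) False] by blast
  have "M \<in> I" using M K by blast
  \<comment> \<open>The right end lies strictly beyond the maximum of \<open>K\<close> because
    segments omit their right endpoint.\<close>
  from ex_bracket[OF this] obtain T where T: "T \<in> I" "M < T" by blast
  have "m \<le> M" using m M by blast
  then have "m < T" using T by simp
  moreover have "m \<in> I" using m K by blast
  moreover have "K \<subseteq> {m..<T}" using m(2) M(2) T(2) by (auto intro: le_less_trans)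
  ultimately show ?thesis using T(1) by blast
qed

lemma u_locally_summable: "locally_summable I (u i)"
  unfolding locally_summable_def
proof (intro allI impI)
  fix K :: "real set" assume K: "compact K \<and> K \<subseteq> I"
  then obtain s T where st: "s \<in> I" "T \<in> I" "K \<subseteq> {s..<T}" using ex_seg_cover by blast
  have "integrable lebesgue (seg s T (u i))"
    using seg_integrable[OF seg_continuous_GG[OF u_continuous st(1,2)] st(1,2), of i] by simp
  then have "integrable lebesgue (\<lambda>t. indicator K t *\<^sub>R seg s T (u i) t)"
  proof (rule integrable_mult_indicator[rotated])
    show "K \<in> sets lebesgue" using K by (simp add: borel_closed compact_imp_closed)
  qed
  moreover have "(\<lambda>t. indicator K t *\<^sub>R seg s T (u i) t) = (\<lambda>t. indicator K t *\<^sub>R u i t)"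
    using st(3) by (auto simp: seg_def indicator_def fun_eq_iff)
  ultimately show "set_integrable lebesgue K (u i)" by (simp add: set_integrable_def)
qed

lemma x_regular: "is_regular_distr I (x i) (u i)"
  unfolding is_regular_distr_def
proof (intro conjI ballI u_locally_summable)
  fix \<phi> assume \<phi>: "\<phi> \<in> RR I"
  then obtain K where K: "compact K" "K \<subseteq> I" "AE t in lebesgue_on I. t \<notin> K \<longrightarrow> \<phi> t = 0" by (auto simp: RR_def)
  obtain s T where st: "s \<in> I" "T \<in> I" "s < T" "K \<subseteq> {s..<T}" using ex_seg_cover[OF K(1,2)] by blast
  have G: "\<phi> \<in> G_infty I" using \<phi> by (rule RR_G_infty)
  have ae: "ae_eq I \<phi> (seg s T \<phi>)"
    using K(3) unfolding ae_eq_def by eventually_elim (use st(4) in \<open>auto simp: seg_def\<close>)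
  then have "x i \<phi> = x i (seg s T \<phi>)" using RR_dual_cong[OF x \<phi> seg_RR[OF G st(1,2)]] by blast
  also have "\<dots> = lint s T (\<lambda>t. u i t * \<phi> t)" using x_seg_eq_lint[OF st(1,2) _ G] st(3) by simp
  also have "\<dots> = (LINT t|lebesgue. indicator I t *\<^sub>R (u i t * \<phi> t))"
    unfolding lint_def
  proof (rule integral_cong_AE)
    show "seg s T (\<lambda>t. u i t * \<phi> t) \<in> borel_measurable lebesgue"
      using seg_u_mult_integrable[OF st(1,2) G_infty_GG[OF G]] by (rule borel_measurable_integrable)
    have "u i \<in> borel_measurable (lebesgue_on I)"
      by (intro continuous_imp_measurable_on_sets_lebesgue u_continuous) simp
    moreover have "\<phi> \<in> borel_measurable (lebesgue_on I)" by (intro GG_measurable G_infty_GG G)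
    ultimately have "(\<lambda>t. u i t * \<phi> t) \<in> borel_measurable (lebesgue_on I)" by (rule borel_measurable_times)
    then have "(\<lambda>t. if t \<in> I then u i t * \<phi> t else 0) \<in> borel_measurable lebesgue"
      by (subst borel_measurable_if) auto
    moreover have "(\<lambda>t. if t \<in> I then u i t * \<phi> t else 0) = (\<lambda>t. indicator I t *\<^sub>R (u i t * \<phi> t))"
      by (auto simp: indicator_def)
    ultimately show "(\<lambda>t. indicator I t *\<^sub>R (u i t * \<phi> t)) \<in> borel_measurable lebesgue" by simp
    show "AE t in lebesgue. seg s T (\<lambda>t. u i t * \<phi> t) t = indicator I t *\<^sub>R (u i t * \<phi> t)"
      using ae unfolding ae_eq_def AE_I
    proof eventually_elim
      case (elim t)
      then show ?case using mem_I[OF st(1,2), of t] by (cases "t \<in> I") (auto simp: seg_def split: if_splits)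
    qed
  qed
  also have "\<dots> = (LINT t|lebesgue_on I. u i t * \<phi> t)" by (rule integral_restrict_space[symmetric]) simp
  finally show "x i \<phi> = (LINT t|lebesgue_on I. u i t * \<phi> t)" .
qed

lemma u_increment:
  assumes p: "p \<in> I" and q: "q \<in> I" and pq: "p \<le> q"
  shows "u i q - u i p = lint p q (\<lambda>t. \<Sum>j\<in>UNIV. a i j t * u j t)"
proof -
  have "u i q - u i p = (\<Sum>j\<in>UNIV. lint p q (\<lambda>t. u j t * a i j t))"
    unfolding u_diff[OF assms] by (intro sum.cong refl x_seg_eq_lint p q pq a)
  also have "\<dots> = (LINT t|lebesgue. (\<Sum>j\<in>UNIV. seg p q (\<lambda>t. u j t * a i j t) t))"
    unfolding lint_def
    by (rule Bochner_Integration.integral_sum[symmetric]) (intro seg_u_mult_integrable p q G_infty_GG a)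
  also have "(\<lambda>t. \<Sum>j\<in>UNIV. seg p q (\<lambda>t. u j t * a i j t) t) = seg p q (\<lambda>t. \<Sum>j\<in>UNIV. a i j t * u j t)"
    by (auto simp: seg_def mult.commute fun_eq_iff)
  finally show ?thesis by (simp add: lint_def)
qed

text \<open>Near \<open>t0\<close> the function \<open>u i\<close> differs by a constant from the
  primitive of the cut right-hand side. That integrand equals both of its one-sided limits almost
  everywhere, and at such points the two one-sided derivatives agree with its value.\<close>

lemma u_deriv_AE:
  "AE t in lebesgue_on I. \<forall>i. (u i has_vector_derivative (\<Sum>j\<in>UNIV. a i j t * u j t)) (at t)"
proof (rule AE_local)
  fix t0 b assume "t0 \<in> I"
  then obtain s T where st: "s \<in> I" "T \<in> I" "s < t0" "t0 < T" using ex_bracket by blast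
  define \<phi> where "\<phi> i = seg s T (\<lambda>t. \<Sum>j\<in>UNIV. a i j t * u j t)" for i
  have \<phi>: "\<phi> i \<in> GG I" for i
  proof -
    have "(\<lambda>t. \<Sum>j\<in>UNIV. seg s T (\<lambda>t. u j t * a i j t) t) \<in> GG I"
      by (intro GG_sum seg_u_mult_GG G_infty_GG a st) simp
    moreover have "(\<lambda>t. \<Sum>j\<in>UNIV. seg s T (\<lambda>t. u j t * a i j t) t) = \<phi> i"
      by (auto simp: \<phi>_def seg_def mult.commute fun_eq_iff)
    ultimately show ?thesis by simp
  qed
  have int: "integrable lebesgue (\<phi> i)" for i
    using seg_integrable[OF \<phi> st(1,2), of i] by (simp add: \<phi>_def)
  have u_eq: "u i r - u i p = cumul (\<phi> i) r - cumul (\<phi> i) p" if "p \<in> {s<..<T}" "r \<in> {s<..<T}" for i p r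
  proof -
    have *: "u i r - u i p = cumul (\<phi> i) r - cumul (\<phi> i) p" if "s < p" "p \<le> r" "r < T" for p r
    proof -
      have pr: "p \<in> I" "r \<in> I" using mem_I[OF st(1,2)] that by auto
      show ?thesis unfolding cumul_diff[OF int that(2)] u_increment[OF pr that(2)]
        using that by (simp add: lint_def \<phi>_def seg_sub')
    qed
    show ?thesis
    proof (cases "p \<le> r")
      case True
      then show ?thesis using *[of p r] that by simp
    next
      case False
      then have "u i p - u i r = cumul (\<phi> i) p - cumul (\<phi> i) r" using *[of r p] that by simp
      then show ?thesis by (metis minus_diff_eq)
    qed
  qed
  have deriv: "(u i has_vector_derivative \<phi> i t) (at t)"
    if t: "t \<in> {s<..<T}" and sl: "\<phi> i t = slim True (\<phi> i) t" "\<phi> i t = slim False (\<phi> i) t" for i t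
  unfolding has_vector_derivative_complex_iff
  proof -
    have tI: "t \<in> I" using mem_I[OF st(1,2)] t by auto
    have "((\<lambda>r. (cumul (\<phi> i) r - cumul (\<phi> i) t) / of_real (r - t)) \<longlongrightarrow> \<phi> i t) (at t)"
    proof (rule filterlim_split_at)
      show "((\<lambda>r. (cumul (\<phi> i) r - cumul (\<phi> i) t) / of_real (r - t)) \<longlongrightarrow> \<phi> i t) (at_left t)"
        using cumul_deriv[OF int GG_tendsto[OF \<phi> tI, of i False]] sl by (simp add: at_side_def)
      show "((\<lambda>r. (cumul (\<phi> i) r - cumul (\<phi> i) t) / of_real (r - t)) \<longlongrightarrow> \<phi> i t) (at_right t)"
        using cumul_deriv[OF int GG_tendsto[OF \<phi> tI, of i True]] sl by (simp add: at_side_def)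
    qed
    moreover have "eventually (\<lambda>r. r \<in> {s<..<T}) (at t)"
      using t by (intro eventually_at_in_open') auto
    then have "eventually (\<lambda>r. (cumul (\<phi> i) r - cumul (\<phi> i) t) / of_real (r - t) = (u i r - u i t) / of_real (r - t)) (at t)"
      by eventually_elim (use u_eq[OF t] in simp)
    ultimately show "((\<lambda>r. (u i r - u i t) / of_real (r - t)) \<longlongrightarrow> \<phi> i t) (at t)"
      by (rule Lim_transform_eventually)
  qed
  have "AE t in lebesgue_on I. \<phi> i t = slim b (\<phi> i) t" for i b by (rule AE_slim[OF \<phi>])
  then have "AE t in lebesgue_on I. \<forall>i. \<phi> i t = slim True (\<phi> i) t \<and> \<phi> i t = slim False (\<phi> i) t"
    by (intro AE_finite_allI[of UNIV, simplified]) (auto intro: AE_conjI)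
  then have "eventually (\<lambda>t. \<forall>i. \<phi> i t = slim True (\<phi> i) t \<and> \<phi> i t = slim False (\<phi> i) t) (ess_side b t0)"
    using \<open>t0 \<in> I\<close> by (rule ev_of_AE)
  moreover have "eventually (\<lambda>t. t \<in> {s<..<T}) (ess_side b t0)"
    using st by (intro ess_side_eventually_at eventually_at_in_open') auto
  ultimately show "\<forall>\<^sub>F t in ess_side b t0. \<forall>i. (u i has_vector_derivative (\<Sum>j\<in>UNIV. a i j t * u j t)) (at t)"
  proof eventually_elim
    case (elim t)
    then have "\<phi> i t = (\<Sum>j\<in>UNIV. a i j t * u j t)" for i by (auto simp: \<phi>_def seg_def)
    then show ?case using deriv[OF elim(2)] elim(1) by metis
  qed
qed

lemma u_abs_continuous: "locally_abs_continuous I (\<lambda>t. \<chi> i. u i t)"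
  unfolding locally_abs_continuous_def
proof (intro allI impI)
  fix p0 q0 assume sub: "{p0..q0} \<subseteq> I"
  have "\<exists>L\<ge>0. \<forall>i p q. p0 \<le> p \<longrightarrow> p \<le> q \<longrightarrow> q \<le> q0 \<longrightarrow> norm (u i q - u i p) \<le> L * (q - p)"
  \<comment> \<open>For \<open>q0 < p0\<close> the endpoints may lie outside \<open>I\<close>, but
    then no admissible pair \<open>p\<close>, \<open>q\<close> exists and \<open>L = 0\<close> will
    do.\<close>
  proof (cases "p0 \<le> q0")
    case True
    then have "p0 \<in> I" "q0 \<in> I" using sub by auto
    then show ?thesis using u_lipschitz True by blast
  qed (auto intro!: exI[of _ 0])
  then obtain L where L: "L \<ge> 0" "\<And>i p q. p0 \<le> p \<Longrightarrow> p \<le> q \<Longrightarrow> q \<le> q0 \<Longrightarrow> norm (u i q - u i p) \<le> L * (q - p)" by blast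
  define N where "N = real CARD('n) * L"
  have N: "0 \<le> N" using L by (simp add: N_def)
  have lip: "norm ((\<chi> i. u i q) - (\<chi> i. u i p) :: complex^'n) \<le> N * (q - p)" if pq: "p0 \<le> p" "p \<le> q" "q \<le> q0" for p q
  proof -
    have "norm ((\<chi> i. u i q) - (\<chi> i. u i p) :: complex^'n) \<le> (\<Sum>i\<in>UNIV. norm (((\<chi> i. u i q) - (\<chi> i. u i p) :: complex^'n) $ i))"
      unfolding norm_vec_def by (rule L2_set_le_sum) simp
    also have "\<dots> \<le> real CARD('n) * (L * (q - p))"
      by (rule sum_bounded_above) (use L(2) pq in simp)
    finally show ?thesis by (simp add: N_def mult_ac)
  qed
  show "abs_continuous_on_interval p0 q0 (\<lambda>t. \<chi> i. u i t)"
    unfolding abs_continuous_on_interval_def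
  proof (intro allI impI)
    fix e :: real assume e: "e > 0"
    show "\<exists>\<delta>>0. \<forall>P. finite P \<and> (\<forall>(p, q)\<in>P. p0 \<le> p \<and> p \<le> q \<and> q \<le> q0) \<and> disjoint_family_on (\<lambda>(p, q). {p<..<q}) P \<and> (\<Sum>(p, q)\<in>P. q - p) < \<delta> \<longrightarrow>
       (\<Sum>(p, q)\<in>P. norm ((\<chi> i. u i q) - (\<chi> i. u i p) :: complex^'n)) < e"
    \<comment> \<open>A Lipschitz function with constant \<open>N\<close> is absolutely continuous
      with this choice; the 1 covers \<open>N = 0\<close> and makes the final inequality
      strict.\<close>
    proof (intro exI[of _ "e / (N + 1)"] conjI allI impI)
      show "0 < e / (N + 1)" using e N by simp
      fix P :: "(real \<times> real) set"
      assume P: "finite P \<and> (\<forall>(p, q)\<in>P. p0 \<le> p \<and> p \<le> q \<and> q \<le> q0) \<and> disjoint_family_on (\<lambda>(p, q). {p<..<q}) P \<and> (\<Sum>(p, q)\<in>P. q - p) < e / (N + 1)"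
      have "(\<Sum>(p, q)\<in>P. norm ((\<chi> i. u i q) - (\<chi> i. u i p) :: complex^'n)) \<le> (\<Sum>(p, q)\<in>P. N * (q - p))"
        by (rule sum_mono) (use P lip in auto)
      also have "\<dots> = N * (\<Sum>(p, q)\<in>P. q - p)" by (simp add: sum_distrib_left case_prod_unfold)
      also have "\<dots> \<le> N * (e / (N + 1))" using P N by (intro mult_left_mono) auto
      also have "\<dots> < e" using e N by (simp add: field_simps)
      finally show "(\<Sum>(p, q)\<in>P. norm ((\<chi> i. u i q) - (\<chi> i. u i p) :: complex^'n)) < e" .
    qed
  qed
qed

end

theorem theorem3p1:
  fixes a b :: ereal
    and A :: "real \<Rightarrow> complex^'n^'n"
    and x :: "cdistr^'n"
  assumes "a < b"
    and "\<And>i j. (\<lambda>t. A t $ i $ j) \<in> G_infty (einterval a b)"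
    and "distr_solution (einterval a b) A x"
  shows "\<exists>u :: real \<Rightarrow> complex^'n. classical_solution (einterval a b) A u \<and>
           (\<forall>i. is_regular_distr (einterval a b) (x $ i) (\<lambda>t. u t $ i))"
proof -
  let ?I = "einterval a b"
  obtain x' where x': "\<forall>i. x' $ i \<in> DD ?I (x $ i)" "\<forall>\<phi>\<in>RR ?I. \<forall>i. (x' $ i) \<phi> = (mat_mult_distr A x $ i) \<phi>"
    and x: "\<forall>i. x $ i \<in> RR_dual ?I" using assms(3) unfolding distr_solution_def by blast
  have "\<forall>i. \<exists>g. g \<in> Delta ?I \<and> x' $ i = (\<lambda>\<phi>. ddt ?I (x $ i) \<phi> + g \<phi>)"
    using x'(1) unfolding DD_def by blast
  then obtain g where g: "\<And>i. g i \<in> Delta ?I" "\<And>i. x' $ i = (\<lambda>\<phi>. ddt ?I (x $ i) \<phi> + g i \<phi>)" by metis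
  have "\<forall>i. \<exists>c. \<forall>\<phi>\<in>RR_F ?I. g i \<phi> = (\<Sum>t | t \<in> ?I \<and> jump t \<phi> \<noteq> 0. c t * jump t \<phi>)"
    using g(1) unfolding Delta_def by blast
  then obtain c where c: "\<And>i \<phi>. \<phi> \<in> RR_F ?I \<Longrightarrow> g i \<phi> = (\<Sum>t | t \<in> ?I \<and> jump t \<phi> \<noteq> 0. c i t * jump t \<phi>)" by metis
  have gd: "g i \<in> RR_dual ?I" for i using g(1)[of i] by (simp add: Delta_def)
  have eq: "- (x $ i) (gder ?I \<phi>) + g i \<phi> = (\<Sum>j\<in>UNIV. (x $ j) (\<lambda>t. A t $ i $ j * \<phi> t))" if "\<phi> \<in> RR ?I" for i \<phi>
    using x'(2)[rule_format, OF that, of i] unfolding g(2) by (simp add: ddt_def mat_mult_distr_def mult_distr_def)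
  have "is_interval ?I" unfolding is_interval_1 einterval_def
    by (auto, metis ereal_less_eq(3) less_le_trans, metis ereal_less_eq(3) le_less_trans)
  moreover have "?I \<noteq> {}" using einterval_nonempty[OF assms(1)] by blast
  ultimately interpret distr_ode ?I "\<lambda>i j t. A t $ i $ j" "\<lambda>i. x $ i" g c
    using assms(2) x gd c eq by unfold_locales auto
  let ?u = "\<lambda>t. \<chi> i. u i t"
  have "AE t in lebesgue_on ?I. (?u has_vector_derivative (A t *v ?u t)) (at t)"
    using u_deriv_AE
  proof eventually_elim
    case (elim t)
    then show ?case by (intro has_vector_derivative_vecI) (simp add: matrix_vector_mult_def)
  qed
  then have "classical_solution ?I A ?u"
    using u_abs_continuous by (simp add: classical_solution_def)
  then show ?thesis using x_regular by (intro exI[of _ ?u]) simp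
qed

end
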